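(* Let $p$ and $q$ be irreducible monic polynomials with degree $2$ over $\mathbb{F}$. Assume that $p$ is separable and that $q$ is inseparable. Let $u$ be an endomorphism of a finite-dimensional vector space $V$ over $\mathbb{F}$. Then, the following conditions are equivalent: (i) $u$ is a q-exceptional $(p,q)$-quotient. (ii) The minimal polynomial of $u$ is a power of $G_{p,q}$ and the invariant factors of $u$ read $r_1,\dots,r_k,\dots$, where, for each positive integer $k$, either $r_{2k}=r_{2k-1}$ or $r_{2k-1}=r_{2k}\,G_{p,q}$. (iii) In some basis of $V$, the endomorphism $u$ is represented by a block-diagonal matrix in which every diagonal block equals $C(G_{p,q}^{n+\epsilon})\oplus C(G_{p,q}^n)$ for some non-negative integer $n$ and some $\epsilon\in\{0,1\}$.
   Context: $\mathbb{F}$ is a field with algebraic closure $\overline{\mathbb{F}}$. $\operatorname{Root}(p)$ is the set of roots of $p$ in $\overline{\mathbb{F}}$. If $p(t)=(t-x_1)(t-x_2)$ and $q(t)=(t-y_1)(t-y_2)$ in $\overline{\mathbb{F}}[t]$, with $p(0)q(0)\neq0$, then $G_{p,q}(t):=\prod_{1\leq i,j\leq 2}\bigl(t-x_iy_j^{-1}\bigr)$, a monic polynomial of degree $4$ in $\mathbb{F}[t]$. An endomorphism $u$ of $V$ is a $(p,q)$-quotient if $u=ab^{-1}$ for some automorphisms $a,b$ of $V$ with $p(a)=0$ and $q(b)=0$. It is q-exceptional with respect to $(p,q)$ if all its eigenvalues in $\overline{\mathbb{F}}$ belong to $\operatorname{Root}(p)\operatorname{Root}(q)^{-1}=\{xy^{-1}: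 x\in\operatorname{Root}(p),\,y\in\operatorname{Root}(q)\}$; a q-exceptional $(p,q)$-quotient is a $(p,q)$-quotient that is q-exceptional with respect to $(p,q)$. $C(r)$ is the companion matrix of the monic polynomial $r$ ($C(1)$ is the $0\times0$ matrix), and $\oplus$ is block-diagonal sum. The invariant factors of $u$ are the monic polynomials $r_1,r_2,\dots$ with $r_{i+1}\mid r_i$ such that $u$ is represented in some basis by $C(r_1)\oplus C(r_2)\oplus\cdots$; the finite list of nonconstant ones is extended to an infinite sequence by $r_i=1$. *)

theory Defs
  imports "HOL-Algebra.Algebraic_Closure_Type" "Jordan_Normal_Form.Char_Poly"
begin

section \<open>Polynomials and their roots in the algebraic closure\<close>

definition ac_roots :: "'a::field poly \<Rightarrow> 'a alg_closure set" where
  "ac_roots p = {x. poly (map_poly to_ac p) x = 0}"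

text \<open>A polynomial is separable if all its roots in the algebraic closure are simple
  (\<^const>\<open>rsquarefree\<close> says that every root has order one).\<close>

definition separable_poly :: "'a::field poly \<Rightarrow> bool" where
  "separable_poly p \<longleftrightarrow> rsquarefree (map_poly to_ac p)"

text \<open>The product runs over the roots counted with multiplicity. It is formed over the
  algebraic closure, and \<open>G_poly\<close> is the polynomial over the base field that maps to it; see
  \<open>map_poly_G_poly\<close> below for its existence when \<open>p\<close>, \<open>q\<close> are monic of degree 2 and
  \<open>q(0)\<close> is nonzero.\<close>

definition G_poly :: "'a::field poly \<Rightarrow> 'a poly \<Rightarrow> 'a poly" where
  "G_poly p q = (THE g. map_poly to_ac g =
     (\<Prod>x\<in>#proots (map_poly to_ac p). \<Prod>y\<in>#proots (map_poly to_ac q). [:- (x * inverse y), 1:]))"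

lemma map_poly_to_ac_inj:
  assumes "map_poly to_ac f = map_poly to_ac g"
  shows "f = g"
proof (rule poly_eqI)
  fix n
  have "Polynomial.coeff (map_poly to_ac f) n = Polynomial.coeff (map_poly to_ac g) n"
    using assms by simp
  thus "Polynomial.coeff f n = Polynomial.coeff g n"
    by (simp add: coeff_map_poly)
qed

lemma proots_two_linear:
  "proots ([:- x1, 1:] * [:- x2, 1:] :: 'b::idom poly) = {#x1, x2#}"
proof -
  have "proots ([:- x1, 1:] * [:- x2, 1:]) = proots [:- x1, 1:] + proots [:- x2, 1:]"
    by (rule proots_mult) auto
  thus ?thesis
    by simp
qed

lemma map_poly_G_poly:
  fixes p q :: "'a::field poly"
  assumes p: "map_poly to_ac p = [:- x1, 1:] * [:- x2, 1:]"
    and q: "map_poly to_ac q = [:- y1, 1:] * [:- y2, 1:]"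
    and q0: "poly q 0 \<noteq> 0"
  shows "map_poly to_ac (G_poly p q) =
    [:- (x1 * inverse y1), 1:] * [:- (x1 * inverse y2), 1:] *
    [:- (x2 * inverse y1), 1:] * [:- (x2 * inverse y2), 1:]" (is "_ = ?P")
proof -
  define a b c d where "a = Polynomial.coeff p 1" and "b = Polynomial.coeff p 0"
    and "c = Polynomial.coeff q 1" and "d = Polynomial.coeff q 0"
  have cp: "to_ac (Polynomial.coeff p n) = Polynomial.coeff ([:- x1, 1:] * [:- x2, 1:]) n" for n
    by (metis p coeff_map_poly to_ac_0)
  have cq: "to_ac (Polynomial.coeff q n) = Polynomial.coeff ([:- y1, 1:] * [:- y2, 1:]) n" for n
    by (metis q coeff_map_poly to_ac_0)
  have a: "to_ac a = - x1 - x2" and b: "to_ac b = x1 * x2"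
    using cp[of 1] cp[of 0] by (simp_all add: a_def b_def)
  have c: "to_ac c = - y1 - y2" and d: "to_ac d = y1 * y2"
    using cq[of 1] cq[of 0] by (simp_all add: c_def d_def)
  have "d \<noteq> 0"
    using q0 by (simp add: d_def poly_0_coeff_0)
  hence y: "y1 \<noteq> 0" "y2 \<noteq> 0"
    using d by (metis mult_zero_left mult_zero_right to_ac_eq_0_iff)+
  define g where "g = [:b\<^sup>2 / d\<^sup>2, - (a * b * c) / d\<^sup>2,
     b * (c\<^sup>2 - (d + d)) / d\<^sup>2 + a\<^sup>2 / d, - (a * c) / d, 1:]"
  have ex: "map_poly to_ac g = ?P"
    using y by (simp add: g_def map_poly_pCons a b c d field_simps power2_eq_square)
  have prods: "(\<Prod>x\<in>#proots (map_poly to_ac p). \<Prod>y\<in>#proots (map_poly to_ac q).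
      [:- (x * inverse y), 1:]) = ?P"
    unfolding p q proots_two_linear by (simp only: image_mset_add_mset image_mset_empty
      prod_mset.add_mset prod_mset.empty mult_1_right mult.assoc)
  have "G_poly p q = g"
    unfolding G_poly_def prods
    by (rule the_equality) (auto simp: ex intro: map_poly_to_ac_inj)
  thus ?thesis
    using ex by simp
qed

section \<open>Companion matrices\<close>

definition companion :: "'a::field poly \<Rightarrow> 'a mat" where
  "companion r = mat (degree r) (degree r)
     (\<lambda>(i, j). if j = degree r - 1 then - Polynomial.coeff r i else if i = Suc j then 1 else 0)"

section \<open>Endomorphisms of a vector space\<close>

text \<open>Throughout, \<open>scale\<close> is the scalar multiplication of a vector space in the sense of the
  locale \<^locale>\<open>vector_space\<close>, whose carrier is the whole type \<^typ>\<open>'b\<close>.\<close>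

type_synonym ('a, 'b) smult_op = "'a \<Rightarrow> 'b \<Rightarrow> 'b"

definition endomorphism :: "('a::field, 'b::ab_group_add) smult_op \<Rightarrow> ('b \<Rightarrow> 'b) \<Rightarrow> bool" where
  "endomorphism scale u \<longleftrightarrow> Vector_Spaces.linear scale scale u"

definition automorphism :: "('a::field, 'b::ab_group_add) smult_op \<Rightarrow> ('b \<Rightarrow> 'b) \<Rightarrow> bool" where
  "automorphism scale u \<longleftrightarrow> endomorphism scale u \<and> bij u"

definition poly_endo ::
  "('a::field, 'b::ab_group_add) smult_op \<Rightarrow> 'a poly \<Rightarrow> ('b \<Rightarrow> 'b) \<Rightarrow> 'b \<Rightarrow> 'b" where
  "poly_endo scale f u v = (\<Sum>i\<le>degree f. scale (Polynomial.coeff f i) ((u ^^ i) v))"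

definition annihilates ::
  "('a::field, 'b::ab_group_add) smult_op \<Rightarrow> 'a poly \<Rightarrow> ('b \<Rightarrow> 'b) \<Rightarrow> bool" where
  "annihilates scale f u \<longleftrightarrow> (\<forall>v. poly_endo scale f u v = 0)"

definition min_poly :: "('a::field, 'b::ab_group_add) smult_op \<Rightarrow> ('b \<Rightarrow> 'b) \<Rightarrow> 'a poly" where
  "min_poly scale u = (THE m. lead_coeff m = 1 \<and> annihilates scale m u \<and>
     (\<forall>f. annihilates scale f u \<longrightarrow> m dvd f))"

text \<open>Ordered bases are lists, so the zero space has the basis \<open>[]\<close> and a 0 by 0 matrix.\<close>

definition ordered_basis :: "('a::field, 'b::ab_group_add) smult_op \<Rightarrow> 'b list \<Rightarrow> bool" where
  "ordered_basis scale bs \<longleftrightarrow> distinct bs \<and> \<not> module.dependent scale (set bs) \<and>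
     module.span scale (set bs) = UNIV"

definition represented_by ::
  "('a::field, 'b::ab_group_add) smult_op \<Rightarrow> ('b \<Rightarrow> 'b) \<Rightarrow> 'a mat \<Rightarrow> bool" where
  "represented_by scale u M \<longleftrightarrow>
     (\<exists>bs. ordered_basis scale bs \<and> M \<in> carrier_mat (length bs) (length bs) \<and>
        (\<forall>j<length bs. u (bs ! j) = (\<Sum>i<length bs. scale (M $$ (i, j)) (bs ! i))))"

text \<open>Eigenvalues in the algebraic closure are those of a representing matrix, viewed as a matrix
  over the algebraic closure; they do not depend on the basis.\<close>

definition ac_eigenvalues ::
  "('a::field, 'b::ab_group_add) smult_op \<Rightarrow> ('b \<Rightarrow> 'b) \<Rightarrow> 'a alg_closure set" where
  "ac_eigenvalues scale u = {z. \<exists>M. represented_by scale u M \<and> eigenvalue (map_mat to_ac M) z}"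

definition pq_quotient ::
  "('a::field, 'b::ab_group_add) smult_op \<Rightarrow> 'a poly \<Rightarrow> 'a poly \<Rightarrow> ('b \<Rightarrow> 'b) \<Rightarrow> bool" where
  "pq_quotient scale p q u \<longleftrightarrow> (\<exists>a b. automorphism scale a \<and> automorphism scale b \<and>
     annihilates scale p a \<and> annihilates scale q b \<and> u = a \<circ> inv_into UNIV b)"

definition q_exceptional ::
  "('a::field, 'b::ab_group_add) smult_op \<Rightarrow> 'a poly \<Rightarrow> 'a poly \<Rightarrow> ('b \<Rightarrow> 'b) \<Rightarrow> bool" where
  "q_exceptional scale p q u \<longleftrightarrow>
     ac_eigenvalues scale u \<subseteq> {x * inverse y | x y. x \<in> ac_roots p \<and> y \<in> ac_roots q}"

text \<open>The sequence of invariant factors is indexed from 1; \<open>r 0\<close> is irrelevant.\<close>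

definition invariant_factors ::
  "('a::field, 'b::ab_group_add) smult_op \<Rightarrow> ('b \<Rightarrow> 'b) \<Rightarrow> (nat \<Rightarrow> 'a poly) \<Rightarrow> bool" where
  "invariant_factors scale u r \<longleftrightarrow>
     (\<forall>i\<ge>1. lead_coeff (r i) = 1 \<and> r (Suc i) dvd r i) \<and>
     (\<exists>m. (\<forall>i>m. r i = 1) \<and>
        represented_by scale u (diag_block_mat (map (\<lambda>i. companion (r i)) [1..<Suc m])))"

end

theory Submission
  imports Defs
begin

text \<open>
  Inseparability of \<open>q\<close> forces characteristic two: \<open>q = t\<^sup>2 + \<delta>\<close> and \<open>p = t\<^sup>2 + \<tau>t + \<alpha>\<close> with
  \<open>\<tau> \<noteq> 0\<close>, and \<open>G = t\<^sup>4 + (\<tau>\<^sup>2/\<delta>)t\<^sup>2 + \<kappa>\<^sup>2\<close> with \<open>\<kappa> = \<alpha>/\<delta>\<close> is irreducible of degree four.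

  If \<open>u = a b\<^sup>-\<^sup>1\<close>, then \<open>P = bab + \<delta>a\<close> satisfies \<open>P u = \<kappa>u\<^sup>-\<^sup>1 P\<close> and \<open>G(u) = \<delta>\<^sup>-\<^sup>3 u\<^sup>2 P\<^sup>2\<close>.
  Conversely, given such a \<open>P\<close> with \<open>G(u)\<close> nilpotent, one recovers \<open>b = s\<^sup>-\<^sup>1(P + \<tau>\<delta>)\<close> and
  \<open>a = ub\<close>, where \<open>s = \<delta>(u + \<kappa>u\<^sup>-\<^sup>1)\<close>.

  When \<open>G(u)\<close> is nilpotent, \<open>F[u]\<close> and \<open>P\<close> generate a ring that behaves like a quotient of a
  noncommutative discrete valuation ring with uniformizer \<open>P\<close> and residue field \<open>F[t]/(G)\<close>. So the
  space is a direct sum of uniserial modules. One of length \<open>m\<close> generated by \<open>v\<close> is, over \<open>F[u]\<close>,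
  the sum of the cyclic modules generated by \<open>v\<close> and \<open>Pv\<close>, with annihilators \<open>G\<close> to the powers
  \<open>\<lceil>m/2\<rceil>\<close> and \<open>\<lfloor>m/2\<rfloor>\<close>. Conversely, on a sum of two such cyclic modules, \<open>P\<close> is defined by exchanging
  the generators up to a factor.
\<close>

text \<open>The operator \<open>P\<close> comes from \<open>b\<close>. Put w = \<kappa> u^-1. The
  element s = ab + ba + \<tau>b = \<delta>(u + w) commutes with \<open>a\<close> and
  \<open>b\<close>, and b u = w b + \<tau>: up to a constant, \<open>b\<close> exchanges
  \<open>u\<close> and \<open>w\<close>. The combination s b + \<tau>\<delta>, which expands to
  \<open>P\<close>, absorbs that constant. In characteristic two its square has no cross term, so it
  is \<delta> s^2 + \<tau>^2 \<delta>^2 = \<delta>^3 (u^2 + w^2 + \<tau>^2/\<delta>), a multiple of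
  u^-2 G(u). Going back requires division by s = \<delta> u^-1 (u^2 + \<kappa>), which is possible
  because u^2 + \<kappa> has degree two and is prime to the irreducible quartic \<open>G\<close>.

  The obstacle is that \<open>P\<close> does not commute with \<open>u\<close>: a decomposition over
  F[u] alone need not respect \<open>P\<close> and would not explain why exponents come in pairs.
  Hence the space is decomposed over \<open>u\<close> and \<open>P\<close> together, and the cyclic
  summands for \<open>u\<close> are read off afterwards. Invariant factors bring a difficulty of
  their own: sorting the exponents breaks up these pairs, and a new pairing has to be found by
  counting.\<close>

text \<open>A locale of its own, so that nothing below is inherited by the global interpretations of
  \<^locale>\<open>vector_space\<close> such as real vector spaces.\<close>

locale plain_vector_space = vector_space scale
  for scale :: "'a::field \<Rightarrow> 'b::ab_group_add \<Rightarrow> 'b"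
begin

section \<open>Polynomials in an endomorphism\<close>

abbreviation endo :: "('b \<Rightarrow> 'b) \<Rightarrow> bool" where
  "endo u \<equiv> Vector_Spaces.linear scale scale u"

abbreviation ev :: "('b \<Rightarrow> 'b) \<Rightarrow> 'a poly \<Rightarrow> 'b \<Rightarrow> 'b" where
  "ev u f \<equiv> poly_endo scale f u"

lemma endoI:
  assumes "\<And>x y. u (x + y) = u x + u y" "\<And>c x. u (scale c x) = scale c (u x)"
  shows "endo u"
  by unfold_locales (simp_all add: assms)

lemma endo_add: "endo u \<Longrightarrow> u (x + y) = u x + u y"
  by (simp add: linear_iff_module_hom module_hom.add)

lemma endo_scale: "endo u \<Longrightarrow> u (scale c x) = scale c (u x)"
  by (simp add: linear_iff_module_hom module_hom.scale)

lemma endo_zero: "endo u \<Longrightarrow> u 0 = 0"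
  by (simp add: linear_iff_module_hom module_hom.zero)

lemma endo_sum: "endo u \<Longrightarrow> u (sum g A) = (\<Sum>x\<in>A. u (g x))"
  by (simp add: linear_iff_module_hom module_hom.sum)

lemma endo_funpow: "endo u \<Longrightarrow> endo (u ^^ n)"
  by (induction n) (auto intro!: endoI simp: endo_add endo_scale)

lemma ev_bound: "degree f < n \<Longrightarrow> ev u f v = (\<Sum>i<n. scale (Polynomial.coeff f i) ((u ^^ i) v))"
  unfolding poly_endo_def
  by (rule sum.mono_neutral_left) (auto simp: coeff_eq_0)

lemma ev_0 [simp]: "ev u 0 v = 0"
  by (simp add: poly_endo_def)

lemma ev_1 [simp]: "ev u 1 v = v"
  by (simp add: poly_endo_def)

lemma ev_pCons: 
  assumes "endo u"
  shows "ev u (pCons a f) v = scale a v + u (ev u f v)"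
proof -
  have "ev u (pCons a f) v = (\<Sum>i<Suc (Suc (degree f)). scale (Polynomial.coeff (pCons a f) i) ((u ^^ i) v))"
    by (rule ev_bound) (metis degree_pCons_le less_Suc_eq_le)
  also have "\<dots> = scale a v + (\<Sum>i<Suc (degree f). scale (Polynomial.coeff f i) (u ((u ^^ i) v)))"
    by (subst sum.lessThan_Suc_shift) (simp del: sum.lessThan_Suc)
  also have "(\<Sum>i<Suc (degree f). scale (Polynomial.coeff f i) (u ((u ^^ i) v))) = u (ev u f v)"
    by (simp only: ev_bound[OF lessI] endo_sum[OF assms] endo_scale[OF assms])
  finally show ?thesis .
qed

lemma ev_endo: "endo u \<Longrightarrow> endo (ev u f)"
proof (induction f)
  case 0
  then show ?case
    by (auto intro!: endoI)
next
  case (pCons a f)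
  then show ?case
    by (auto intro!: endoI simp: ev_pCons endo_add endo_scale algebra_simps)
qed

lemma ev_commute: "endo u \<Longrightarrow> ev u f (u v) = u (ev u f v)"
  by (induction f arbitrary: v) (simp_all add: ev_pCons endo_zero endo_add endo_scale)

lemma ev_add: "endo u \<Longrightarrow> ev u (f + g) v = ev u f v + ev u g v"
proof -
  define n where "n = Suc (max (degree f) (degree g))"
  have "degree (f + g) < n" "degree f < n" "degree g < n"
    by (auto simp: n_def less_Suc_eq_le degree_add_le)
  then show ?thesis
    by (simp add: ev_bound scale_left_distrib sum.distrib)
qed

lemma ev_smult: "endo u \<Longrightarrow> ev u (Polynomial.smult c f) v = scale c (ev u f v)"
  by (induction f) (simp_all add: ev_pCons endo_scale algebra_simps)

lemma ev_mult: "endo u \<Longrightarrow> ev u (f * g) v = ev u f (ev u g v)"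
  by (induction f) (simp_all add: ev_pCons ev_add ev_smult)

lemma ev_mult': "endo u \<Longrightarrow> ev u (f * g) v = ev u g (ev u f v)"
  by (metis ev_mult mult.commute)

lemma ev_diff: "endo u \<Longrightarrow> ev u (f - g) v = ev u f v - ev u g v"
  using ev_add[of u "f - g" g v] by (simp add: algebra_simps)

lemma ev_sum: "endo u \<Longrightarrow> ev u (sum f A) v = (\<Sum>x\<in>A. ev u (f x) v)"
  by (induction A rule: infinite_finite_induct) (simp_all add: ev_add)

lemma ev_monom: "endo u \<Longrightarrow> ev u (Polynomial.monom c n) v = scale c ((u ^^ n) v)"
  by (induction n) (simp_all add: ev_pCons endo_scale endo_zero monom_0 monom_Suc)

lemma ev_dvd:
  assumes "endo u" "f dvd g" "ev u f v = 0"
  shows "ev u g v = 0"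
  using assms by (auto elim!: dvdE simp: ev_mult' endo_zero[OF ev_endo])

lemma ev_mod:
  assumes u: "endo u" and r: "ev u r v = 0"
  shows "ev u (f mod r) v = ev u f v"
proof -
  have "ev u (f mod r) v = ev u f v - ev u (f div r * r) v"
    by (simp flip: minus_div_mult_eq_mod ev_diff[OF u])
  then show ?thesis
    by (simp add: r ev_mult[OF u] endo_zero[OF ev_endo[OF u]])
qed

text \<open>Read \<open>w\<close> as \<open>\<kappa>\<close> times the inverse of \<open>u\<close>.
  Since t -> \<kappa>/t is an involution, an operator that turns \<open>u\<close> into
  \<open>w\<close> also turns \<open>w\<close> into \<open>u\<close>.\<close>

lemma intertwiner_conj:
  assumes u: "endo u" and P: "endo P" and \<kappa>: "\<kappa> \<noteq> 0"
    and uw: "\<And>x. u (w x) = scale \<kappa> x" and Pu: "\<And>x. P (u x) = w (P x)"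
  shows "P (w x) = u (P x)"
proof -
  have "scale \<kappa> (P (w x)) = u (P (u (w x)))"
    by (subst Pu) (simp only: uw)
  then show ?thesis
    using \<kappa> by (simp add: uw endo_scale[OF u] endo_scale[OF P])
qed

section \<open>Companion matrices and cyclic decompositions\<close>

text \<open>The matrix condition of \<open>represented_by\<close> without the demand that the list
  be a basis, so that it can be split along diagonal blocks and also applied to dependent
  vectors.\<close>

definition acts_by :: "('b \<Rightarrow> 'b) \<Rightarrow> 'b list \<Rightarrow> 'a mat \<Rightarrow> bool" where
  "acts_by u bs M \<longleftrightarrow> M \<in> carrier_mat (length bs) (length bs) \<and>
     (\<forall>j<length bs. u (bs ! j) = (\<Sum>i<length bs. scale (M $$ (i, j)) (bs ! i)))"

lemma represented_by_iff:
  "represented_by scale u M \<longleftrightarrow> (\<exists>bs. ordered_basis scale bs \<and> acts_by u bs M)"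
  by (auto simp: represented_by_def acts_by_def)

definition chain :: "('b \<Rightarrow> 'b) \<Rightarrow> 'b \<Rightarrow> nat \<Rightarrow> 'b list" where
  "chain u v n = map (\<lambda>i. (u ^^ i) v) [0..<n]"

lemma length_chain [simp]: "length (chain u v n) = n"
  by (simp add: chain_def)

lemma nth_chain [simp]: "i < n \<Longrightarrow> chain u v n ! i = (u ^^ i) v"
  by (simp add: chain_def)

lemma set_chain: "set (chain u v n) = (\<lambda>i. (u ^^ i) v) ` {..<n}"
  by (auto simp: chain_def)

lemma sum_lessThan_add:
  fixes f :: "nat \<Rightarrow> 'c::comm_monoid_add"
  shows "(\<Sum>i<m + n. f i) = (\<Sum>i<m. f i) + (\<Sum>i<n. f (m + i))"
  by (induction n) (simp_all add: add.assoc)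

lemma all_less_add_iff:
  fixes m n :: nat
  shows "(\<forall>j<m + n. P j) \<longleftrightarrow> (\<forall>j<m. P j) \<and> (\<forall>j<n. P (m + j))"
proof safe
  fix j assume "\<forall>j<m. P j" "\<forall>j<n. P (m + j)" "j < m + n"
  then show "P j"
    by (cases "j < m") (auto dest: spec[of _ "j - m"])
qed simp_all

lemma acts_by_append:
  assumes "A \<in> carrier_mat (length xs) (length xs)" "D \<in> carrier_mat (length ys) (length ys)"
  shows "acts_by u (xs @ ys) (four_block_mat A (0\<^sub>m (dim_row A) (dim_col D)) (0\<^sub>m (dim_row D) (dim_col A)) D)
    \<longleftrightarrow> acts_by u xs A \<and> acts_by u ys D"
  using assms unfolding acts_by_def
  by (auto simp: all_less_add_iff sum_lessThan_add nth_append)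

lemma companion_carrier: "companion r \<in> carrier_mat (degree r) (degree r)"
  by (simp add: companion_def)

lemma companion_column:
  assumes "j < degree r" "length bs = degree r"
  shows "(\<Sum>i<degree r. scale (companion r $$ (i, j)) (bs ! i)) =
    (if Suc j < degree r then bs ! Suc j
     else - (\<Sum>i<degree r. scale (Polynomial.coeff r i) (bs ! i)))"
proof (cases "Suc j < degree r")
  case True
  have "(\<Sum>i<degree r. scale (companion r $$ (i, j)) (bs ! i)) =
      (\<Sum>i<degree r. if i = Suc j then bs ! i else 0)"
    using True by (intro sum.cong) (auto simp: companion_def)
  then show ?thesis
    using True by simp
next
  case False
  then have "j = degree r - 1"
    using assms by simp
  then have "(\<Sum>i<degree r. scale (companion r $$ (i, j)) (bs ! i)) =
      (\<Sum>i<degree r. - scale (Polynomial.coeff r i) (bs ! i))"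
    using assms by (intro sum.cong) (auto simp: companion_def)
  then show ?thesis
    using False by (simp add: sum_negf)
qed

lemma ev_monic:
  assumes "lead_coeff r = 1"
  shows "ev u r v = (\<Sum>i<degree r. scale (Polynomial.coeff r i) ((u ^^ i) v)) + (u ^^ degree r) v"
  using assms by (simp add: ev_bound[OF lessI])

lemma acts_by_chain_companion:
  assumes "lead_coeff r = 1" "ev u r v = 0"
  shows "acts_by u (chain u v (degree r)) (companion r)"
proof -
  have "u ((u ^^ j) v) = (\<Sum>i<degree r. scale (companion r $$ (i, j)) (chain u v (degree r) ! i))"
    if j: "j < degree r" for j
  proof (cases "Suc j < degree r")
    case False
    then have "Suc j = degree r"
      using j by simp
    then have "u ((u ^^ j) v) = (u ^^ degree r) v"
      by (simp flip: \<open>Suc j = degree r\<close>)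
    also have "\<dots> = - (\<Sum>i<degree r. scale (Polynomial.coeff r i) ((u ^^ i) v))"
      using ev_monic[OF assms(1), of u v] assms(2) by (simp add: eq_neg_iff_add_eq_0 add.commute)
    finally show ?thesis
      using False j by (subst companion_column) simp_all
  next
    case True
    then show ?thesis
      using j by (subst companion_column) simp_all
  qed
  then show ?thesis
    by (simp add: acts_by_def companion_carrier)
qed

lemma acts_by_companionD:
  assumes r: "lead_coeff r = 1" and M: "acts_by u bs (companion r)"
  shows "\<exists>v. bs = chain u v (degree r) \<and> ev u r v = 0"
proof -
  have len: "length bs = degree r"
    using M companion_carrier[of r] by (auto simp: acts_by_def)
  have col: "u (bs ! j) = (\<Sum>i<degree r. scale (companion r $$ (i, j)) (bs ! i))"
    if "j < degree r" for j
    using M that by (auto simp: acts_by_def len)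
  \<comment> \<open>For \<open>r = 1\<close> the list is empty and has no first entry; the only
    vector killed by 1 is 0.\<close>
  define v where "v = (if degree r = 0 then 0 else bs ! 0)"
  have nth: "j < degree r \<Longrightarrow> bs ! j = (u ^^ j) v" for j
  proof (induction j)
    case (Suc j)
    then show ?case
      using col[of j] by (simp add: companion_column[OF _ len])
  qed (simp add: v_def)
  then have bs: "bs = chain u v (degree r)"
    by (intro nth_equalityI) (simp_all add: len)
  have "ev u r v = 0"
  proof (cases "degree r = 0")
    case True
    then show ?thesis
      using r by (simp add: ev_monic v_def)
  next
    case False
    then obtain d where d: "degree r = Suc d"
      using not0_implies_Suc by blast
    then have "(u ^^ degree r) v = u (bs ! d)"
      by (simp add: nth)
    also have "\<dots> = - (\<Sum>i<degree r. scale (Polynomial.coeff r i) (bs ! i))"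
      using d by (subst col, simp) (subst companion_column[OF _ len], simp_all)
    also have "\<dots> = - (\<Sum>i<degree r. scale (Polynomial.coeff r i) ((u ^^ i) v))"
      by (simp add: nth)
    finally show ?thesis
      by (simp add: ev_monic[OF r])
  qed
  with bs show ?thesis
    by blast
qed

definition blocks :: "('b \<Rightarrow> 'b) \<Rightarrow> ('b \<times> 'a poly) list \<Rightarrow> 'b list" where
  "blocks u ps = concat (map (\<lambda>(v, r). chain u v (degree r)) ps)"

lemma blocks_simps [simp]:
  "blocks u [] = []"
  "blocks u ((v, r) # ps) = chain u v (degree r) @ blocks u ps"
  "blocks u (ps @ ps') = blocks u ps @ blocks u ps'"
  by (simp_all add: blocks_def)

definition companions :: "'a poly list \<Rightarrow> 'a mat" where
  "companions rs = diag_block_mat (map companion rs)"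

lemma companions_Cons: "companions (r # rs) =
  four_block_mat (companion r) (0\<^sub>m (dim_row (companion r)) (dim_col (companions rs)))
    (0\<^sub>m (dim_row (companions rs)) (dim_col (companion r))) (companions rs)"
  unfolding companions_def list.map diag_block_mat.simps Let_def ..

lemma companions_carrier:
  "companions rs \<in> carrier_mat (sum_list (map degree rs)) (sum_list (map degree rs))"
proof (induction rs)
  case Nil
  then show ?case
    by (simp add: companions_def)
next
  case (Cons r rs)
  then show ?case
    unfolding companions_Cons list.map sum_list.Cons
    by (intro four_block_carrier_mat companion_carrier)
qed

lemma acts_by_blocks:
  assumes "\<forall>(v, r)\<in>set ps. lead_coeff r = 1 \<and> ev u r v = 0"
  shows "acts_by u (blocks u ps) (companions (map snd ps))"
  using assms
proof (induction ps)
  case Nil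
  then show ?case
    by (simp add: acts_by_def companions_def)
next
  case (Cons x ps)
  obtain v r where x: "x = (v, r)"
    by force
  have IH: "acts_by u (blocks u ps) (companions (map snd ps))"
    using Cons by simp
  then have "companions (map snd ps) \<in> carrier_mat (length (blocks u ps)) (length (blocks u ps))"
    by (simp add: acts_by_def)
  then have "acts_by u (chain u v (degree r) @ blocks u ps) (companions (r # map snd ps))"
    unfolding companions_Cons using Cons.prems IH companion_carrier[of r]
    by (subst acts_by_append) (simp_all add: x acts_by_chain_companion)
  then show ?case
    by (simp add: x)
qed

lemma acts_by_companionsD:
  assumes "\<forall>r\<in>set rs. lead_coeff r = 1" "acts_by u bs (companions rs)"
  shows "\<exists>ps. map snd ps = rs \<and> bs = blocks u ps \<and> (\<forall>(v, r)\<in>set ps. ev u r v = 0)"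
  using assms
proof (induction rs arbitrary: bs)
  case Nil
  then show ?case
    by (auto simp: acts_by_def companions_def)
next
  case (Cons r rs)
  have len: "length bs = degree r + sum_list (map degree rs)"
    using Cons.prems(2) companions_carrier[of "r # rs"] by (auto simp: acts_by_def)
  define xs ys where "xs = take (degree r) bs" and "ys = drop (degree r) bs"
  have xy: "bs = xs @ ys" "length xs = degree r" "length ys = sum_list (map degree rs)"
    by (auto simp: xs_def ys_def len)
  have "acts_by u xs (companion r) \<and> acts_by u ys (companions rs)"
    using Cons.prems(2) companion_carrier[of r] companions_carrier[of rs]
    unfolding xy(1) companions_Cons by (subst (asm) acts_by_append) (simp_all add: xy)
  moreover from this obtain ps where "map snd ps = rs" "ys = blocks u ps" "\<forall>(v, r)\<in>set ps. ev u r v = 0"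
    using Cons by force
  moreover from calculation obtain v where "xs = chain u v (degree r)" "ev u r v = 0"
    using acts_by_companionD Cons.prems(1) by (metis list.set_intros(1))
  ultimately show ?case
    by (intro exI[of _ "(v, r) # ps"]) (simp add: xy(1))
qed

text \<open>An internal direct sum of cyclic F[u]-modules, given by generators and their
  annihilators. Pairs with polynomial 1 are allowed: their chain is empty and their generator is 0.
  In this form summands are easy to permute and to pad, which is awkward for block matrices.\<close>

definition cyclic_decomp :: "('b \<Rightarrow> 'b) \<Rightarrow> ('b \<times> 'a poly) list \<Rightarrow> bool" where
  "cyclic_decomp u ps \<longleftrightarrow> ordered_basis scale (blocks u ps) \<and>
     (\<forall>(v, r)\<in>set ps. lead_coeff r = 1 \<and> ev u r v = 0)"

lemma represented_by_companions_iff: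
  assumes "\<forall>r\<in>set rs. lead_coeff r = 1"
  shows "represented_by scale u (companions rs) \<longleftrightarrow> (\<exists>ps. map snd ps = rs \<and> cyclic_decomp u ps)"
proof
  assume "represented_by scale u (companions rs)"
  then obtain bs where bs: "ordered_basis scale bs" "acts_by u bs (companions rs)"
    by (auto simp: represented_by_iff)
  obtain ps where "map snd ps = rs" "bs = blocks u ps" "\<forall>(v, r)\<in>set ps. ev u r v = 0"
    using acts_by_companionsD[OF assms bs(2)] by blast
  moreover from this have "\<forall>(v, r)\<in>set ps. lead_coeff r = 1"
    using assms by fastforce
  ultimately show "\<exists>ps. map snd ps = rs \<and> cyclic_decomp u ps"
    using bs by (intro exI[of _ ps]) (auto simp: cyclic_decomp_def)
next
  assume "\<exists>ps. map snd ps = rs \<and> cyclic_decomp u ps"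
  then show "represented_by scale u (companions rs)"
    by (auto simp: represented_by_iff cyclic_decomp_def intro: acts_by_blocks)
qed

lemma cyclic_decomp_cong_mset:
  assumes "mset ps = mset ps'" "cyclic_decomp u ps"
  shows "cyclic_decomp u ps'"
proof -
  have "mset (blocks u xs) = (\<Sum>(v, r)\<in>#mset xs. mset (chain u v (degree r)))" for xs
    by (induction xs) auto
  then have "mset (blocks u ps) = mset (blocks u ps')"
    by (simp add: assms(1))
  then have "set (blocks u ps) = set (blocks u ps')" "distinct (blocks u ps) = distinct (blocks u ps')"
    by (auto dest: mset_eq_setD mset_eq_imp_distinct_iff)
  with assms mset_eq_setD[OF assms(1)] show ?thesis
    by (simp add: cyclic_decomp_def ordered_basis_def)
qed

section \<open>Linear independence of lists\<close>

definition list_independent :: "'b list \<Rightarrow> bool" where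
  "list_independent bs \<longleftrightarrow>
     (\<forall>c. (\<Sum>i<length bs. scale (c i) (bs ! i)) = 0 \<longrightarrow> (\<forall>i<length bs. c i = 0))"

lemma ordered_basis_iff: "ordered_basis scale bs \<longleftrightarrow> list_independent bs \<and> span (set bs) = UNIV"
proof -
  have sum_nth: "(\<Sum>i<length bs. g (bs ! i)) = (\<Sum>x\<in>set bs. g x)" if "distinct bs" for g :: "'b \<Rightarrow> 'b"
    by (rule sum.reindex_bij_betw) (rule bij_betw_nth[OF that], auto)
  have "list_independent bs \<longleftrightarrow> distinct bs \<and> independent (set bs)"
  proof
    assume ind: "list_independent bs"
    have dist: "distinct bs"
      unfolding distinct_conv_nth
    proof (intro allI impI notI)
      fix i j assume ij: "i < length bs" "j < length bs" "i \<noteq> j" "bs ! i = bs ! j"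
      define c :: "nat \<Rightarrow> 'a" where "c k = (if k = i then 1 else 0) - (if k = j then 1 else 0)" for k
      have "(\<Sum>k<length bs. scale (c k) (bs ! k)) =
        (\<Sum>k<length bs. (if k = i then bs ! k else 0) - (if k = j then bs ! k else 0))"
        by (rule sum.cong) (auto simp: c_def)
      also have "\<dots> = 0"
        using ij by (simp add: sum_subtractf)
      finally have "c i = 0"
        using ind ij unfolding list_independent_def by blast
      then show False
        using ij by (simp add: c_def)
    qed
    moreover have "independent (set bs)"
    proof
      assume "dependent (set bs)"
      then obtain g b where g: "b \<in> set bs" "g b \<noteq> 0" "(\<Sum>x\<in>set bs. scale (g x) x) = 0"
        by (auto simp: dependent_finite)
      then have "(\<Sum>i<length bs. scale (g (bs ! i)) (bs ! i)) = 0"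
        using sum_nth[OF dist, of "\<lambda>x. scale (g x) x"] by simp
      then show False
        using ind g(1,2) unfolding list_independent_def by (metis in_set_conv_nth)
    qed
    ultimately show "distinct bs \<and> independent (set bs)" ..
  next
    assume *: "distinct bs \<and> independent (set bs)"
    show "list_independent bs"
      unfolding list_independent_def
    proof (intro allI impI)
      fix c i assume c: "(\<Sum>i<length bs. scale (c i) (bs ! i)) = 0" and i: "i < length bs"
      define g where "g x = c (the_inv_into {..<length bs} ((!) bs) x)" for x
      have g: "g (bs ! i) = c i" if "i < length bs" for i
        unfolding g_def using * that by (subst the_inv_into_f_f) (auto simp: inj_on_nth)
      have "(\<Sum>x\<in>set bs. scale (g x) x) = (\<Sum>i<length bs. scale (c i) (bs ! i))"
        using * by (subst sum_nth[symmetric]) (auto simp: g)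
      then show "c i = 0"
        using * c i independentD[of "set bs" "set bs" g "bs ! i"] by (simp add: g)
    qed
  qed
  then show ?thesis
    by (auto simp: ordered_basis_def)
qed

lemma list_independent_concat_aux:
  fixes c :: "nat \<Rightarrow> 'a"
  shows "\<exists>C. (\<Sum>i<length (concat bss). scale (c i) (concat bss ! i)) =
      (\<Sum>k<length bss. \<Sum>i<length (bss ! k). scale (C k i) (bss ! k ! i)) \<and>
    ((\<forall>k<length bss. \<forall>i<length (bss ! k). C k i = 0) \<longrightarrow> (\<forall>i<length (concat bss). c i = 0))"
proof (induction bss arbitrary: c)
  case Nil
  then show ?case
    by simp
next
  case (Cons bs bss)
  obtain C where C: "(\<Sum>i<length (concat bss). scale (c (length bs + i)) (concat bss ! i)) =
      (\<Sum>k<length bss. \<Sum>i<length (bss ! k). scale (C k i) (bss ! k ! i))"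
    "(\<forall>k<length bss. \<forall>i<length (bss ! k). C k i = 0) \<Longrightarrow>
      (\<forall>i<length (concat bss). c (length bs + i) = 0)"
    using Cons.IH[of "\<lambda>i. c (length bs + i)"] by blast
  have "(\<Sum>i<length (concat (bs # bss)). scale (c i) (concat (bs # bss) ! i)) =
      (\<Sum>i<length bs. scale (c i) (bs ! i)) +
      (\<Sum>i<length (concat bss). scale (c (length bs + i)) (concat bss ! i))"
    by (simp only: concat.simps length_append sum_lessThan_add) (simp add: nth_append)
  also have "\<dots> = (\<Sum>k<length (bs # bss). \<Sum>i<length ((bs # bss) ! k).
      scale (case_nat c C k i) ((bs # bss) ! k ! i))"
    by (simp only: C(1) length_Cons sum.lessThan_Suc_shift) simp
  finally have "(\<Sum>i<length (concat (bs # bss)). scale (c i) (concat (bs # bss) ! i)) =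
      (\<Sum>k<length (bs # bss). \<Sum>i<length ((bs # bss) ! k).
      scale (case_nat c C k i) ((bs # bss) ! k ! i))" .
  moreover have "\<forall>i<length (concat (bs # bss)). c i = 0"
    if z: "\<forall>k<length (bs # bss). \<forall>i<length ((bs # bss) ! k). case_nat c C k i = 0"
  proof -
    have "\<forall>i<length bs. c i = 0" "\<forall>k<length bss. \<forall>i<length (bss ! k). C k i = 0"
      using spec[OF z, of 0] z by force+
    then show ?thesis
      using C(2) by (simp only: concat.simps length_append all_less_add_iff) blast
  qed
  ultimately show ?case
    by (intro exI[of _ "case_nat c C"]) blast
qed

lemma list_independent_concatI:
  assumes "\<And>C. (\<Sum>k<length bss. \<Sum>i<length (bss ! k). scale (C k i) (bss ! k ! i)) = 0 \<Longrightarrow>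
    \<forall>k<length bss. \<forall>i<length (bss ! k). C k i = 0"
  shows "list_independent (concat bss)"
  unfolding list_independent_def
proof (rule allI, rule impI)
  fix c assume "(\<Sum>i<length (concat bss). scale (c i) (concat bss ! i)) = 0"
  moreover obtain C where "(\<Sum>i<length (concat bss). scale (c i) (concat bss ! i)) =
      (\<Sum>k<length bss. \<Sum>i<length (bss ! k). scale (C k i) (bss ! k ! i))"
    "(\<forall>k<length bss. \<forall>i<length (bss ! k). C k i = 0) \<Longrightarrow> (\<forall>i<length (concat bss). c i = 0)"
    using list_independent_concat_aux by blast
  ultimately show "\<forall>i<length (concat bss). c i = 0"
    using assms by presburger
qed

lemma list_independent_append:
  assumes "list_independent (xs @ ys)"
  shows "list_independent xs"
  unfolding list_independent_def
proof (intro allI impI)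
  fix c i assume "(\<Sum>i<length xs. scale (c i) (xs ! i)) = 0" "i < length xs"
  moreover from this have "\<forall>k<length (xs @ ys). (if k < length xs then c k else 0) = 0"
    using spec[OF assms[unfolded list_independent_def], of "\<lambda>i. if i < length xs then c i else 0"]
    by (simp add: sum_lessThan_add nth_append)
  ultimately show "c i = 0"
    by (auto dest!: spec[of _ i])
qed

text \<open>The remainder of \<open>f\<close> modulo \<open>r\<close> kills \<open>v\<close> as
  well. Its degree is below that of \<open>r\<close>, so its coefficients would be a relation inside
  the chain of \<open>v\<close>, which is part of a basis.\<close>

lemma cyclic_decomp_annihilator:
  assumes u: "endo u" and ps: "cyclic_decomp u ps" and vr: "(v, r) \<in> set ps" and f: "ev u f v = 0"
  shows "r dvd f"
proof -
  obtain xs ys where split: "ps = xs @ (v, r) # ys"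
    using vr by (meson split_list)
  have r: "lead_coeff r = 1" "ev u r v = 0"
    using ps vr by (auto simp: cyclic_decomp_def)
  have "cyclic_decomp u ((v, r) # xs @ ys)"
    by (rule cyclic_decomp_cong_mset[OF _ ps]) (simp add: split)
  then have ind: "list_independent (chain u v (degree r))"
    by (simp only: cyclic_decomp_def ordered_basis_iff blocks_simps) (blast dest: list_independent_append)
  define g where "g = f mod r"
  have g0: "ev u g v = 0"
    unfolding g_def ev_mod[OF u r(2)] by (rule f)
  have "r \<noteq> 0"
    using r by auto
  show ?thesis
  proof (rule ccontr)
    assume "\<not> r dvd f"
    then have g: "g \<noteq> 0" "degree g < degree r"
      using \<open>r \<noteq> 0\<close> by (auto simp: g_def mod_eq_0_iff_dvd degree_mod_less_degree)
    then have "(\<Sum>i<degree r. scale (Polynomial.coeff g i) ((u ^^ i) v)) = 0"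
      using g0 by (simp add: ev_bound)
    then have "Polynomial.coeff g i = 0" if "i < degree r" for i
      using ind[unfolded list_independent_def, rule_format, of "Polynomial.coeff g" i] that by simp
    then have "lead_coeff g = 0"
      using g(2) by blast
    then show False
      using g(1) by simp
  qed
qed

lemma annihilates_cyclic_decomp:
  assumes u: "endo u" and ps: "cyclic_decomp u ps" and m: "\<forall>r\<in>snd ` set ps. r dvd m"
  shows "annihilates scale m u"
proof -
  have base: "ev u m b = 0" if b: "b \<in> set (blocks u ps)" for b
  proof -
    obtain x where x: "x \<in> set ps" "b \<in> set (case x of (v, r) \<Rightarrow> chain u v (degree r))"
      using b unfolding blocks_def set_concat set_map by blast
    obtain v r where vr: "x = (v, r)"
      by (cases x)
    then obtain i where "b = (u ^^ i) v"
      using x by (auto simp: set_chain)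
    moreover have "ev u r v = 0" "r dvd m"
      using x vr m ps by (force simp: cyclic_decomp_def)+
    then have "ev u m v = 0"
      by (rule ev_dvd[OF u, rotated])
    moreover have "ev u m ((u ^^ i) v) = (u ^^ i) (ev u m v)" for i
      by (induction i) (simp_all add: ev_commute[OF u])
    ultimately show ?thesis
      by (simp add: endo_zero[OF endo_funpow[OF u]])
  qed
  have "ev u m v = 0" if "v \<in> span (set (blocks u ps))" for v
    using that
  proof (induction rule: span_induct_alt)
    case base
    then show ?case
      by (simp add: endo_zero[OF ev_endo[OF u]])
  next
    case (step c x y)
    then show ?case
      by (simp add: base endo_add[OF ev_endo[OF u]] endo_scale[OF ev_endo[OF u]])
  qed
  then show ?thesis
    using ps by (auto simp: annihilates_def cyclic_decomp_def ordered_basis_def)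
qed

lemma min_poly_cyclic_decomp:
  assumes u: "endo u" and ps: "cyclic_decomp u ps"
    and m: "lead_coeff m = 1" "\<forall>r\<in>snd ` set ps. r dvd m"
      "\<And>f. \<forall>r\<in>snd ` set ps. r dvd f \<Longrightarrow> m dvd f"
  shows "min_poly scale u = m"
proof -
  have ann: "annihilates scale m u"
    by (rule annihilates_cyclic_decomp[OF u ps m(2)])
  have dvd: "m dvd f" if f: "annihilates scale f u" for f
  proof (intro m(3) ballI)
    fix r assume "r \<in> snd ` set ps"
    then obtain v where "(v, r) \<in> set ps"
      by auto
    then show "r dvd f"
      using f by (intro cyclic_decomp_annihilator[OF u ps]) (auto simp: annihilates_def)
  qed
  show ?thesis
    unfolding min_poly_def
  proof (rule the_equality)
    fix m' assume m': "lead_coeff m' = 1 \<and> annihilates scale m' u \<and> (\<forall>f. annihilates scale f u \<longrightarrow> m' dvd f)"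
    then have "m dvd m'" "m' dvd m"
      using ann dvd by blast+
    then show "m' = m"
      using m' m(1) by (intro poly_dvd_antisym) simp_all
  qed (use ann dvd m in blast)
qed

end

lemma diag_block_mat_concat:
  "diag_block_mat (map diag_block_mat Ass) = diag_block_mat (concat Ass)"
  by (induction Ass) (simp_all add: diag_block_mat_append Let_def)

section \<open>Irreducible polynomials over a field\<close>

text \<open>Euclid's algorithm, with \<open>G mod g\<close> as the next remainder. For nonconstant
  \<open>g\<close> it does not vanish, because an irreducible \<open>G\<close> has no nonconstant
  divisor of smaller degree.\<close>

lemma irreducible_bezout:
  fixes G f :: "'a::field poly"
  assumes G: "irreducible G" and f: "\<not> G dvd f"
  shows "\<exists>a b. a * G + b * f = 1"
proof -
  have aux: "\<exists>a b. a * G + b * g = 1" if "g \<noteq> 0" "degree g < degree G" for g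
    using that
  proof (induction "degree g" arbitrary: g rule: less_induct)
    case less
    show ?case
    proof (cases "degree g = 0")
      case True
      then obtain k where "g = [:k:]"
        by (meson degree_eq_zeroE)
      with less.prems show ?thesis
        by (intro exI[of _ 0] exI[of _ "[:1 / k:]"]) simp
    next
      case False
      have "\<not> g dvd G"
      proof
        assume "g dvd G"
        then obtain k where k: "G = g * k" ..
        then have "g dvd 1 \<or> k dvd 1"
          using G unfolding irreducible_def by blast
        then have "k \<noteq> 0 \<and> degree k = 0"
          using False by (simp add: poly_dvd_1)
        then have "degree G = degree g"
          using less.prems(1) by (simp add: k degree_mult_eq)
        then show False
          using less.prems by simp
      qed
      then have "G mod g \<noteq> 0" "degree (G mod g) < degree g"
        using less.prems by (simp_all add: mod_eq_0_iff_dvd degree_mod_less_degree)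
      then obtain a b where "a * G + b * (G mod g) = 1"
        using less by (metis less_trans)
      then have "(a + b) * G + (- b * (G div g)) * g = 1"
        by (simp add: algebra_simps flip: minus_div_mult_eq_mod)
      then show ?thesis
        by blast
    qed
  qed
  have "G \<noteq> 0"
    using G by auto
  then obtain a b where ab: "a * G + b * (f mod G) = 1"
    using f aux[of "f mod G"] by (auto simp: mod_eq_0_iff_dvd degree_mod_less_degree)
  then have "(a - b * (f div G)) * G + b * f = 1"
    by (simp add: algebra_simps flip: minus_div_mult_eq_mod)
  then show ?thesis
    by blast
qed

text \<open>The identity for \<open>Suc N\<close> is the product of those for 1 and
  \<open>N\<close>. Its use: as soon as \<open>G ^ N\<close> at \<open>u\<close> kills the space,
  \<open>f\<close> at \<open>u\<close> is invertible.\<close>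

lemma irreducible_power_bezout:
  fixes G f :: "'a::field poly"
  assumes G: "irreducible G" and f: "\<not> G dvd f"
  shows "\<exists>a b. a * G ^ N + b * f = 1"
proof (induction N)
  case 0
  show ?case
    by (intro exI[of _ 1] exI[of _ 0]) simp
next
  case (Suc N)
  then obtain a' b' where 1: "a' * G ^ N + b' * f = 1"
    by blast
  obtain a b where 2: "a * G + b * f = 1"
    using irreducible_bezout[OF G f] by blast
  have "(a * a') * G ^ Suc N + (a * G * b' + b * a' * G ^ N + b * b' * f) * f =
      (a * G + b * f) * (a' * G ^ N + b' * f)"
    by (simp add: algebra_simps)
  then have "(a * a') * G ^ Suc N + (a * G * b' + b * a' * G ^ N + b * b' * f) * f = 1"
    by (simp only: 1 2 mult_1)
  then show ?case
    by blast
qed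

lemma irreducible_dvd_multD:
  fixes G :: "'a::field poly"
  assumes G: "irreducible G" "G dvd f * g"
  shows "G dvd f \<or> G dvd g"
proof (rule disjCI)
  assume "\<not> G dvd g"
  then obtain a b where "a * G + b * g = 1"
    using irreducible_bezout[OF G(1)] by blast
  then have "f * (a * G + b * g) = f"
    by simp
  moreover have "G dvd f * a * G + b * (f * g)"
    by (rule dvd_add[OF dvd_triv_right dvd_mult[OF G(2)]])
  ultimately show "G dvd f"
    by (simp add: algebra_simps)
qed

text \<open>Powers of t appear as factors when \<open>G\<close> at \<open>u\<close> is expressed by
  the square of \<open>P\<close>. They are units modulo \<open>G\<close>, since an irreducible
  polynomial of degree above one does not divide t.\<close>

lemma irreducible_not_dvd_monom_mult:
  fixes G :: "'a::field poly"
  assumes G: "irreducible G" "1 < degree G" and f: "\<not> G dvd f" and k: "k \<noteq> 0"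
  shows "\<not> G dvd Polynomial.smult k (Polynomial.monom 1 n) * f"
proof -
  have "\<not> G dvd Polynomial.monom k n"
    using k
  proof (induction n arbitrary: k)
    case 0
    then show ?case
      using G by (auto simp: monom_0 dest: dvd_imp_degree_le)
  next
    case (Suc n)
    have "\<not> G dvd [:0, 1:]"
      using G by (auto dest: dvd_imp_degree_le)
    moreover have "Polynomial.monom k (Suc n) = [:0, 1:] * Polynomial.monom k n"
      by (simp add: monom_Suc)
    ultimately show ?case
      using Suc irreducible_dvd_multD[OF G(1), of "[:0, 1:]" "Polynomial.monom k n"] by auto
  qed
  then show ?thesis
    using f irreducible_dvd_multD[OF G(1)] by (auto simp: smult_monom)
qed

lemma irreducible_power_decompose:
  fixes G f :: "'a::field poly"
  assumes G: "irreducible G" and f: "f \<noteq> 0"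
  shows "\<exists>a g. f = G ^ a * g \<and> \<not> G dvd g"
  using f
proof (induction "degree f" arbitrary: f rule: less_induct)
  case less
  show ?case
  proof (cases "G dvd f")
    case True
    then obtain h where h: "f = G * h" ..
    have "degree G \<noteq> 0"
      using G by (auto simp: irreducible_def is_unit_iff_degree)
    then have "degree h < degree f"
      using h less.prems by (auto simp: degree_mult_eq)
    moreover have "h \<noteq> 0"
      using h less.prems by auto
    ultimately obtain a g where "h = G ^ a * g" "\<not> G dvd g"
      using less.hyps by blast
    then show ?thesis
      using h by (intro exI[of _ "Suc a"] exI[of _ g]) simp
  next
    case False
    then show ?thesis
      by (intro exI[of _ 0] exI[of _ f]) simp
  qed
qed

text \<open>Split off the largest power of \<open>G\<close> from \<open>r\<close>. The cofactor
  divides \<open>G ^ N\<close> and is prime to it, hence is constant, and it is monic.\<close>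

lemma monic_dvd_irreducible_power:
  fixes G r :: "'a::field poly"
  assumes G: "irreducible G" "lead_coeff G = 1" and r: "lead_coeff r = 1" "r dvd G ^ N"
  shows "\<exists>e. r = G ^ e"
proof -
  have "r \<noteq> 0"
    using r by auto
  then obtain e g where g: "r = G ^ e * g" "\<not> G dvd g"
    using irreducible_power_decompose[OF G(1)] by blast
  obtain a b where ab: "a * G ^ N + b * g = 1"
    using irreducible_power_bezout[OF G(1) g(2)] by blast
  have "g dvd G ^ N"
    using r(2) unfolding g(1) by (rule dvd_mult_right)
  then have "g dvd a * G ^ N + b * g"
    by (intro dvd_add dvd_mult) simp_all
  then have "g dvd 1"
    by (simp only: ab)
  moreover have "lead_coeff g = 1"
    using r(1) G(2) by (simp add: g lead_coeff_mult lead_coeff_power)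
  ultimately have "g = 1"
    by (auto simp: poly_dvd_1 monic_degree_0)
  then show ?thesis
    using g by auto
qed

lemma coeff_sum_monom:
  "Polynomial.coeff (\<Sum>i<d. Polynomial.monom (c i) i) j = (if j < d then c j else 0)"
  by (simp add: coeff_sum)

lemma degree_sum_monom_less:
  assumes "(\<Sum>i<d. Polynomial.monom (c i) i) \<noteq> 0"
  shows "degree (\<Sum>i<d. Polynomial.monom (c i) i) < d"
proof (rule ccontr)
  assume "\<not> ?thesis"
  then have "lead_coeff (\<Sum>i<d. Polynomial.monom (c i) i) = 0"
    by (subst coeff_sum_monom) simp
  with assms show False
    by simp
qed

section \<open>Spans of chains\<close>

context plain_vector_space
begin

lemma ev_sum_monom:
  "endo u \<Longrightarrow> ev u (\<Sum>i<d. Polynomial.monom (c i) i) v = (\<Sum>i<d. scale (c i) ((u ^^ i) v))"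
  by (simp add: ev_sum ev_monom)

lemma ev_in_span_chain:
  assumes u: "endo u" and r: "lead_coeff r = 1" "ev u r v = 0"
  shows "ev u f v \<in> span (set (chain u v (degree r)))"
proof (cases "f mod r = 0")
  case True
  then show ?thesis
    using ev_mod[OF u r(2), of f] span_zero by simp
next
  case False
  have "r \<noteq> 0"
    using r by auto
  then have "ev u f v = (\<Sum>i<degree r. scale (Polynomial.coeff (f mod r) i) ((u ^^ i) v))"
    using False by (subst ev_mod[OF u r(2), symmetric], intro ev_bound degree_mod_less')
  also have "\<dots> \<in> span (set (chain u v (degree r)))"
    by (intro span_sum span_scale span_base) (auto simp: set_chain)
  finally show ?thesis .
qed

lemma set_blocks: "set (blocks u ps) = {(u ^^ i) v | v r i. (v, r) \<in> set ps \<and> i < degree r}"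
  unfolding blocks_def set_concat by (fastforce simp: set_chain)

lemma ev_in_span_blocks:
  assumes u: "endo u" and "lead_coeff r = 1" "ev u r v = 0" "(v, r) \<in> set ps"
  shows "ev u f v \<in> span (set (blocks u ps))"
proof -
  have "set (chain u v (degree r)) \<subseteq> set (blocks u ps)"
    using assms(4) by (auto simp: set_blocks set_chain)
  then show ?thesis
    using ev_in_span_chain[OF assms(1-3)] span_mono by blast
qed

lemma span_blocks_invariant:
  assumes h: "endo h" and x: "x \<in> span (set (blocks u ps))"
    and base: "\<And>v r i. (v, r) \<in> set ps \<Longrightarrow> h ((u ^^ i) v) \<in> span (set (blocks u ps))"
  shows "h x \<in> span (set (blocks u ps))"
  using x
proof (induction rule: span_induct_alt)
  case base
  then show ?case
    by (simp add: endo_zero[OF h] span_zero)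
next
  case (step c y z)
  then show ?case
    using base by (auto simp: endo_add[OF h] endo_scale[OF h] set_blocks intro!: span_add span_scale)
qed

end

section \<open>Decomposition under a twisted pair\<close>

lemma funpow_diff: "m \<le> n \<Longrightarrow> (f ^^ n) x = (f ^^ m) ((f ^^ (n - m)) x)"
  using funpow_add[of m "n - m" f] by simp

text \<open>\<open>w\<close> is \<open>\<kappa>\<close> times the inverse of \<open>u\<close>, kept
  as a separate operator so that the passage of \<open>P\<close> is symmetric: it turns polynomials
  in \<open>u\<close> into polynomials in \<open>w\<close> and back. Hence \<open>G ^ N\<close> has
  to kill the space at both operators.\<close>

locale twisted_pair = plain_vector_space scale
  for scale :: "'a::field \<Rightarrow> 'b::ab_group_add \<Rightarrow> 'b" +
  fixes u w P :: "'b \<Rightarrow> 'b" and G :: "'a poly" and \<kappa> c :: 'a and N :: nat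
  assumes u: "endo u" and w: "endo w" and P: "endo P"
    and uw: "u (w x) = scale \<kappa> x" and wu: "w (u x) = scale \<kappa> x"
    and \<kappa>: "\<kappa> \<noteq> 0" and c: "c \<noteq> 0"
    and Pu: "P (u x) = w (P x)"
    and G: "irreducible G" "lead_coeff G = 1" "1 < degree G"
    and ev_G: "ev u G x = scale c (u (u (P (P x))))"
    and nil_u: "ev u (G ^ N) x = 0" and nil_w: "ev w (G ^ N) x = 0"
    and fin: "\<exists>B. finite B \<and> span B = UNIV"
begin

lemma Pw: "P (w x) = u (P x)"
  by (rule intertwiner_conj[OF u P \<kappa> uw Pu])

text \<open>The square of \<open>P\<close> commutes with \<open>u\<close>, so both factors
  \<open>P\<close> of \<open>ev_G\<close> can be moved to the front. In the valuation picture
  \<open>G\<close> has valuation two.\<close>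

lemma ev_G_mult:
  "ev u (G * f) x = P (P (ev u (Polynomial.smult c (Polynomial.monom 1 2) * f) x))"
  by (simp add: ev_mult[OF u] ev_smult[OF u] ev_monom[OF u] ev_G endo_scale[OF P] Pu Pw numeral_2_eq_2)

lemma ev_G_power_mult:
  "ev u (G ^ a * f) x =
    (P ^^ (2 * a)) (ev u (Polynomial.smult (c ^ a) (Polynomial.monom 1 (2 * a)) * f) x)"
proof (induction a arbitrary: f)
  case 0
  then show ?case
    by simp
next
  case (Suc a)
  let ?h = "\<lambda>a. Polynomial.smult (c ^ a) (Polynomial.monom 1 (2 * a))"
  have "ev u (G ^ Suc a * f) x = ev u (G ^ a * (G * f)) x"
    by (simp add: mult_ac)
  also have "\<dots> = (P ^^ (2 * a)) (ev u (G * (?h a * f)) x)"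
    by (subst Suc.IH) (simp only: mult.left_commute[of _ G])
  also have "\<dots> = (P ^^ (2 * a)) (P (P (ev u (?h 1 * (?h a * f)) x)))"
    by (simp only: ev_G_mult power_one_right mult_1_right)
  also have "?h 1 * (?h a * f) = ?h (Suc a) * f"
    by (simp add: mult_monom mult.commute[of c] flip: mult.assoc)
  also have "(P ^^ (2 * a)) (P (P y)) = (P ^^ (2 * Suc a)) y" for y
    by (simp add: funpow_swap1)
  finally show ?case .
qed

text \<open>The Boolean records at which of the two conjugate operators a polynomial is evaluated;
  each passage of \<open>P\<close> flips it.\<close>

definition tw :: "bool \<Rightarrow> 'b \<Rightarrow> 'b" where
  "tw b = (if b then u else w)"

lemma endo_tw: "endo (tw b)"
  by (simp add: tw_def u w)

lemma P_ev: "P (ev (tw b) f x) = ev (tw (\<not> b)) f (P x)"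
  by (induction f) (auto simp: ev_pCons[OF u] ev_pCons[OF w] endo_zero[OF P] endo_add[OF P] endo_scale[OF P]
      tw_def Pu Pw)

lemma P_power_ev: "\<exists>b'. \<forall>f x. (P ^^ j) (ev (tw b) f x) = ev (tw b') f ((P ^^ j) x)"
proof (induction j)
  case 0
  then show ?case
    by auto
next
  case (Suc j)
  then obtain b' where "(P ^^ j) (ev (tw b) f x) = ev (tw b') f ((P ^^ j) x)" for f x
    by blast
  then have "\<forall>f x. (P ^^ Suc j) (ev (tw b) f x) = ev (tw (\<not> b')) f ((P ^^ Suc j) x)"
    by (simp add: P_ev)
  then show ?case ..
qed

lemma ev_tw_left_inverse:
  assumes "\<not> G dvd f"
  shows "\<exists>h. \<forall>x. ev (tw b) h (ev (tw b) f x) = x"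
proof -
  obtain a h where ah: "a * G ^ N + h * f = 1"
    using irreducible_power_bezout[OF G(1) assms] by blast
  have "ev (tw b) h (ev (tw b) f x) = ev (tw b) (a * G ^ N + h * f) x" for x
    by (simp add: ev_add[OF endo_tw] ev_mult[OF endo_tw] endo_zero[OF ev_endo[OF endo_tw]])
      (simp add: tw_def nil_u nil_w endo_zero[OF ev_endo[OF u]] endo_zero[OF ev_endo[OF w]])
  then show ?thesis
    by (auto simp: ah)
qed

text \<open>At \<open>u\<close>, \<open>G ^ N\<close> is \<open>P ^^ (2 * N)\<close> preceded by the
  polynomial \<open>?h\<close>, which is invertible because it is a multiple of a power of
  t.\<close>

lemma P_nilpotent: "(P ^^ (2 * N)) x = 0"
proof -
  let ?h = "Polynomial.smult (c ^ N) (Polynomial.monom 1 (2 * N))"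
  have "\<not> G dvd 1"
    using G(3) by (auto simp: poly_dvd_1)
  then have "\<not> G dvd ?h * 1"
    using c by (intro irreducible_not_dvd_monom_mult[OF G(1,3)]) auto
  then have "\<not> G dvd ?h"
    by simp
  then obtain g where "ev (tw True) g (ev (tw True) ?h y) = y" for y
    using ev_tw_left_inverse by blast
  from this[of x] have "ev u (g * ?h) x = x"
    by (simp only: tw_def if_True ev_mult[OF u])
  \<comment> \<open>Polynomials in \<open>u\<close> commute, so the left inverse is also a right
    inverse and every \<open>x\<close> is a value of \<open>?h\<close> at \<open>u\<close>.\<close>
  then have "ev u ?h (ev u g x) = x"
    by (simp only: ev_mult'[OF u])
  then show ?thesis
    using ev_G_power_mult[of N 1 "ev u g x"] by (simp add: nil_u)
qed

section \<open>Submodules and units of the operator ring\<close>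

definition stable :: "'b set \<Rightarrow> bool" where
  "stable S \<longleftrightarrow> subspace S \<and> (\<forall>x\<in>S. u x \<in> S \<and> w x \<in> S \<and> P x \<in> S)"

text \<open>The ring generated by \<open>u\<close>, \<open>w\<close> and \<open>P\<close>, as a
  predicate on functions. Membership guarantees that stable subspaces are preserved, without a
  choice of normal form for the elements.\<close>

inductive ops :: "('b \<Rightarrow> 'b) \<Rightarrow> bool" where
  ops_id: "ops (\<lambda>x. x)"
| ops_add: "ops f \<Longrightarrow> ops g \<Longrightarrow> ops (\<lambda>x. f x + g x)"
| ops_scale: "ops f \<Longrightarrow> ops (\<lambda>x. scale k (f x))"
| ops_u: "ops f \<Longrightarrow> ops (\<lambda>x. u (f x))"
| ops_w: "ops f \<Longrightarrow> ops (\<lambda>x. w (f x))"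
| ops_P: "ops f \<Longrightarrow> ops (\<lambda>x. P (f x))"

lemma ops_stable: "ops f \<Longrightarrow> stable S \<Longrightarrow> x \<in> S \<Longrightarrow> f x \<in> S"
  by (induction rule: ops.induct) (auto simp: stable_def intro: subspace_add subspace_scale)

lemma ops_tw: "ops f \<Longrightarrow> ops (\<lambda>x. tw b (f x))"
  by (cases b) (simp_all add: tw_def ops_u ops_w)

lemma ops_zero: "ops (\<lambda>x. 0)"
  using ops_scale[OF ops_id, of 0] by simp

lemma ops_ev: "ops z \<Longrightarrow> ops (\<lambda>x. ev (tw b) f (z x))"
  by (induction f) (simp_all add: ops_zero ev_pCons[OF endo_tw] ops_add ops_scale ops_tw)

lemma ops_P_power: "ops z \<Longrightarrow> ops (\<lambda>x. (P ^^ j) (z x))"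
  by (induction j) (simp_all add: ops_P)

lemma ops_binomial: "ops (\<lambda>x. ev (tw b) f x + ev (tw b) g (P x))"
  by (intro ops_add ops_ev ops_P ops_id)

text \<open>An invertible constant term plus a multiple of the nilpotent \<open>P\<close> is a unit;
  instead of its inverse, only the effect on stable subspaces is recorded. If
  \<open>(P ^^ Suc j) x\<close> lies in \<open>S\<close>, then \<open>P ^^ j\<close> applied to the
  hypothesis puts \<open>(P ^^ j) x\<close> in \<open>S\<close>. The descent starts at
  \<open>2 * N\<close>, where the power vanishes.\<close>

lemma unit_reflects_stable:
  assumes f: "\<not> G dvd f" and S: "stable S" and x: "ev (tw b) f x + ev (tw b) g (P x) \<in> S"
  shows "x \<in> S"
proof -
  have sub: "subspace S"
    using S by (simp add: stable_def)
  have "(P ^^ j) x \<in> S \<Longrightarrow> x \<in> S" for j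
  proof (induction j)
    case (Suc j)
    obtain b' where b': "(P ^^ j) (ev (tw b) f x) = ev (tw b') f ((P ^^ j) x)" for f x
      using P_power_ev by blast
    obtain h where h: "ev (tw b') h (ev (tw b') f y) = y" for y
      using ev_tw_left_inverse[OF f] by blast
    have "(P ^^ j) (ev (tw b) f x + ev (tw b) g (P x)) \<in> S"
      using ops_stable[OF ops_P_power[OF ops_id] S x] .
    then have "ev (tw b') f ((P ^^ j) x) + ev (tw b') g ((P ^^ Suc j) x) \<in> S"
      by (simp add: endo_add[OF endo_funpow[OF P]] b' funpow_swap1)
    moreover have "ev (tw b') g ((P ^^ Suc j) x) \<in> S"
      using ops_stable[OF ops_ev[OF ops_id] S Suc.prems] .
    ultimately have "ev (tw b') f ((P ^^ j) x) \<in> S"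
      using subspace_diff[OF sub] by fastforce
    then have "(P ^^ j) x \<in> S"
      using ops_stable[OF ops_ev[OF ops_id] S] h by metis
    then show ?case
      by (rule Suc.IH)
  qed simp
  from this[of "2 * N"] show ?thesis
    by (simp add: P_nilpotent subspace_0[OF sub])
qed

text \<open>Every element \<open>f(u) + g(u) P\<close> of the operator ring is a power of \<open>P\<close> times a unit, as in a
  noncommutative discrete valuation ring.\<close>

lemma valuation:
  assumes nz: "f \<noteq> 0 \<or> g \<noteq> 0"
    and f: "f \<noteq> 0 \<Longrightarrow> degree f < degree G * ((m + 1) div 2)"
    and g: "g \<noteq> 0 \<Longrightarrow> degree g < degree G * (m div 2)"
  shows "\<exists>k z. k < m \<and> ops z \<and> (\<forall>x. ev u f x + ev u g (P x) = (P ^^ k) (z x)) \<and>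
    (\<forall>S x. stable S \<longrightarrow> z x \<in> S \<longrightarrow> x \<in> S)"
proof -
  let ?h = "\<lambda>a. Polynomial.smult (c ^ a) (Polynomial.monom 1 (2 * a))"
  have P_pow_add: "(P ^^ j) x + (P ^^ j) y = (P ^^ j) (x + y)" for j x y
    by (simp add: endo_add[OF endo_funpow[OF P]])
  have deg: "degree G * a \<le> degree (G ^ a * h)" if "h \<noteq> 0" for a h
    using that G by (subst degree_mult_eq) (auto simp: degree_power_eq)
  have not_dvd: "\<not> G dvd ?h a * h" if "\<not> G dvd h" for a h
    using c that by (intro irreducible_not_dvd_monom_mult[OF G(1,3)]) auto
  \<comment> \<open>Here \<open>f\<close> has at most as many factors \<open>G\<close> as
    \<open>g\<close>, so the term of lowest valuation is the one with \<open>f\<close>, of valuation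
    \<open>2 * a\<close>.\<close>
  have even: ?thesis if "f = G ^ a * f'" "\<not> G dvd f'" "g = G ^ a * g'" for a f' g'
  proof (intro exI conjI allI impI)
    have "f' \<noteq> 0"
      using that by auto
    then have "f \<noteq> 0"
      using that G by auto
    then have "degree G * a < degree G * ((m + 1) div 2)"
      using f deg[OF \<open>f' \<noteq> 0\<close>, of a] that(1) by (metis le_less_trans)
    \<comment> \<open>\<open>a\<close> is below \<open>m\<close> / 2 rounded up, which is the same
      as \<open>2 * a < m\<close>. The degree bounds are the lengths of the two chains in a module
      of length \<open>m\<close>.\<close>
    then show "2 * a < m"
      by auto
    show "ops (\<lambda>x. ev (tw True) (?h a * f') x + ev (tw True) (?h a * g') (P x))"
      by (rule ops_binomial)
    show "ev u f x + ev u g (P x) =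
        (P ^^ (2 * a)) (ev (tw True) (?h a * f') x + ev (tw True) (?h a * g') (P x))" for x
      by (simp only: that ev_G_power_mult P_pow_add tw_def if_True)
    show "x \<in> S" if "stable S" "ev (tw True) (?h a * f') x + ev (tw True) (?h a * g') (P x) \<in> S" for x S
      using unit_reflects_stable[OF not_dvd[OF \<open>\<not> G dvd f'\<close>] that] .
  qed
  \<comment> \<open>Otherwise the term with \<open>g\<close> leads, with valuation
    \<open>2 * a + 1\<close>. Pulling its extra \<open>P\<close> to the front turns the remaining
    polynomials into polynomials in \<open>w\<close>, hence \<open>tw False\<close>.\<close>
  have odd: ?thesis if "g = G ^ a * g'" "\<not> G dvd g'" "f = G ^ a * (G * f')" for a f' g'
  proof (intro exI conjI allI impI)
    have "g' \<noteq> 0"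
      using that by auto
    then have "g \<noteq> 0"
      using that G by auto
    then have "degree G * a < degree G * (m div 2)"
      using g deg[OF \<open>g' \<noteq> 0\<close>, of a] that(1) by (metis le_less_trans)
    then show "2 * a + 1 < m"
      by auto
    let ?f = "?h 1 * (?h a * f')"
    show "ops (\<lambda>x. ev (tw False) (?h a * g') x + ev (tw False) ?f (P x))"
      by (rule ops_binomial)
    show "ev u f x + ev u g (P x) =
        (P ^^ (2 * a + 1)) (ev (tw False) (?h a * g') x + ev (tw False) ?f (P x))" for x
    proof -
      have "ev u f x + ev u g (P x) = (P ^^ (2 * a)) (ev u (G * (?h a * f')) x + ev u (?h a * g') (P x))"
        by (simp only: that(1,3) ev_G_power_mult P_pow_add) (simp only: mult.left_commute[of _ G])
      also have "ev u (G * (?h a * f')) x = P (ev (tw False) ?f (P x))"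
        using P_ev[where b = True and f = ?f and x = x]
        by (simp only: ev_G_mult tw_def if_True not_True_eq_False if_False power_one_right mult_1_right)
      also have "ev u (?h a * g') (P x) = P (ev (tw False) (?h a * g') x)"
        using P_ev[where b = False and f = "?h a * g'" and x = x]
        by (simp only: tw_def if_True not_False_eq_True if_False)
      also have "P (ev (tw False) ?f (P x)) + P (ev (tw False) (?h a * g') x) =
          P (ev (tw False) (?h a * g') x + ev (tw False) ?f (P x))"
        by (simp only: endo_add[OF P] add.commute)
      finally show ?thesis
        by (simp add: funpow_swap1)
    qed
    show "x \<in> S" if "stable S" "ev (tw False) (?h a * g') x + ev (tw False) ?f (P x) \<in> S" for x S
      using unit_reflects_stable[OF not_dvd[OF \<open>\<not> G dvd g'\<close>] that] .
  qed
  show ?thesis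
  proof (cases "f = 0")
    case True
    then obtain b g' where g': "g = G ^ b * g'" "\<not> G dvd g'"
      using nz irreducible_power_decompose[OF G(1), of g] by blast
    show ?thesis
      by (rule odd[OF g', of 0]) (simp add: True)
  next
    case False
    then obtain a f' where f': "f = G ^ a * f'" "\<not> G dvd f'"
      using irreducible_power_decompose[OF G(1), of f] by blast
    show ?thesis
    proof (cases "g = 0")
      case True
      show ?thesis
        by (rule even[OF f', of 0]) (simp add: True)
    next
      case False
      then obtain b g' where g': "g = G ^ b * g'" "\<not> G dvd g'"
        using irreducible_power_decompose[OF G(1), of g] by blast
      show ?thesis
      proof (cases "a \<le> b")
        case True
        then have "g = G ^ a * (G ^ (b - a) * g')"
          by (simp add: g' flip: mult.assoc power_add)
        then show ?thesis
          by (rule even[OF f'])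
      next
        case False
        then obtain e where "a = b + Suc e"
          by (metis less_imp_Suc_add add_Suc_right not_le)
        then have "f = G ^ b * (G * (G ^ e * f'))"
          by (simp add: f'(1) power_add mult_ac)
        then show ?thesis
          by (rule odd[OF g'])
      qed
    qed
  qed
qed

section \<open>Decomposition by a shortest generating list\<close>

definition generators :: "('b \<times> nat) list \<Rightarrow> bool" where
  "generators L \<longleftrightarrow> (\<forall>(v, m)\<in>set L. (P ^^ m) v = 0) \<and>
     (\<forall>S. stable S \<longrightarrow> fst ` set L \<subseteq> S \<longrightarrow> S = UNIV)"

text \<open>\<open>2 * N\<close> bounds the nilpotency order of \<open>P\<close> at every vector.
  Crude bounds suffice, since their sum is minimised later.\<close>

lemma ex_generators: "\<exists>L. generators L"
proof -
  obtain B where B: "finite B" "span B = UNIV"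
    using fin by blast
  then obtain bs where bs: "set bs = B"
    using finite_list by blast
  have "generators (map (\<lambda>v. (v, 2 * N)) bs)"
    unfolding generators_def
  proof (intro conjI allI impI)
    fix S assume "stable S" "fst ` set (map (\<lambda>v. (v, 2 * N)) bs) \<subseteq> S"
    then have "subspace S" "B \<subseteq> S"
      using bs by (simp_all add: stable_def image_image)
    then show "S = UNIV"
      using B(2) span_minimal[of B S] by blast
  qed (simp add: P_nilpotent)
  then show ?thesis ..
qed

text \<open>The exchange step of the structure theorem over a valuation ring. If \<open>l\<close> is
  the least valuation among the coefficients, the relation is \<open>P ^^ l\<close> applied to a
  vector \<open>v\<close> in which some generator has a unit coefficient. So \<open>v\<close> can
  replace that generator, and the length bound drops to \<open>l\<close>.\<close>

lemma reduce_generators: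
  assumes L: "generators L"
    and rel: "(\<Sum>i<length L. ev u (f i) (fst (L ! i)) + ev u (g i) (P (fst (L ! i)))) = 0"
    and f: "\<And>i. i < length L \<Longrightarrow> f i \<noteq> 0 \<Longrightarrow> degree (f i) < degree G * ((snd (L ! i) + 1) div 2)"
    and g: "\<And>i. i < length L \<Longrightarrow> g i \<noteq> 0 \<Longrightarrow> degree (g i) < degree G * (snd (L ! i) div 2)"
    and nz: "\<exists>i<length L. f i \<noteq> 0 \<or> g i \<noteq> 0"
  shows "\<exists>L'. generators L' \<and> sum_list (map snd L') < sum_list (map snd L)"
proof -
  define I where "I = {i. i < length L \<and> (f i \<noteq> 0 \<or> g i \<noteq> 0)}"
  have I: "finite I" "I \<noteq> {}"
    using nz by (auto simp: I_def)
  define good where "good i k z \<longleftrightarrow> k < snd (L ! i) \<and> ops z \<and>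
      (\<forall>x. ev u (f i) x + ev u (g i) (P x) = (P ^^ k) (z x)) \<and>
      (\<forall>S x. stable S \<longrightarrow> z x \<in> S \<longrightarrow> x \<in> S)" for i k z
  have "\<forall>i\<in>I. \<exists>kz. good i (fst kz) (snd kz)"
  proof
    fix i assume "i \<in> I"
    then have i: "i < length L" "f i \<noteq> 0 \<or> g i \<noteq> 0"
      by (simp_all add: I_def)
    have "\<exists>k z. good i k z"
      unfolding good_def by (rule valuation[OF i(2) f[OF i(1)] g[OF i(1)]])
    then show "\<exists>kz. good i (fst kz) (snd kz)"
      by simp
  qed
  then obtain kz where "\<forall>i\<in>I. good i (fst (kz i)) (snd (kz i))"
    by (rule bchoice[THEN exE])
  moreover define k z where "k i = fst (kz i)" and "z i = snd (kz i)" for i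
  ultimately have good: "good i (k i) (z i)" if "i \<in> I" for i
    using that by simp
  have kz: "k i < snd (L ! i)" "ops (z i)"
    "ev u (f i) x + ev u (g i) (P x) = (P ^^ k i) (z i x)"
    "stable S \<Longrightarrow> z i x \<in> S \<Longrightarrow> x \<in> S" if "i \<in> I" for i x S
  proof -
    note * = good[OF that, unfolded good_def]
    show "k i < snd (L ! i)" "ops (z i)" "ev u (f i) x + ev u (g i) (P x) = (P ^^ k i) (z i x)"
      by (rule *[THEN conjunct1], rule *[THEN conjunct2, THEN conjunct1],
        rule *[THEN conjunct2, THEN conjunct2, THEN conjunct1, THEN spec])
    show "stable S \<Longrightarrow> z i x \<in> S \<Longrightarrow> x \<in> S"
      by (rule *[THEN conjunct2, THEN conjunct2, THEN conjunct2, THEN spec, THEN spec, THEN mp, THEN mp])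
  qed
  define l where "l = Min (k ` I)"
  have "l \<in> k ` I"
    using I by (simp add: l_def)
  then obtain i0 where i0: "i0 \<in> I" "k i0 = l"
    by blast
  have l: "l \<le> k i" if "i \<in> I" for i
    using I that by (simp add: l_def)
  define y where "y i x = (P ^^ (k i - l)) (z i x)" for i x
  have y: "ops (y i)" "ev u (f i) x + ev u (g i) (P x) = (P ^^ l) (y i x)" if "i \<in> I" for i x
  proof -
    show "ops (y i)"
      unfolding y_def using kz(2)[OF that] by (rule ops_P_power)
    have "(P ^^ k i) (z i x) = (P ^^ l) ((P ^^ (k i - l)) (z i x))"
      by (rule funpow_diff[OF l[OF that]])
    then show "ev u (f i) x + ev u (g i) (P x) = (P ^^ l) (y i x)"
      by (simp add: kz(3)[OF that] y_def)
  qed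
  define v where "v = (\<Sum>i\<in>I. y i (fst (L ! i)))"
  have "(P ^^ l) v = (\<Sum>i\<in>I. ev u (f i) (fst (L ! i)) + ev u (g i) (P (fst (L ! i))))"
    unfolding v_def by (simp add: endo_sum[OF endo_funpow[OF P]] y(2))
  also have "\<dots> = (\<Sum>i<length L. ev u (f i) (fst (L ! i)) + ev u (g i) (P (fst (L ! i))))"
    by (rule sum.mono_neutral_left) (auto simp: I_def)
  finally have v: "(P ^^ l) v = 0"
    using rel by simp
  have len: "i0 < length L"
    using i0 by (simp add: I_def)
  have "generators (L[i0 := (v, l)])"
    unfolding generators_def
  proof (intro conjI allI impI)
    show "\<forall>(v, m)\<in>set (L[i0 := (v, l)]). (P ^^ m) v = 0"
    proof clarify
      fix x m assume "(x, m) \<in> set (L[i0 := (v, l)])"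
      then have "(x, m) = (v, l) \<or> (x, m) \<in> set L"
        using set_update_subset_insert[of L i0 "(v, l)"] by blast
      then show "(P ^^ m) x = 0"
        using L v unfolding generators_def by blast
    qed
    fix S assume S: "stable S" and gen: "fst ` set (L[i0 := (v, l)]) \<subseteq> S"
    have sub: "subspace S"
      using S by (simp add: stable_def)
    have nth: "fst (L[i0 := (v, l)] ! i) \<in> S" if "i < length L" for i
    proof -
      have "L[i0 := (v, l)] ! i \<in> set (L[i0 := (v, l)])"
        using that by (intro nth_mem) simp
      then show ?thesis
        using gen by blast
    qed
    have vS: "v \<in> S"
      using nth[OF len] len by simp
    have LS: "fst (L ! i) \<in> S" if "i < length L" "i \<noteq> i0" for i
      using nth[OF that(1)] that by simp
    have "(\<Sum>i\<in>I - {i0}. y i (fst (L ! i))) \<in> S"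
    proof (rule subspace_sum[OF sub])
      fix i assume i: "i \<in> I - {i0}"
      then have "fst (L ! i) \<in> S"
        using LS by (simp add: I_def)
      with i show "y i (fst (L ! i)) \<in> S"
        using ops_stable[OF y(1) S] by blast
    qed
    then have "v - (\<Sum>i\<in>I - {i0}. y i (fst (L ! i))) \<in> S"
      using vS subspace_diff[OF sub] by blast
    moreover have "v = y i0 (fst (L ! i0)) + (\<Sum>i\<in>I - {i0}. y i (fst (L ! i)))"
      unfolding v_def by (rule sum.remove[OF I(1) i0(1)])
    ultimately have "y i0 (fst (L ! i0)) \<in> S"
      by simp
    \<comment> \<open>At \<open>i0\<close> the minimum is attained, so \<open>y i0\<close> is
      \<open>z i0\<close> itself, which reflects stable subspaces.\<close>
    then have "z i0 (fst (L ! i0)) \<in> S"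
      by (simp add: y_def i0(2))
    then have L0: "fst (L ! i0) \<in> S"
      by (rule kz(4)[OF i0(1) S])
    have "fst ` set L \<subseteq> S"
    proof (rule image_subsetI)
      fix x assume "x \<in> set L"
      then obtain i where "i < length L" "L ! i = x"
        by (meson in_set_conv_nth)
      then show "fst x \<in> S"
        using LS[of i] L0 by (cases "i = i0") auto
    qed
    then show "S = UNIV"
      using L S unfolding generators_def by blast
  qed
  moreover have "sum_list (map snd (L[i0 := (v, l)])) < sum_list (map snd L)"
  proof -
    have "sum_list (map snd L) = sum_list (map snd (take i0 L @ L ! i0 # drop (Suc i0) L))"
      by (simp only: id_take_nth_drop[OF len, symmetric])
    moreover have "sum_list (map snd (L[i0 := (v, l)])) =
        sum_list (map snd (take i0 L @ (v, l) # drop (Suc i0) L))"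
      by (simp only: upd_conv_take_nth_drop[OF len])
    moreover have "l < snd (L ! i0)"
      using kz(1)[OF i0(1)] i0(2) by simp
    ultimately show ?thesis
      by (simp only: map_append list.map sum_list_append sum_list.Cons snd_conv)
  qed
  ultimately show ?thesis
    by blast
qed

definition pair_blocks :: "('b \<times> nat) list \<Rightarrow> ('b \<times> 'a poly) list" where
  "pair_blocks L = concat (map (\<lambda>(v, m). [(v, G ^ ((m + 1) div 2)), (P v, G ^ (m div 2))]) L)"

lemma set_pair_blocks:
  "x \<in> set (pair_blocks L) \<longleftrightarrow>
    (\<exists>v m. (v, m) \<in> set L \<and> (x = (v, G ^ ((m + 1) div 2)) \<or> x = (P v, G ^ (m div 2))))"
proof -
  have "set (pair_blocks L) = (\<Union>(v, m)\<in>set L. {(v, G ^ ((m + 1) div 2)), (P v, G ^ (m div 2))})"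
    by (simp add: pair_blocks_def split_beta)
  then show ?thesis
    by blast
qed

lemma ev_G_power_eq_0:
  assumes "(P ^^ m) v = 0" "m \<le> 2 * a"
  shows "ev u (G ^ a) v = 0"
proof -
  obtain b where b: "(P ^^ (2 * a)) (ev (tw True) f x) = ev (tw b) f ((P ^^ (2 * a)) x)" for f x
    using P_power_ev by blast
  have "(P ^^ (2 * a)) v = (P ^^ (2 * a - m)) ((P ^^ m) v)"
    using funpow_diff[of "2 * a - m" "2 * a" P v] assms(2) by simp
  then have "(P ^^ (2 * a)) v = 0"
    using assms(1) by (simp add: endo_zero[OF endo_funpow[OF P]])
  then have "(P ^^ (2 * a)) (ev (tw True) f v) = 0" for f
    by (simp add: b endo_zero[OF ev_endo[OF endo_tw]])
  then show ?thesis
    using ev_G_power_mult[of a 1 v] by (simp add: tw_def)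
qed

lemma pair_blocks_annihilated:
  assumes "generators L" "(v, r) \<in> set (pair_blocks L)"
  shows "lead_coeff r = 1" "ev u r v = 0"
proof -
  obtain x m where xm: "(x, m) \<in> set L"
    "v = x \<and> r = G ^ ((m + 1) div 2) \<or> v = P x \<and> r = G ^ (m div 2)"
    using assms(2) unfolding set_pair_blocks by blast
  have Pm: "(P ^^ m) x = 0"
    using assms(1) xm(1) unfolding generators_def by blast
  show "lead_coeff r = 1"
    using xm(2) G(2) by (auto simp: lead_coeff_power)
  show "ev u r v = 0"
  proof (cases "v = x \<and> r = G ^ ((m + 1) div 2)")
    case True
    then show ?thesis
      using ev_G_power_eq_0[OF Pm, of "(m + 1) div 2"] by simp
  next
    case False
    then have v: "v = P x" "r = G ^ (m div 2)"
      using xm(2) by auto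
    \<comment> \<open>For \<open>m = 0\<close> the subtraction is truncated, but then
      \<open>x\<close> is 0.\<close>
    have "(P ^^ (m - 1)) (P x) = 0"
    proof (cases m)
      case 0
      then show ?thesis
        using Pm by (simp add: endo_zero[OF P])
    next
      case (Suc n)
      then show ?thesis
        using Pm by (simp add: funpow_swap1)
    qed
    then show ?thesis
      using ev_G_power_eq_0[of "m - 1" "P x" "m div 2"] v by simp
  qed
qed

text \<open>The span contains the generators, so it suffices that it is stable. It is closed under
  \<open>w\<close> because the inverse of \<open>u\<close> is a polynomial in \<open>u\<close>, and
  under \<open>P\<close> because the square of \<open>P\<close> at a generator is, by
  \<open>ev_G\<close>, a value of polynomials in \<open>u\<close> and \<open>w\<close>.\<close>

lemma span_pair_blocks:
  assumes L: "generators L"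
  shows "span (set (blocks u (pair_blocks L))) = UNIV"
proof -
  define T where "T = span (set (blocks u (pair_blocks L)))"
  have evT: "ev u f v \<in> T" if "(v, r) \<in> set (pair_blocks L)" for v r f
    unfolding T_def using ev_in_span_blocks[OF u pair_blocks_annihilated[OF L that] that] .
  have inv: "h x \<in> T" if "endo h" "x \<in> T" "\<And>v r i. (v, r) \<in> set (pair_blocks L) \<Longrightarrow> h ((u ^^ i) v) \<in> T" for h x
    using span_blocks_invariant[of h x u "pair_blocks L"] that unfolding T_def by blast
  have pow: "(u ^^ i) v = ev u (Polynomial.monom 1 i) v" for i v
    by (simp add: ev_monom[OF u])
  have uT: "u x \<in> T" if "x \<in> T" for x
  proof (rule inv[OF u that])
    fix v r i assume "(v, r) \<in> set (pair_blocks L)"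
    then show "u ((u ^^ i) v) \<in> T"
      using evT[of v r "Polynomial.monom 1 (Suc i)"] by (simp add: ev_monom[OF u])
  qed
  have "\<not> G dvd [:0, 1:]"
    using G by (auto dest: dvd_imp_degree_le)
  then obtain h where h: "ev (tw True) h (ev (tw True) [:0, 1:] x) = x" for x
    using ev_tw_left_inverse by blast
  have wh: "w x = scale \<kappa> (ev u h x)" for x
    using h[of "w x"] by (simp add: tw_def ev_pCons[OF u] uw endo_scale[OF ev_endo[OF u]] endo_zero[OF u])
  have subT: "subspace T"
    by (simp add: T_def)
  have wT: "w x \<in> T" if "x \<in> T" for x
  proof (rule inv[OF w that])
    fix v r i assume "(v, r) \<in> set (pair_blocks L)"
    then show "w ((u ^^ i) v) \<in> T"
      using evT[of v r "h * Polynomial.monom 1 i"]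
      by (simp add: wh pow ev_mult[OF u] subspace_scale[OF subT] del: funpow.simps)
  qed
  have wpT: "(w ^^ i) x \<in> T" if "x \<in> T" for x i
    using that by (induction i) (simp_all add: wT)
  have PT: "P x \<in> T" if "x \<in> T" for x
  proof (rule inv[OF P that])
    fix v r i assume "(v, r) \<in> set (pair_blocks L)"
    then obtain x m where xm: "(x, m) \<in> set L" "v = x \<or> v = P x"
      unfolding set_pair_blocks by blast
    then have "(x, G ^ ((m + 1) div 2)) \<in> set (pair_blocks L)" "(P x, G ^ (m div 2)) \<in> set (pair_blocks L)"
      unfolding set_pair_blocks by blast+
    note xT = this[THEN evT]
    define k where "k = c * \<kappa> * \<kappa>"
    have "w (w (ev u G x)) = scale k (P (P x))" "k \<noteq> 0"
      using c \<kappa> by (simp_all add: k_def ev_G endo_scale[OF w] wu)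
    then have "P (P x) = scale (inverse k) (w (w (ev u G x)))"
      by simp
    then have "P (P x) \<in> T"
      using xT(1)[of G] by (simp add: subspace_scale[OF subT] wT)
    moreover have "P x \<in> T"
      using xT(2)[of 1] by simp
    ultimately have "P v \<in> T"
      using xm(2) by auto
    moreover have "P ((u ^^ i) v) = (w ^^ i) (P v)" for i
      by (induction i) (simp_all add: Pu)
    ultimately show "P ((u ^^ i) v) \<in> T"
      by (simp add: wpT)
  qed
  have "stable T"
    using subT uT wT PT by (simp add: stable_def)
  moreover have "fst ` set L \<subseteq> T"
  proof safe
    fix v m assume "(v, m) \<in> set L"
    then have "(v, G ^ ((m + 1) div 2)) \<in> set (pair_blocks L)"
      unfolding set_pair_blocks by blast
    then show "fst (v, m) \<in> T"
      using evT[of v _ 1] by simp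
  qed
  ultimately have "T = UNIV"
    using L unfolding generators_def by blast
  then show ?thesis
    by (simp add: T_def)
qed

text \<open>In a generating list of least total length the chains are independent: the coefficients
  of a relation, read as polynomials along the two chains of each generator, obey the degree bounds
  of \<open>reduce_generators\<close>, so a nontrivial relation would give a shorter list.\<close>

theorem cyclic_decomp_pair_blocks: "\<exists>L. cyclic_decomp u (pair_blocks L)"
proof -
  obtain L where L: "generators L"
    and min: "\<And>L'. generators L' \<Longrightarrow> sum_list (map snd L) \<le> sum_list (map snd L')"
    using ex_generators ex_has_least_nat[of generators _ "\<lambda>L. sum_list (map snd L)"] by blast
  define d1 d2 where "d1 k = degree G * ((snd (L ! k) + 1) div 2)" and "d2 k = degree G * (snd (L ! k) div 2)" for k
  define bss where "bss = map (\<lambda>k. chain u (fst (L ! k)) (d1 k) @ chain u (P (fst (L ! k))) (d2 k)) [0..<length L]"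
  have "map (\<lambda>(v, m). chain u v (degree G * ((m + 1) div 2)) @ chain u (P v) (degree G * (m div 2))) L = bss"
    by (rule nth_equalityI) (auto simp: bss_def d1_def d2_def split_beta)
  moreover have "blocks u (pair_blocks L) =
    concat (map (\<lambda>(v, m). chain u v (degree G * ((m + 1) div 2)) @ chain u (P v) (degree G * (m div 2))) L)"
  proof (induction L)
    case (Cons x L)
    have "degree (G ^ n) = degree G * n" for n
      using G by (subst degree_power_eq) auto
    then show ?case
      using Cons by (cases x) (simp add: pair_blocks_def)
  qed (simp add: pair_blocks_def)
  ultimately have bl: "blocks u (pair_blocks L) = concat bss"
    by simp
  have ind: "list_independent (blocks u (pair_blocks L))"
    unfolding bl
  proof (rule list_independent_concatI)
    fix C assume C: "(\<Sum>k<length bss. \<Sum>i<length (bss ! k). scale (C k i) (bss ! k ! i)) = 0"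
    define f g where "f k = (\<Sum>i<d1 k. Polynomial.monom (C k i) i)"
      and "g k = (\<Sum>i<d2 k. Polynomial.monom (C k (d1 k + i)) i)" for k
    have "(\<Sum>i<length (bss ! k). scale (C k i) (bss ! k ! i)) =
        ev u (f k) (fst (L ! k)) + ev u (g k) (P (fst (L ! k)))" if "k < length L" for k
      using that by (simp add: bss_def sum_lessThan_add nth_append f_def g_def ev_sum_monom[OF u])
    then have "(\<Sum>k<length L. ev u (f k) (fst (L ! k)) + ev u (g k) (P (fst (L ! k)))) = 0"
      using C by (simp add: bss_def)
    note rel = this
    have df: "degree (f i) < degree G * ((snd (L ! i) + 1) div 2)" if "f i \<noteq> 0" for i
      unfolding f_def d1_def by (rule degree_sum_monom_less) (use that in \<open>simp add: f_def d1_def\<close>)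
    have dg: "degree (g i) < degree G * (snd (L ! i) div 2)" if "g i \<noteq> 0" for i
      unfolding g_def d2_def by (rule degree_sum_monom_less) (use that in \<open>simp add: g_def d2_def\<close>)
    have z: "\<not> (\<exists>i<length L. f i \<noteq> 0 \<or> g i \<noteq> 0)"
    proof
      assume "\<exists>i<length L. f i \<noteq> 0 \<or> g i \<noteq> 0"
      from reduce_generators[OF L rel df dg this]
      obtain L' where "generators L'" "sum_list (map snd L') < sum_list (map snd L)"
        by blast
      with min[of L'] show False
        by simp
    qed
    show "\<forall>k<length bss. \<forall>i<length (bss ! k). C k i = 0"
    proof (intro allI impI)
      fix k i assume "k < length bss" "i < length (bss ! k)"
      then have k: "k < length L" and i: "i < d1 k + d2 k"
        by (simp_all add: bss_def)
      then have "f k = 0" "g k = 0"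
        using z by blast+
      then have fg: "Polynomial.coeff (f k) j = 0" "Polynomial.coeff (g k) j = 0" for j
        by simp_all
      show "C k i = 0"
      proof (cases "i < d1 k")
        case True
        then show ?thesis
          using fg(1)[of i] by (simp add: f_def coeff_sum_monom)
      next
        case False
        then show ?thesis
          using i fg(2)[of "i - d1 k"] by (simp add: g_def coeff_sum_monom split: if_splits)
      qed
    qed
  qed
  have "ordered_basis scale (blocks u (pair_blocks L))"
    unfolding ordered_basis_iff using ind span_pair_blocks[OF L] by (rule conjI)
  then have "cyclic_decomp u (pair_blocks L)"
    unfolding cyclic_decomp_def using pair_blocks_annihilated[OF L] by blast
  then show ?thesis ..
qed

end

section \<open>Linear maps prescribed on generators\<close>

context plain_vector_space
begin

lemma ev_commute_endo:
  assumes "endo u" "endo h" "\<And>x. u (h x) = h (u x)"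
  shows "ev u f (h x) = h (ev u f x)"
  by (induction f) (simp_all add: ev_pCons assms endo_zero endo_add endo_scale)

lemma endo_eq_on_basis:
  assumes f: "endo f" and g: "endo g" and bs: "ordered_basis scale bs"
    and eq: "\<And>j. j < length bs \<Longrightarrow> f (bs ! j) = g (bs ! j)"
  shows "f x = g x"
proof -
  have base: "f b = g b" if "b \<in> set bs" for b
    using that eq by (metis in_set_conv_nth)
  have "x \<in> span (set bs)"
    using bs by (simp add: ordered_basis_def)
  then show ?thesis
  proof (induction rule: span_induct_alt)
    case base
    then show ?case
      by (simp add: endo_zero[OF f] endo_zero[OF g])
  next
    case (step c x y)
    then show ?case
      by (simp add: base endo_add[OF f] endo_add[OF g] endo_scale[OF f] endo_scale[OF g])
  qed
qed

lemma length_blocks_eq: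
  "map snd ps = map snd ps' \<Longrightarrow> length (blocks u ps) = length (blocks w ps')"
proof (induction ps arbitrary: ps')
  case (Cons x ps)
  then obtain y ps'' where "ps' = y # ps''" "snd x = snd y" "map snd ps = map snd ps''"
    by auto
  then show ?case
    using Cons.IH by (cases x; cases y) simp
qed simp

lemma zip_blocks:
  assumes "map snd ps = map snd ps'" "((v, r), (v', r')) \<in> set (zip ps ps')" "0 < degree r"
  shows "(v, v') \<in> set (zip (blocks u ps) (blocks w ps'))"
  using assms
proof (induction ps arbitrary: ps')
  case (Cons x ps)
  then obtain y ps'' where y: "ps' = y # ps''" "snd x = snd y" "map snd ps = map snd ps''"
    by auto
  obtain x1 y1 s where xy: "x = (x1, s)" "y = (y1, s)"
    using y(2) by (cases x; cases y) simp
  have z: "zip (blocks u (x # ps)) (blocks w ps') =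
      zip (chain u x1 (degree s)) (chain w y1 (degree s)) @ zip (blocks u ps) (blocks w ps'')"
    by (simp add: y xy)
  show ?case
  proof (cases "((v, r), (v', r')) = (x, y)")
    case True
    then have "zip (chain u x1 (degree s)) (chain w y1 (degree s)) ! 0 = (v, v')"
      using Cons.prems(3) xy by simp
    then have "(v, v') \<in> set (zip (chain u x1 (degree s)) (chain w y1 (degree s)))"
      using True Cons.prems(3) xy by (metis length_chain length_zip min.idem nth_mem prod.inject)
    then show ?thesis
      by (simp only: z set_append Un_iff simp_thms)
  next
    case False
    then have "((v, r), (v', r')) \<in> set (zip ps ps'')"
      using Cons.prems(2) y(1) by auto
    then have "(v, v') \<in> set (zip (blocks u ps) (blocks w ps''))"
      using Cons.IH[OF y(3)] Cons.prems(3) by simp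
    then show ?thesis
      by (simp only: z set_append Un_iff simp_thms)
  qed
qed simp

text \<open>The universal property of a sum of cyclic modules: generators may be sent to any vectors
  killed by the same polynomials at \<open>w\<close>. Both lists of vectors obey the same block
  matrix, which gives the intertwining relation on the basis.\<close>

lemma cyclic_decomp_intertwiner:
  assumes u: "endo u" and w: "endo w" and ps: "cyclic_decomp u ps"
    and snd: "map snd ps = map snd ps'" and ps': "\<forall>(v, r)\<in>set ps'. ev w r v = 0"
  shows "\<exists>P. endo P \<and> (\<forall>x. P (u x) = w (P x)) \<and>
    (\<forall>v r v' r'. ((v, r), (v', r')) \<in> set (zip ps ps') \<longrightarrow> P v = v')"
proof -
  define bs cs M where "bs = blocks u ps" and "cs = blocks w ps'" and "M = companions (map snd ps)"
  have basis: "ordered_basis scale bs" and ann: "\<forall>(v, r)\<in>set ps. lead_coeff r = 1 \<and> ev u r v = 0"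
    using ps by (simp_all add: cyclic_decomp_def bs_def)
  have "\<forall>r\<in>set (map snd ps'). lead_coeff r = 1"
    unfolding snd[symmetric] using ann by auto
  then have ann': "\<forall>(v, r)\<in>set ps'. lead_coeff r = 1 \<and> ev w r v = 0"
    using ps' by fastforce
  have len: "length bs = length cs"
    unfolding bs_def cs_def by (rule length_blocks_eq[OF snd])
  have ub: "u (bs ! j) = (\<Sum>i<length bs. scale (M $$ (i, j)) (bs ! i))" if "j < length bs" for j
    using acts_by_blocks[OF ann] that unfolding acts_by_def bs_def M_def by blast
  have wc: "w (cs ! j) = (\<Sum>i<length bs. scale (M $$ (i, j)) (cs ! i))" if "j < length bs" for j
    using acts_by_blocks[OF ann'] that unfolding acts_by_def len unfolding cs_def M_def snd by blast
  interpret vv: vector_space_pair scale scale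
    by unfold_locales
  have "independent (set bs)" and dist: "distinct bs"
    using basis by (simp_all add: ordered_basis_def)
  then obtain P where P: "endo P" and Pf: "\<forall>x\<in>set bs. P x = the (map_of (zip bs cs) x)"
    using vv.linear_independent_extend[of "set bs" "\<lambda>x. the (map_of (zip bs cs) x)"] by blast
  have Pb: "P (bs ! j) = cs ! j" if "j < length bs" for j
    using Pf that map_of_zip_nth[OF len dist, of j] len by simp
  have "P (u x) = w (P x)" for x
  proof (rule endo_eq_on_basis[where f = "\<lambda>x. P (u x)" and g = "\<lambda>x. w (P x)", OF _ _ basis])
    show "endo (\<lambda>x. P (u x))" "endo (\<lambda>x. w (P x))"
      by (auto intro!: endoI simp: endo_add[OF P] endo_add[OF u] endo_add[OF w]
        endo_scale[OF P] endo_scale[OF u] endo_scale[OF w])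
    fix j assume j: "j < length bs"
    have "P (u (bs ! j)) = (\<Sum>i<length bs. scale (M $$ (i, j)) (P (bs ! i)))"
      by (simp only: ub[OF j] endo_sum[OF P] endo_scale[OF P])
    also have "\<dots> = w (cs ! j)"
      unfolding wc[OF j] by (rule sum.cong) (simp_all add: Pb)
    finally show "P (u (bs ! j)) = w (P (bs ! j))"
      by (simp add: Pb j)
  qed
  moreover have "P v = v'" if z: "((v, r), (v', r')) \<in> set (zip ps ps')" for v r v' r'
  proof (cases "0 < degree r")
    case True
    then have "(v, v') \<in> set (zip bs cs)"
      unfolding bs_def cs_def by (rule zip_blocks[OF snd z])
    then obtain j where "j < length bs" "v = bs ! j" "v' = cs ! j"
      by (auto simp: set_zip)
    then show ?thesis
      by (simp add: Pb)
  next
    \<comment> \<open>Degree 0 means that the polynomial is 1, which leaves 0 as the only value of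
      both generators.\<close>
    case False
    have "(v, r) \<in> set ps" "(v', r') \<in> set ps'"
      using z by (auto dest: set_zip_leftD set_zip_rightD)
    then have r: "lead_coeff r = 1" "ev u r v = 0" "ev w r' v' = 0"
      using ann ann' by auto
    obtain k where k: "k < length ps" "k < length ps'" "ps ! k = (v, r)" "ps' ! k = (v', r')"
      using z by (auto simp: set_zip)
    then have "r = r'"
      using arg_cong[OF snd, of "\<lambda>xs. xs ! k"] by simp
    moreover have "r = 1"
      using False r(1) by (simp add: monic_degree_0)
    ultimately show ?thesis
      using r by (simp add: endo_zero[OF P])
  qed
  ultimately show ?thesis
    using P by blast
qed

end

section \<open>The quadratic relations\<close>

text \<open>What the operator calculus uses of the separability hypotheses: characteristic two, the
  shape of the three polynomials, and the irreducibility of \<open>G\<close>.\<close>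

locale char2_quadratics = plain_vector_space scale
  for scale :: "'a::field \<Rightarrow> 'b::ab_group_add \<Rightarrow> 'b" +
  fixes \<alpha> \<tau> \<delta> :: 'a and G p q :: "'a poly"
  assumes char2: "(1::'a) + 1 = 0"
    and nz: "\<alpha> \<noteq> 0" "\<delta> \<noteq> 0"
    and p: "p = [:\<alpha>, \<tau>, 1:]" and q: "q = [:\<delta>, 0, 1:]"
    and G_eq: "G = [:(\<alpha> / \<delta>)\<^sup>2, 0, \<tau>\<^sup>2 / \<delta>, 0, 1:]"
    and G_irred: "irreducible G"
    and fin: "\<exists>B. finite B \<and> span B = UNIV"
begin

lemma add_self: "x + x = (0::'b)"
proof -
  have "x + x = scale (1 + 1) x"
    by (simp only: scale_left_distrib scale_one)
  then show ?thesis
    by (simp only: char2 scale_zero_left)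
qed

lemma add_self_left: "x + (x + y) = (y::'b)"
  by (simp add: add_self flip: add.assoc)

lemma eq_if_add_eq_0: "x + y = 0 \<Longrightarrow> x = (y::'b)"
  by (metis add_self add_left_cancel)

definition \<kappa> :: 'a where "\<kappa> = \<alpha> / \<delta>"

lemma \<kappa>: "\<kappa> \<noteq> 0"
  using nz by (simp add: \<kappa>_def)

lemma degree_G: "degree G = 4"
  by (simp add: G_eq)

lemma monic_G: "lead_coeff G = 1"
  by (simp add: G_eq)

lemma ev_G_expand:
  assumes "endo u"
  shows "ev u G x = u (u (u (u x))) + scale (\<tau>\<^sup>2 / \<delta>) (u (u x)) + scale (\<kappa>\<^sup>2) x"
  by (simp add: G_eq ev_pCons[OF assms] endo_add[OF assms] endo_scale[OF assms] endo_zero[OF assms]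
      \<kappa>_def ac_simps)

lemma quotient_imp_twisted:
  assumes a: "endo a" and b: "endo b" and pa: "annihilates scale p a" and qb: "annihilates scale q b"
    and u: "endo u" and ub: "\<And>x. u (b x) = a x"
  shows "\<exists>w P. endo w \<and> endo P \<and> (\<forall>x. u (w x) = scale \<kappa> x) \<and> (\<forall>x. w (u x) = scale \<kappa> x) \<and>
    (\<forall>x. P (u x) = w (P x)) \<and> (\<forall>x. ev u G x = scale (1 / \<delta> ^ 3) (u (u (P (P x)))))"
proof -
  have aa: "a (a x) = scale \<tau> (a x) + scale \<alpha> x" for x
  proof (rule eq_if_add_eq_0)
    have "ev a p x = 0"
      using pa by (simp add: annihilates_def)
    then show "a (a x) + (scale \<tau> (a x) + scale \<alpha> x) = 0"
      by (simp add: p ev_pCons[OF a] endo_add[OF a] endo_scale[OF a] endo_zero[OF a] ac_simps)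
  qed
  have bb: "b (b x) = scale \<delta> x" for x
  proof (rule eq_if_add_eq_0)
    have "ev b q x = 0"
      using qb by (simp add: annihilates_def)
    then show "b (b x) + scale \<delta> x = 0"
      by (simp add: q ev_pCons[OF b] endo_add[OF b] endo_scale[OF b] endo_zero[OF b] ac_simps)
  qed
  \<comment> \<open>Since a^-1 = \<alpha>^-1 (a + \<tau>), the operator \<kappa> u^-1 = \<kappa> b
    a^-1 is \<delta>^-1 b (a + \<tau>).\<close>
  define w P where "w x = scale (1 / \<delta>) (b (scale \<tau> x + a x))" and "P x = b (a (b x)) + scale \<delta> (a x)" for x
  note lin = endo_add[OF a] endo_scale[OF a] endo_add[OF b] endo_scale[OF b]
  have ux: "u x = scale (1 / \<delta>) (a (b x))" for x
  proof -
    have "scale \<delta> (u x) = a (b x)"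
      using ub[of "b x"] by (simp add: bb endo_scale[OF u])
    then show ?thesis
      using nz by (metis nonzero_divide_eq_eq scale_one scale_scale)
  qed
  have w: "endo w" and P: "endo P"
    by (auto intro!: endoI simp: w_def P_def lin algebra_simps)
  have "u (w x) = scale \<kappa> x" "w (u x) = scale \<kappa> x" for x
    using nz by (simp_all add: ux w_def lin bb aa \<kappa>_def scale_right_distrib add_self_left)
  moreover have "P (u x) = w (P x)" for x
  proof -
    have "P (a (b x)) = b (scale \<tau> (P x) + a (P x))"
      by (simp add: P_def lin bb aa scale_right_distrib ac_simps add_self add_self_left)
    then show ?thesis
      by (simp add: ux w_def endo_scale[OF P])
  qed
  moreover have "ev u G x = scale (1 / \<delta> ^ 3) (u (u (P (P x))))" for x
  proof -
    \<comment> \<open>\<open>U\<close> is \<delta> times \<open>u\<close> and clears the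
      denominators. The sum in brackets in \<open>U4\<close> is \<open>\<delta> ^ 4\<close> times
      \<open>G\<close> at \<open>u\<close>.\<close>
    define U where "U x = a (b x)" for x
    have U4: "scale \<delta> (U (U (U (U x))) + scale (\<tau> * \<tau> * \<delta>) (U (U x)) + scale (\<alpha> * \<alpha> * \<delta> * \<delta>) x) =
        U (U (P (P x)))"
      by (simp add: U_def P_def lin bb aa scale_right_distrib ac_simps add_self add_self_left)
    have uU: "u x = scale (1 / \<delta>) (U x)" for x
      by (simp add: ux U_def)
    have linU: "U (scale k x) = scale k (U x)" for k x
      by (simp add: U_def lin)
    have "scale (1 / \<delta> ^ 3) (u (u (P (P x)))) = scale (1 / \<delta> ^ 5) (U (U (P (P x))))"
      by (simp add: uU linU power_def)
    also have "\<dots> = scale (1 / \<delta> ^ 4) (U (U (U (U x))) + scale (\<tau> * \<tau> * \<delta>) (U (U x)) + scale (\<alpha> * \<alpha> * \<delta> * \<delta>) x)"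
      using nz by (simp add: eval_nat_numeral flip: U4)
    also have "\<dots> = ev u G x"
      using nz by (simp add: ev_G_expand[OF u] uU linU scale_right_distrib \<kappa>_def eval_nat_numeral field_simps)
    finally show ?thesis ..
  qed
  ultimately show ?thesis
    using w P by blast
qed

text \<open>\<open>b\<close> is the solution of P = s b + \<tau>\<delta>, with \<open>t\<close> as
  the inverse of \<open>s\<close>, and \<open>a\<close> is forced by u = a b^-1. What has to be
  checked are the quadratic relations of \<open>a\<close> and \<open>b\<close>.\<close>

lemma twisted_imp_quotient:
  assumes u: "endo u" and w: "endo w" and P: "endo P"
    and uw: "\<And>x. u (w x) = scale \<kappa> x" and wu: "\<And>x. w (u x) = scale \<kappa> x"
    and Pu: "\<And>x. P (u x) = w (P x)"
    and evG: "\<And>x. ev u G x = scale (1 / \<delta> ^ 3) (u (u (P (P x))))"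
    and nil: "\<And>x. ev u (G ^ N) x = 0"
  shows "pq_quotient scale p q u"
proof -
  have Pw: "P (w x) = u (P x)" for x
    by (rule intertwiner_conj[OF u P \<kappa> uw Pu])
  have PP: "P (P x) = scale (\<delta> ^ 3) (u (u x) + scale (\<tau>\<^sup>2 / \<delta>) x + w (w x))" for x
  proof -
    have "w (w (ev u G x)) = scale (\<kappa> * \<kappa>) (u (u x) + scale (\<tau>\<^sup>2 / \<delta>) x + w (w x))"
      by (simp add: ev_G_expand[OF u] endo_add[OF w] endo_scale[OF w] wu scale_right_distrib
          power2_eq_square ac_simps)
    moreover have "w (w (ev u G x)) = scale (\<kappa> * \<kappa>) (scale (1 / \<delta> ^ 3) (P (P x)))"
      by (simp add: evG endo_scale[OF w] wu ac_simps)
    ultimately have "scale (1 / \<delta> ^ 3) (P (P x)) = u (u x) + scale (\<tau>\<^sup>2 / \<delta>) x + w (w x)"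
      using \<kappa> by (metis mult_eq_0_iff scale_cancel_left)
    then have "scale (\<delta> ^ 3) (scale (1 / \<delta> ^ 3) (P (P x))) =
        scale (\<delta> ^ 3) (u (u x) + scale (\<tau>\<^sup>2 / \<delta>) x + w (w x))"
      by (rule arg_cong)
    then show ?thesis
      using nz by simp
  qed
  \<comment> \<open>At \<open>u\<close> this quadratic is u^2 + \<kappa>, which equals u s up to the
    factor \<delta>; its invertibility gives that of \<open>s\<close>.\<close>
  have "\<not> G dvd [:\<kappa>, 0, 1:]"
    using degree_G by (auto dest: dvd_imp_degree_le)
  then obtain g h where gh: "g * G ^ N + h * [:\<kappa>, 0, 1:] = 1"
    using irreducible_power_bezout[OF G_irred] by blast
  have h: "ev u h (u (u x) + scale \<kappa> x) = x" for x
  proof -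
    have "ev u (g * G ^ N + h * [:\<kappa>, 0, 1:]) x = ev u h (u (u x) + scale \<kappa> x)"
      by (simp only: ev_add[OF u] ev_mult[OF u] nil endo_zero[OF ev_endo[OF u]])
        (simp add: ev_pCons[OF u] endo_zero[OF u] add.commute)
    then show ?thesis
      by (simp only: gh ev_1)
  qed
  define s where "s x = scale \<delta> (u x + w x)" for x
  \<comment> \<open>From u s = \<delta> (u^2 + \<kappa>) follows s^-1 = \<delta>^-1 u h(u).\<close>
  define t where "t x = scale (1 / \<delta>) (u (ev u h x))" for x
  have t: "endo t" and s: "endo s"
    by (auto intro!: endoI simp: t_def s_def endo_add[OF u] endo_scale[OF u] endo_add[OF w] endo_scale[OF w]
        endo_add[OF ev_endo[OF u]] endo_scale[OF ev_endo[OF u]] scale_right_distrib ac_simps)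
  have ts: "t (s x) = x" for x
  proof -
    have "t (s x) = ev u h (u (u x + w x))"
      using nz by (simp add: t_def s_def endo_scale[OF ev_endo[OF u]] endo_scale[OF u] ev_commute[OF u])
    then show ?thesis
      by (simp add: endo_add[OF u] uw h)
  qed
  \<comment> \<open>\<open>P\<close> exchanges \<open>u\<close> and \<open>w\<close>, and
    \<open>s\<close> is symmetric in them.\<close>
  have su: "s (u x) = u (s x)" and sw: "s (w x) = w (s x)" and sP: "s (P x) = P (s x)" for x
    by (simp_all add: s_def endo_scale[OF u] endo_scale[OF w] endo_scale[OF P] endo_add[OF u]
        endo_add[OF w] endo_add[OF P] uw wu Pu Pw add.commute)
  have st: "s (t x) = x" for x
  proof -
    have "ev u h (s x) = s (ev u h x)" for x
      by (rule ev_commute_endo[OF u s]) (simp add: su)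
    then have "s (t x) = t (s x)"
      by (simp add: t_def endo_scale[OF s] su)
    then show ?thesis
      by (simp add: ts)
  qed
  have t_comm: "t (f x) = f (t x)" if "\<And>x. s (f x) = f (s x)" for f x
    using that[of "t x"] by (metis st ts)
  have tu: "t (u x) = u (t x)" and tw: "t (w x) = w (t x)" and tP: "t (P x) = P (t x)" for x
    by (rule t_comm, rule su, rule t_comm, rule sw, rule t_comm, rule sP)
  define b a where "b x = t (P x + scale (\<tau> * \<delta>) x)" and "a x = u (b x)" for x
  note lin = endo_add[OF t] endo_scale[OF t] endo_add[OF P] endo_scale[OF P] endo_add[OF u] endo_scale[OF u]
    endo_add[OF w] endo_scale[OF w]
  have b: "endo b"
    by (auto intro!: endoI simp: b_def lin scale_right_distrib ac_simps)
  have a: "endo a"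
    by (auto intro!: endoI simp: a_def lin endo_add[OF b] endo_scale[OF b])
  \<comment> \<open>\<open>s\<close> times \<open>b\<close> is P + \<tau>\<delta>, whose square has
    no cross term in characteristic two.\<close>
  have bb: "b (b x) = scale \<delta> x" for x
  proof -
    have ss: "s (s x) = scale (\<delta> * \<delta>) (u (u x) + w (w x))"
      by (simp add: s_def lin uw wu scale_right_distrib ac_simps add_self add_self_left)
    have "P (P x) + scale (\<tau> * \<delta> * (\<tau> * \<delta>)) x = scale \<delta> (s (s x))"
      using nz by (simp add: PP ss scale_right_distrib power2_eq_square power3_eq_cube ac_simps add_self add_self_left)
    moreover have "b (b x) = t (t (P (P x) + scale (\<tau> * \<delta> * (\<tau> * \<delta>)) x))"
      by (simp add: b_def lin scale_right_distrib ac_simps add_self_left flip: tP)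
    ultimately show ?thesis
      by (simp add: lin ts)
  qed
  \<comment> \<open>\<open>b\<close> exchanges \<open>u\<close> and \<open>w\<close> up to the
    constant \<tau>. With a = u b this yields a^2 = u b u b = \<kappa> b^2 + \<tau> a, and
    \<kappa>\<delta> = \<alpha>.\<close>
  have bu: "b (u x) = w (b x) + scale \<tau> x" for x
  proof -
    have "b (u x) = t (w (P x)) + t (scale (\<tau> * \<delta>) (u x))"
      by (simp add: b_def lin Pu)
    moreover have "w (b x) = t (w (P x)) + t (scale (\<tau> * \<delta>) (w x))"
      by (simp add: b_def lin tw)
    moreover have "scale \<tau> x = t (scale (\<tau> * \<delta>) (u x)) + t (scale (\<tau> * \<delta>) (w x))"
    proof -
      have "scale \<tau> x = scale \<tau> (t (s x))"
        by (simp add: ts)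
      then show ?thesis
        by (simp add: s_def lin scale_right_distrib)
    qed
    ultimately show ?thesis
      by (simp add: ac_simps add_self add_self_left)
  qed
  have aa: "a (a x) = scale \<tau> (a x) + scale \<alpha> x" for x
    using nz by (simp add: a_def bu lin uw bb \<kappa>_def ac_simps)
  have bij_b: "bij b"
  proof (rule o_bij)
    show "(\<lambda>x. scale (1 / \<delta>) (b x)) \<circ> b = id" "b \<circ> (\<lambda>x. scale (1 / \<delta>) (b x)) = id"
      using nz by (simp_all add: fun_eq_iff bb endo_scale[OF b])
  qed
  have bij_u: "bij u"
  proof (rule o_bij)
    show "(\<lambda>x. scale (1 / \<kappa>) (w x)) \<circ> u = id" "u \<circ> (\<lambda>x. scale (1 / \<kappa>) (w x)) = id"
      using \<kappa> by (simp_all add: fun_eq_iff uw wu endo_scale[OF u])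
  qed
  have a_comp: "a = u \<circ> b"
    by (simp add: fun_eq_iff a_def)
  have "bij a"
    unfolding a_comp by (rule bij_comp[OF bij_b bij_u])
  moreover have "annihilates scale p a"
    by (simp add: annihilates_def p ev_pCons[OF a] endo_add[OF a] endo_scale[OF a] endo_zero[OF a] aa
        ac_simps add_self add_self_left)
  moreover have "annihilates scale q b"
    by (simp add: annihilates_def q ev_pCons[OF b] endo_add[OF b] endo_scale[OF b] endo_zero[OF b] bb add_self)
  moreover have "u = a \<circ> inv_into UNIV b"
    using bij_b by (simp add: a_comp fun_eq_iff bij_is_surj surj_f_inv_f)
  ultimately show ?thesis
    using a b bij_b unfolding pq_quotient_def automorphism_def endomorphism_def by blast
qed

text \<open>\<open>G\<close> is self-reciprocal under t -> \<kappa>/t: both sides are \<kappa>^2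
  (u^2 + w^2 + \<tau>^2/\<delta>) applied to \<open>x\<close>.\<close>

lemma ev_conj_G:
  assumes u: "endo u" and w: "endo w"
    and uw: "\<And>x. u (w x) = scale \<kappa> x" and wu: "\<And>x. w (u x) = scale \<kappa> x"
  shows "u (u (ev w G x)) = w (w (ev u G x))"
  by (simp add: ev_G_expand[OF u] ev_G_expand[OF w] endo_add[OF w] endo_scale[OF w] endo_add[OF u]
      endo_scale[OF u] wu uw power2_eq_square ac_simps)

text \<open>Iterating \<open>ev_conj_G\<close> exchanges the powers of \<open>G\<close> at
  \<open>u\<close> and at \<open>w\<close> up to powers of \<open>u\<close> and \<open>w\<close>,
  and \<open>u\<close> is injective.\<close>

lemma ev_conj_G_power_eq_0:
  assumes u: "endo u" and w: "endo w"
    and uw: "\<And>x. u (w x) = scale \<kappa> x" and wu: "\<And>x. w (u x) = scale \<kappa> x"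
    and x: "ev u (G ^ n) x = 0"
  shows "ev w (G ^ n) x = 0"
proof -
  have ew: "ev u f (w x) = w (ev u f x)" for f x
    by (rule ev_commute_endo[OF u w]) (simp add: uw wu)
  have eu: "ev w f (u x) = u (ev w f x)" for f x
    by (rule ev_commute_endo[OF w u]) (simp add: uw wu)
  have "ev u f (ev w g x) = ev w g (ev u f x)" for f g x
    by (rule ev_commute_endo[OF u ev_endo[OF w]]) (simp add: eu)
  note comm = this
  have "(u ^^ (2 * n)) (ev w (G ^ n) x) = (w ^^ (2 * n)) (ev u (G ^ n) x)" for x
  proof (induction n arbitrary: x)
    case (Suc n)
    have "(u ^^ (2 * Suc n)) (ev w (G ^ Suc n) x) = (u ^^ (2 * n)) (ev w (G ^ n) (u (u (ev w G x))))"
      by (simp add: ev_mult'[OF w] eu funpow_swap1)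
    also have "\<dots> = (u ^^ (2 * n)) (ev w (G ^ n) (w (w (ev u G x))))"
      by (simp only: ev_conj_G[OF u w uw wu])
    also have "\<dots> = (w ^^ (2 * n)) (ev u (G ^ n) (w (w (ev u G x))))"
      by (rule Suc.IH)
    also have "\<dots> = (w ^^ (2 * Suc n)) (ev u (G ^ Suc n) x)"
      by (simp add: ev_mult'[OF u] ew funpow_swap1)
    finally show ?case .
  qed simp
  then have 0: "(u ^^ (2 * n)) (ev w (G ^ n) x) = 0"
    using x by (simp add: endo_zero[OF endo_funpow[OF w]])
  have "y = 0" if "u y = 0" for y
    using wu[of y] that \<kappa> by (simp add: endo_zero[OF w])
  then have "(u ^^ k) y = 0 \<Longrightarrow> y = 0" for k y
    by (induction k) auto
  then show ?thesis
    using 0 by blast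
qed

lemma inverse_from_nilpotent:
  assumes u: "endo u" and nil: "\<And>x. ev u (G ^ N) x = 0"
  shows "\<exists>w. endo w \<and> (\<forall>x. u (w x) = scale \<kappa> x) \<and> (\<forall>x. w (u x) = scale \<kappa> x)"
proof -
  have "\<not> G dvd [:0, 1:]"
    using degree_G by (auto dest: dvd_imp_degree_le)
  then obtain g h where gh: "g * G ^ N + h * [:0, 1:] = 1"
    using irreducible_power_bezout[OF G_irred] by blast
  have h: "ev u h (u x) = x" for x
  proof -
    have "ev u (g * G ^ N + h * [:0, 1:]) x = ev u h (u x)"
      by (simp only: ev_add[OF u] ev_mult[OF u] nil endo_zero[OF ev_endo[OF u]])
        (simp add: ev_pCons[OF u] endo_zero[OF u])
    then show ?thesis
      by (simp only: gh ev_1)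
  qed
  have "endo (\<lambda>x. scale \<kappa> (ev u h x))"
    by (auto intro!: endoI simp: endo_add[OF ev_endo[OF u]] endo_scale[OF ev_endo[OF u]]
        scale_right_distrib ac_simps)
  moreover have "u (scale \<kappa> (ev u h x)) = scale \<kappa> x" "scale \<kappa> (ev u h (u x)) = scale \<kappa> x" for x
    using h[of x] by (simp_all add: endo_scale[OF u] flip: ev_commute[OF u])
  ultimately show ?thesis
    by (intro exI[of _ "\<lambda>x. scale \<kappa> (ev u h x)"]) blast
qed

text \<open>One entry is one diagonal block of condition (iii) together with the generators of its
  two cyclic summands.\<close>

definition exponent_blocks :: "('b \<times> 'b \<times> nat \<times> nat) list \<Rightarrow> ('b \<times> 'a poly) list" where
  "exponent_blocks qs = concat (map (\<lambda>(v, v', n, e). [(v, G ^ (n + e)), (v', G ^ n)]) qs)"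

lemma exponent_blocks_simps [simp]:
  "exponent_blocks [] = []"
  "exponent_blocks ((v, v', n, e) # qs) = (v, G ^ (n + e)) # (v', G ^ n) # exponent_blocks qs"
  by (simp_all add: exponent_blocks_def)

lemma set_exponent_blocks:
  "(v, v', n, e) \<in> set qs \<Longrightarrow> (v, G ^ (n + e)) \<in> set (exponent_blocks qs) \<and> (v', G ^ n) \<in> set (exponent_blocks qs)"
  by (induction qs) auto

text \<open>\<open>P\<close> is defined by v -> v' -> t v, where \<open>t\<close> is the value that
  the square of \<open>P\<close> must take. It exists if v' and t v are killed by the powers of
  \<open>G\<close> that belong to v and v'; for t v this is where \<open>e \<le> 1\<close>
  enters.\<close>

lemma exponent_blocks_imp_quotient:
  assumes u: "endo u" and qs: "\<forall>(v, v', n, e)\<in>set qs. e \<le> 1" and dec: "cyclic_decomp u (exponent_blocks qs)"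
    and nil: "\<And>x. ev u (G ^ N) x = 0"
  shows "pq_quotient scale p q u"
proof -
  obtain w where w: "endo w" and uw: "\<And>x. u (w x) = scale \<kappa> x" and wu: "\<And>x. w (u x) = scale \<kappa> x"
    using inverse_from_nilpotent[OF u nil] by blast
  \<comment> \<open>This is \<delta>^3 u^-2 G(u), with u^-1 written as w/\<kappa>.\<close>
  define t where "t v = scale (\<delta> ^ 3 / \<kappa>\<^sup>2) (w (w (ev u G v)))" for v
  have ew: "ev u f (w x) = w (ev u f x)" for f x
    by (rule ev_commute_endo[OF u w]) (simp add: uw wu)
  define ps' where "ps' = concat (map (\<lambda>(v, v', n, e). [(v', G ^ (n + e)), (t v, G ^ n)]) qs)"
  have ann: "ev u (G ^ (n + e)) v = 0 \<and> ev u (G ^ n) v' = 0" if "(v, v', n, e) \<in> set qs" for v v' n e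
    using set_exponent_blocks[OF that] dec unfolding cyclic_decomp_def by blast
  have snd_eq: "map snd (exponent_blocks qs) = map snd ps'"
    by (simp add: ps'_def exponent_blocks_def map_concat o_def split_beta)
  have ps': "ev w r x = 0" if x: "(x, r) \<in> set ps'" for x r
  proof -
    obtain v v' n e where vq: "(v, v', n, e) \<in> set qs"
      and xr: "x = v' \<and> r = G ^ (n + e) \<or> x = t v \<and> r = G ^ n"
      using x unfolding ps'_def by fastforce
    have e: "e \<le> 1"
      using qs vq by blast
    have "ev u r x = 0"
      using xr
    proof
      assume "x = v' \<and> r = G ^ (n + e)"
      then show ?thesis
        using ann[OF vq] by (simp add: power_add ev_mult'[OF u] endo_zero[OF ev_endo[OF u]])
    next
      assume xr: "x = t v \<and> r = G ^ n"
      have "G ^ (n + e) dvd G ^ (n + 1)"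
        using e by (intro le_imp_power_dvd) simp
      then have "ev u (G ^ (n + 1)) v = 0"
        using ann[OF vq] ev_dvd[OF u] by blast
      then have "ev u (G ^ n) (ev u G v) = 0"
        by (simp add: ev_mult'[OF u])
      then show ?thesis
        using xr by (simp add: t_def endo_scale[OF ev_endo[OF u]] ew endo_zero[OF w])
    qed
    moreover obtain k where "r = G ^ k"
      using xr by blast
    ultimately show ?thesis
      using ev_conj_G_power_eq_0[OF u w uw wu] by blast
  qed
  obtain P where P: "endo P" and Pu: "\<And>x. P (u x) = w (P x)"
    and Pz: "\<And>v r v' r'. ((v, r), (v', r')) \<in> set (zip (exponent_blocks qs) ps') \<Longrightarrow> P v = v'"
    using cyclic_decomp_intertwiner[OF u w dec snd_eq] ps' by blast
  have "((v, G ^ (n + e)), (v', G ^ (n + e))) \<in> set (zip (exponent_blocks qs) ps') \<and>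
      ((v', G ^ n), (t v, G ^ n)) \<in> set (zip (exponent_blocks qs) ps')"
    if "(v, v', n, e) \<in> set qs" for v v' n e
    using that unfolding ps'_def by (induction qs) auto
  then have Pv: "P v = v'" "P v' = t v" if "(v, v', n, e) \<in> set qs" for v v' n e
    using that Pz by blast+
  have Pw: "P (w x) = u (P x)" for x
    by (rule intertwiner_conj[OF u P \<kappa> uw Pu])
  have PevG: "P (ev u G x) = ev w G (P x)" for x
    by (simp add: ev_G_expand[OF u] ev_G_expand[OF w] endo_add[OF P] endo_scale[OF P] Pu)
  have PPt: "P (P x) = t x" if "(v, v', n, e) \<in> set qs" "x = v \<or> x = v'" for v v' n e x
    using that(2)
  proof
    assume "x = v"
    then show ?thesis
      by (simp add: Pv[OF that(1)])
  next
    \<comment> \<open>Passing \<open>P\<close> through \<open>t\<close> exchanges \<open>u\<close>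
      and \<open>w\<close>, and \<open>t\<close> is unchanged by this because \<open>G\<close> is
      self-reciprocal.\<close>
    assume x: "x = v'"
    have "P (P x) = P (t v)"
      by (simp add: Pv[OF that(1)] x)
    also have "\<dots> = scale (\<delta> ^ 3 / \<kappa>\<^sup>2) (u (u (ev w G v')))"
      by (simp add: t_def endo_scale[OF P] Pw PevG Pv(1)[OF that(1)])
    also have "\<dots> = t x"
      by (simp add: t_def x ev_conj_G[OF u w uw wu])
    finally show ?thesis .
  qed
  \<comment> \<open>Both sides commute with \<open>u\<close>, so it is enough to compare them at the
    generators.\<close>
  have evG: "ev u G x = scale (1 / \<delta> ^ 3) (u (u (P (P x))))" for x
  proof (rule endo_eq_on_basis[OF ev_endo[OF u]])
    show "endo (\<lambda>x. scale (1 / \<delta> ^ 3) (u (u (P (P x)))))"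
      by (auto intro!: endoI simp: endo_add[OF P] endo_scale[OF P] endo_add[OF u] endo_scale[OF u]
          scale_right_distrib ac_simps)
    show "ordered_basis scale (blocks u (exponent_blocks qs))"
      using dec by (simp add: cyclic_decomp_def)
    fix j assume "j < length (blocks u (exponent_blocks qs))"
    then have "blocks u (exponent_blocks qs) ! j \<in> set (blocks u (exponent_blocks qs))"
      by (rule nth_mem)
    then obtain x r i where x: "(x, r) \<in> set (exponent_blocks qs)"
      and j: "blocks u (exponent_blocks qs) ! j = (u ^^ i) x"
      unfolding set_blocks by blast
    obtain v v' n e where "(v, v', n, e) \<in> set qs" "x = v \<or> x = v'"
      using x unfolding exponent_blocks_def by fastforce
    then have PPx: "P (P x) = t x"
      by (rule PPt)
    have "(ev u G) ((u ^^ i) x) = (u ^^ i) (ev u G x)"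
      by (induction i) (simp_all add: ev_commute[OF u])
    moreover have "u (u (P (P ((u ^^ i) x)))) = (u ^^ i) (u (u (P (P x))))"
      by (induction i) (simp_all add: Pu Pw)
    moreover have "ev u G x = scale (1 / \<delta> ^ 3) (u (u (P (P x))))"
      using nz \<kappa> by (simp add: PPx t_def endo_scale[OF u] uw power2_eq_square)
    ultimately show "ev u G (blocks u (exponent_blocks qs) ! j) =
        scale (1 / \<delta> ^ 3) (u (u (P (P (blocks u (exponent_blocks qs) ! j)))))"
      by (simp add: j endo_scale[OF endo_funpow[OF u]])
  qed
  show ?thesis
    by (rule twisted_imp_quotient[OF u w P uw wu Pu evG nil])
qed

lemma quotient_imp_exponent_blocks:
  assumes u: "endo u" and pq: "pq_quotient scale p q u" and nil: "\<And>x. ev u (G ^ N) x = 0"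
  shows "\<exists>qs. (\<forall>(v, v', n, e)\<in>set qs. e \<le> 1) \<and> cyclic_decomp u (exponent_blocks qs)"
proof -
  obtain a b where ab: "automorphism scale a" "automorphism scale b"
    "annihilates scale p a" "annihilates scale q b" "u = a \<circ> inv_into UNIV b"
    using pq unfolding pq_quotient_def by blast
  have b: "bij b"
    using ab(2) by (simp add: automorphism_def)
  have "endo a" "endo b"
    using ab(1,2) by (simp_all add: automorphism_def endomorphism_def)
  moreover have "u (b x) = a x" for x
    using b by (simp add: ab(5) bij_is_inj)
  ultimately obtain w P where w: "endo w" and P: "endo P"
    and uw: "\<And>x. u (w x) = scale \<kappa> x" and wu: "\<And>x. w (u x) = scale \<kappa> x"
    and Pu: "\<And>x. P (u x) = w (P x)"
    and evG: "\<And>x. ev u G x = scale (1 / \<delta> ^ 3) (u (u (P (P x))))"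
    using quotient_imp_twisted[OF _ _ ab(3,4) u] by blast
  interpret T: twisted_pair scale u w P G \<kappa> "1 / \<delta> ^ 3" N
  proof (intro twisted_pair.intro twisted_pair_axioms.intro plain_vector_space_axioms)
    show "ev w (G ^ N) x = 0" for x
      by (rule ev_conj_G_power_eq_0[OF u w uw wu nil])
    show "1 / \<delta> ^ 3 \<noteq> 0"
      using nz by simp
    show "1 < degree G"
      by (simp add: degree_G)
  qed (fact u w P uw wu Pu evG nil fin \<kappa> G_irred monic_G)+
  obtain L where L: "cyclic_decomp u (T.pair_blocks L)"
    using T.cyclic_decomp_pair_blocks by blast
  \<comment> \<open>The two exponents are the halves of the length \<open>m\<close>, rounded down
    and up; they differ by the parity of \<open>m\<close>.\<close>
  define qs where "qs = map (\<lambda>(v, m). (v, P v, m div 2, (m + 1) div 2 - m div 2)) L"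
  have "exponent_blocks qs = T.pair_blocks L"
    unfolding exponent_blocks_def T.pair_blocks_def qs_def map_map
    by (rule arg_cong[of _ _ concat], rule map_cong) auto
  then show ?thesis
    using L by (intro exI[of _ qs]) (auto simp: qs_def)
qed

end

section \<open>Characteristic polynomials and eigenvalues\<close>

context plain_vector_space
begin

lemma ex_acts_by:
  assumes bs: "ordered_basis scale bs"
  shows "\<exists>M. acts_by u bs M"
proof -
  define M where "M = mat (length bs) (length bs) (\<lambda>(i, j). representation (set bs) (u (bs ! j)) (bs ! i))"
  have ind: "independent (set bs)" and sp: "span (set bs) = UNIV" and dist: "distinct bs"
    using bs by (simp_all add: ordered_basis_def)
  have "u (bs ! j) = (\<Sum>i<length bs. scale (M $$ (i, j)) (bs ! i))" if j: "j < length bs" for j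
  proof -
    let ?g = "\<lambda>b. scale (representation (set bs) (u (bs ! j)) b) b"
    have "(\<Sum>i<length bs. scale (M $$ (i, j)) (bs ! i)) = (\<Sum>i<length bs. ?g (bs ! i))"
      using j by (intro sum.cong) (simp_all add: M_def)
    also have "\<dots> = (\<Sum>b\<in>set bs. ?g b)"
      by (rule sum.reindex_bij_betw[OF bij_betw_nth[OF dist]]) auto
    also have "\<dots> = u (bs ! j)"
      by (rule sum_representation_eq[OF ind]) (simp_all add: sp)
    finally show ?thesis ..
  qed
  then show ?thesis
    by (intro exI[of _ M]) (simp add: acts_by_def M_def)
qed

text \<open>Cayley--Hamilton, by multiplying the relation \<open>(tI - M) b = 0\<close> between the basis vectors with the
  adjugate matrix.\<close>

lemma char_poly_annihilates:
  assumes u: "endo u" and bs: "ordered_basis scale bs" and M: "acts_by u bs M"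
  shows "ev u (char_poly M) x = 0"
proof -
  define n where "n = length bs"
  define C where "C = char_poly_matrix M"
  define D where "D = adj_mat C"
  have Mc: "M \<in> carrier_mat n n"
    using M by (simp add: acts_by_def n_def)
  then have Cc: "C \<in> carrier_mat n n"
    by (simp add: C_def)
  note adj = adj_mat[OF Cc, folded D_def]
  have C0: "(\<Sum>i<n. ev u (C $$ (i, j)) (bs ! i)) = 0" if j: "j < n" for j
  proof -
    have "ev u (C $$ (i, j)) (bs ! i) =
        (if i = j then u (bs ! i) else 0) - scale (M $$ (i, j)) (bs ! i)" if "i < n" for i
      using that j Mc by (simp add: C_def char_poly_matrix_def ev_pCons[OF u] endo_zero[OF u] endo_add[OF u])
    then have "(\<Sum>i<n. ev u (C $$ (i, j)) (bs ! i)) =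
        (\<Sum>i<n. (if i = j then u (bs ! i) else 0) - scale (M $$ (i, j)) (bs ! i))"
      by simp
    also have "\<dots> = u (bs ! j) - (\<Sum>i<n. scale (M $$ (i, j)) (bs ! i))"
      using j by (simp add: sum_subtractf)
    also have "\<dots> = 0"
      using M j by (simp add: acts_by_def n_def)
    finally show ?thesis .
  qed
  have "ev u (char_poly M) (bs ! k) = 0" if k: "k < n" for k
  proof -
    have CD: "(\<Sum>j<n. C $$ (i, j) * D $$ (j, k)) = (if i = k then char_poly M else 0)" if i: "i < n" for i
    proof -
      have "(\<Sum>j<n. C $$ (i, j) * D $$ (j, k)) = (C * D) $$ (i, k)"
        using i k Cc adj(1) by (simp add: scalar_prod_def lessThan_atLeast0)
      also have "\<dots> = (if i = k then det C else 0)"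
        using i k by (simp add: adj(2))
      finally show ?thesis
        by (simp only: char_poly_def C_def)
    qed
    have "0 = (\<Sum>j<n. ev u (D $$ (j, k)) (\<Sum>i<n. ev u (C $$ (i, j)) (bs ! i)))"
      by (simp add: C0 endo_zero[OF ev_endo[OF u]])
    also have "\<dots> = (\<Sum>j<n. \<Sum>i<n. ev u (C $$ (i, j) * D $$ (j, k)) (bs ! i))"
      by (simp add: endo_sum[OF ev_endo[OF u]] ev_mult'[OF u])
    also have "\<dots> = (\<Sum>i<n. \<Sum>j<n. ev u (C $$ (i, j) * D $$ (j, k)) (bs ! i))"
      by (rule sum.swap)
    also have "\<dots> = (\<Sum>i<n. if i = k then ev u (char_poly M) (bs ! i) else 0)"
      by (rule sum.cong) (auto simp: CD simp flip: ev_sum[OF u])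
    finally show ?thesis
      using k by simp
  qed
  moreover have "endo (\<lambda>x. 0)"
    by (rule endoI) simp_all
  ultimately show ?thesis
    using endo_eq_on_basis[OF ev_endo[OF u] _ bs, of "\<lambda>x. 0"] by (simp add: n_def)
qed

end

section \<open>Values of polynomials in the algebraic closure\<close>

lemma map_poly_to_ac_pCons: "map_poly to_ac (pCons a f) = pCons (to_ac a) (map_poly to_ac f)"
  by (rule poly_eqI) (simp add: coeff_map_poly coeff_pCons split: nat.split)

lemma poly_map_to_ac_add:
  "poly (map_poly to_ac (f + g)) z = poly (map_poly to_ac f) z + poly (map_poly to_ac g) z"
proof -
  have "map_poly to_ac (f + g) = map_poly to_ac f + map_poly to_ac g"
    by (rule poly_eqI) (simp add: coeff_map_poly)
  then show ?thesis
    by simp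
qed

lemma poly_map_to_ac_mult:
  "poly (map_poly to_ac (f * g)) z = poly (map_poly to_ac f) z * poly (map_poly to_ac g) z"
proof (induction f)
  case (pCons a f)
  have "map_poly to_ac (Polynomial.smult a g) = Polynomial.smult (to_ac a) (map_poly to_ac g)"
    by (rule poly_eqI) (simp add: coeff_map_poly)
  then show ?case
    using pCons by (simp add: poly_map_to_ac_add map_poly_to_ac_pCons algebra_simps)
qed simp

lemma poly_map_to_ac_power: "poly (map_poly to_ac (f ^ n)) z = poly (map_poly to_ac f) z ^ n"
  by (induction n) (simp_all add: poly_map_to_ac_mult)

lemma comm_ring_hom_to_ac: "comm_ring_hom to_ac"
  by unfold_locales simp_all

text \<open>By the Bezout identity a common root in the closure forces \<open>G dvd f\<close>;
  divide by \<open>G\<close> and repeat.\<close>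

lemma dvd_irreducible_power_if_roots:
  fixes f G :: "'a::field poly"
  assumes G: "irreducible G" and f: "f \<noteq> 0"
    and roots: "\<And>z. poly (map_poly to_ac f) z = 0 \<Longrightarrow> poly (map_poly to_ac G) z = 0"
  shows "\<exists>N. f dvd G ^ N"
  using f roots
proof (induction "degree f" arbitrary: f rule: less_induct)
  case less
  show ?case
  proof (cases "degree f = 0")
    case True
    then have "f dvd G ^ 0"
      using less.prems(1) by (simp add: poly_dvd_1)
    then show ?thesis ..
  next
    case False
    then have "0 < degree (map_poly to_ac f)"
      by (simp add: degree_map_poly)
    then obtain z where z: "poly (map_poly to_ac f) z = 0"
      using alg_closed_imp_poly_has_root by blast
    then have Gz: "poly (map_poly to_ac G) z = 0"
      by (rule less.prems(2))
    have "G dvd f"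
    proof (rule ccontr)
      assume "\<not> G dvd f"
      then obtain a b where "a * G + b * f = 1"
        using irreducible_bezout[OF G] by blast
      then have "poly (map_poly to_ac (a * G + b * f)) z = poly (map_poly to_ac (1 :: 'a poly)) z"
        by simp
      then show False
        by (simp add: poly_map_to_ac_add poly_map_to_ac_mult z Gz)
    qed
    then obtain h where h: "f = G * h" ..
    have "h \<noteq> 0"
      using h less.prems(1) by auto
    have "degree G \<noteq> 0"
      using G by (auto simp: irreducible_def is_unit_iff_degree)
    then have "degree h < degree f"
      using h less.prems(1) by (auto simp: degree_mult_eq)
    moreover have "poly (map_poly to_ac G) z = 0" if "poly (map_poly to_ac h) z = 0" for z
      using that by (intro less.prems(2)) (simp add: h poly_map_to_ac_mult)
    ultimately obtain N where "h dvd G ^ N"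
      using less.hyps \<open>h \<noteq> 0\<close> by blast
    then have "f dvd G ^ Suc N"
      unfolding h power_Suc by (rule mult_dvd_mono[OF dvd_refl])
    then show ?thesis ..
  qed
qed

context plain_vector_space
begin

text \<open>An eigenvector over the closure is not a vector of the space. A left eigenvector,
  however, is a functional \<phi> on the space with values in the closure and \<phi>(u v) = z
  \<phi>(v), so \<phi>(f(u) v) = f(z) \<phi>(v).\<close>

lemma eigenvalue_imp_root:
  assumes u: "endo u" and z: "z \<in> ac_eigenvalues scale u" and f: "\<And>x. ev u f x = 0"
  shows "poly (map_poly to_ac f) z = 0"
proof -
  obtain bs M where bs: "ordered_basis scale bs" and M: "acts_by u bs M"
    and ez: "eigenvalue (map_mat to_ac M) z"
    using z by (auto simp: ac_eigenvalues_def represented_by_iff)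
  define n where "n = length bs"
  have Mc: "M \<in> carrier_mat n n"
    using M by (simp add: acts_by_def n_def)
  then have Ac: "map_mat to_ac M \<in> carrier_mat n n" "transpose_mat (map_mat to_ac M) \<in> carrier_mat n n"
    by simp_all
  have "eigenvalue (transpose_mat (map_mat to_ac M)) z"
    using ez unfolding eigenvalue_root_char_poly[OF Ac(1)] eigenvalue_root_char_poly[OF Ac(2)]
      char_poly_transpose_mat[OF Ac(1)] .
  then obtain y where y: "y \<in> carrier_vec n" "y \<noteq> 0\<^sub>v n"
    and Ay: "transpose_mat (map_mat to_ac M) *\<^sub>v y = z \<cdot>\<^sub>v y"
    using Mc by (auto simp: eigenvalue_def eigenvector_def)
  have Ay': "(\<Sum>i<n. to_ac (M $$ (i, j)) * y $ i) = z * y $ j" if j: "j < n" for j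
  proof -
    have "(transpose_mat (map_mat to_ac M) *\<^sub>v y) $ j = (\<Sum>i<n. to_ac (M $$ (i, j)) * y $ i)"
      using j y(1) Mc by (simp add: scalar_prod_def lessThan_atLeast0)
    then show ?thesis
      using j y(1) by (simp add: Ay)
  qed
  have ind: "independent (set bs)" and sp: "span (set bs) = UNIV" and dist: "distinct bs"
    using bs by (simp_all add: ordered_basis_def)
  define \<phi> where "\<phi> v = (\<Sum>i<n. to_ac (representation (set bs) v (bs ! i)) * y $ i)" for v
  have \<phi>_add: "\<phi> (v + v') = \<phi> v + \<phi> v'" for v v'
    by (simp add: \<phi>_def representation_add[OF ind] sp algebra_simps sum.distrib)
  have \<phi>_scale: "\<phi> (scale c v) = to_ac c * \<phi> v" for c v
    by (simp add: \<phi>_def representation_scale[OF ind] sp algebra_simps sum_distrib_left)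
  have \<phi>_zero: "\<phi> 0 = 0"
    using \<phi>_scale[of 0 0] by simp
  have \<phi>_sum: "\<phi> (sum g A) = (\<Sum>i\<in>A. \<phi> (g i))" for g :: "nat \<Rightarrow> 'b" and A
    by (induction A rule: infinite_finite_induct) (simp_all add: \<phi>_add \<phi>_zero)
  have \<phi>_basis: "\<phi> (bs ! j) = y $ j" if j: "j < n" for j
  proof -
    have "\<phi> (bs ! j) = (\<Sum>i<n. if i = j then y $ i else 0)"
      unfolding \<phi>_def using j dist
      by (intro sum.cong) (auto simp: representation_basis[OF ind] n_def nth_eq_iff_index_eq)
    then show ?thesis
      using j by simp
  qed
  have \<phi>_ub: "\<phi> (u (bs ! j)) = z * \<phi> (bs ! j)" if j: "j < n" for j
  proof -
    have "u (bs ! j) = (\<Sum>i<n. scale (M $$ (i, j)) (bs ! i))"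
      using M j unfolding acts_by_def n_def by blast
    then have "\<phi> (u (bs ! j)) = (\<Sum>i<n. to_ac (M $$ (i, j)) * \<phi> (bs ! i))"
      by (simp add: \<phi>_sum \<phi>_scale)
    then show ?thesis
      using Ay'[OF j] by (simp add: \<phi>_basis j)
  qed
  have \<phi>_u: "\<phi> (u v) = z * \<phi> v" for v
  proof -
    have "v \<in> span (set bs)"
      by (simp add: sp)
    then show ?thesis
    proof (induction rule: span_induct_alt)
      case base
      then show ?case
        by (simp add: endo_zero[OF u] \<phi>_zero)
    next
      case (step c b v)
      then obtain j where "j < n" "b = bs ! j"
        unfolding n_def by (auto simp: in_set_conv_nth)
      with step show ?case
        by (simp add: endo_add[OF u] endo_scale[OF u] \<phi>_add \<phi>_scale \<phi>_ub algebra_simps)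
    qed
  qed
  have \<phi>_ev: "\<phi> (ev u f v) = poly (map_poly to_ac f) z * \<phi> v" for f v
    by (induction f) (simp_all add: \<phi>_zero ev_pCons[OF u] \<phi>_add \<phi>_scale \<phi>_u map_poly_to_ac_pCons algebra_simps)
  obtain j where "j < n" "y $ j \<noteq> 0"
    using y by (metis carrier_vecD eq_vecI index_zero_vec(1,2))
  moreover have "poly (map_poly to_ac f) z * \<phi> (bs ! j) = 0"
    using \<phi>_ev[of f "bs ! j"] by (simp add: f \<phi>_zero)
  ultimately show ?thesis
    by (simp add: \<phi>_basis)
qed

lemma nilpotent_if_eigenvalues_roots:
  assumes u: "endo u" and bs: "ordered_basis scale bs" and G: "irreducible G"
    and roots: "\<And>z. z \<in> ac_eigenvalues scale u \<Longrightarrow> poly (map_poly to_ac G) z = 0"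
  shows "\<exists>N. \<forall>x. ev u (G ^ N) x = 0"
proof -
  obtain M where M: "acts_by u bs M"
    using ex_acts_by[OF bs] by blast
  then have Mc: "M \<in> carrier_mat (length bs) (length bs)"
    by (simp add: acts_by_def)
  have "represented_by scale u M"
    using bs M by (auto simp: represented_by_iff)
  then have "poly (map_poly to_ac G) z = 0" if "poly (map_poly to_ac (char_poly M)) z = 0" for z
  proof (intro roots)
    have "eigenvalue (map_mat to_ac M) z"
      using that Mc by (subst eigenvalue_root_char_poly[of _ "length bs"])
        (simp_all add: comm_ring_hom.char_poly_hom[OF comm_ring_hom_to_ac Mc])
    with \<open>represented_by scale u M\<close> show "z \<in> ac_eigenvalues scale u"
      unfolding ac_eigenvalues_def by blast
  qed
  moreover have "char_poly M \<noteq> 0"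
    using degree_monic_char_poly[OF Mc] by auto
  ultimately obtain N where "char_poly M dvd G ^ N"
    using dvd_irreducible_power_if_roots[OF G] by blast
  then show ?thesis
    using ev_dvd[OF u _ char_poly_annihilates[OF u bs M]] by blast
qed

end

section \<open>A separable and an inseparable quadratic\<close>

lemma monic_quadratic_eq:
  assumes "lead_coeff p = 1" "degree p = 2"
  shows "p = [:Polynomial.coeff p 0, Polynomial.coeff p 1, 1:]"
proof (rule poly_eqI)
  fix n :: nat
  consider "n = 0" | "n = 1" | "n = 2" | "2 < n"
    by linarith
  then show "Polynomial.coeff p n = Polynomial.coeff [:Polynomial.coeff p 0, Polynomial.coeff p 1, 1:] n"
    using assms by cases (auto simp: coeff_eq_0 eval_nat_numeral)
qed

lemma irreducible_quadratic_no_root: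
  fixes p :: "'a::field poly"
  assumes p: "irreducible p" "degree p = 2"
  shows "poly p x \<noteq> 0"
proof
  assume "poly p x = 0"
  then obtain k where k: "p = [:- x, 1:] * k"
    by (auto simp: poly_eq_0_iff_dvd)
  then have "[:- x, 1:] dvd 1 \<or> k dvd 1"
    using p(1) unfolding irreducible_def by blast
  then have "k \<noteq> 0 \<and> degree k = 0"
    by (auto simp: poly_dvd_1)
  then have "degree p = 1"
    unfolding k by (subst degree_mult_eq) auto
  then show False
    using p(2) by simp
qed

lemma poly_map_to_ac_of_base: "poly (map_poly to_ac f) (to_ac x) = to_ac (poly f x)"
  by (induction f) (simp_all add: map_poly_to_ac_pCons)

lemma monic_quadratic_splits:
  fixes p :: "'a::field poly"
  assumes p: "lead_coeff p = 1" "degree p = 2"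
  obtains x1 x2 where "map_poly to_ac p = [:- x1, 1:] * [:- x2, 1:]"
proof -
  define a b where "a = Polynomial.coeff p 1" and "b = Polynomial.coeff p 0"
  have mp: "map_poly to_ac p = [:to_ac b, to_ac a, 1:]"
    by (subst monic_quadratic_eq[OF p]) (simp add: map_poly_to_ac_pCons a_def b_def)
  then have "0 < degree (map_poly to_ac p)"
    by simp
  then obtain x1 where "poly (map_poly to_ac p) x1 = 0"
    using alg_closed_imp_poly_has_root by blast
  then have "to_ac b = - (x1 * (to_ac a + x1))"
    by (simp add: mp eq_neg_iff_add_eq_0)
  then have "map_poly to_ac p = [:- x1, 1:] * [:- (- to_ac a - x1), 1:]"
    by (simp add: mp algebra_simps)
  then show ?thesis
    by (rule that)
qed

lemma separable_poly_iff_distinct_roots: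
  assumes "map_poly to_ac p = [:- x1, 1:] * [:- x2, 1:]"
  shows "separable_poly p \<longleftrightarrow> x1 \<noteq> x2"
proof -
  have nz: "[:- x1, 1:] * [:- x2, 1:] \<noteq> 0"
    by simp
  have "order a ([:- x1, 1:] * [:- x2, 1:]) = count {#x1, x2#} a" for a
    by (simp only: proots_two_linear[symmetric] count_proots[OF nz])
  then show ?thesis
    unfolding separable_poly_def assms rsquarefree_def using nz by auto
qed

text \<open>In characteristic two the product is the square of (t + a)(t + b), and squaring is
  additive.\<close>

lemma char2_quartic:
  fixes a b :: "'c::comm_ring_1"
  assumes "(1::'c) + 1 = 0"
  shows "[:- a, 1:] * [:- a, 1:] * [:- b, 1:] * [:- b, 1:] = [:(a * b)\<^sup>2, 0, (a + b)\<^sup>2, 0, 1:]"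
proof -
  have dbl: "x + x = 0" for x :: 'c
    using distrib_right[of 1 1 x] by (simp only: assms mult_zero_left mult_1_left)
  have dbl_left: "x + (x + z) = z" for x z :: 'c
    by (simp only: add.assoc[symmetric] dbl add_0_left)
  have neg: "- x = x" for x :: 'c
    by (rule minus_unique[OF dbl])
  show ?thesis
    by (simp add: neg power2_eq_square distrib_left distrib_right ac_simps dbl dbl_left)
qed

locale quadratic_pair =
  fixes p q :: "'a::field poly"
  assumes p: "irreducible p" "lead_coeff p = 1" "degree p = 2"
    and q: "irreducible q" "lead_coeff q = 1" "degree q = 2"
    and sep_p: "separable_poly p"
    and insep_q: "\<not> separable_poly q"
begin

definition \<alpha> :: 'a where "\<alpha> = Polynomial.coeff p 0"
definition \<tau> :: 'a where "\<tau> = Polynomial.coeff p 1"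
definition \<delta> :: 'a where "\<delta> = Polynomial.coeff q 0"

lemma p_eq: "p = [:\<alpha>, \<tau>, 1:]"
  unfolding \<alpha>_def \<tau>_def by (rule monic_quadratic_eq[OF p(2,3)])

lemma p_no_root: "poly p x \<noteq> 0" and q_no_root: "poly q x \<noteq> 0"
  using irreducible_quadratic_no_root p q by blast+

lemma ex_roots:
  "\<exists>x1 x2 y. map_poly to_ac p = [:- x1, 1:] * [:- x2, 1:] \<and> x1 \<noteq> x2 \<and>
     map_poly to_ac q = [:- y, 1:] * [:- y, 1:]"
proof -
  obtain x1 x2 where x: "map_poly to_ac p = [:- x1, 1:] * [:- x2, 1:]"
    by (rule monic_quadratic_splits[OF p(2,3)])
  obtain y1 y2 where y: "map_poly to_ac q = [:- y1, 1:] * [:- y2, 1:]"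
    by (rule monic_quadratic_splits[OF q(2,3)])
  have "x1 \<noteq> x2" "y1 = y2"
    using separable_poly_iff_distinct_roots[OF x] separable_poly_iff_distinct_roots[OF y] sep_p insep_q
    by simp_all
  with x y show ?thesis
    by blast
qed

text \<open>\<open>x1\<close>, \<open>x2\<close> and \<open>y\<close> are nested choices, each made
  with the earlier ones fixed, so that the roots satisfy one joint statement.\<close>

definition x1 :: "'a alg_closure" where
  "x1 = (SOME x1. \<exists>x2 y. map_poly to_ac p = [:- x1, 1:] * [:- x2, 1:] \<and> x1 \<noteq> x2 \<and>
     map_poly to_ac q = [:- y, 1:] * [:- y, 1:])"

definition x2 :: "'a alg_closure" where
  "x2 = (SOME x2. \<exists>y. map_poly to_ac p = [:- x1, 1:] * [:- x2, 1:] \<and> x1 \<noteq> x2 \<and>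
     map_poly to_ac q = [:- y, 1:] * [:- y, 1:])"

definition y :: "'a alg_closure" where
  "y = (SOME y. map_poly to_ac p = [:- x1, 1:] * [:- x2, 1:] \<and> x1 \<noteq> x2 \<and>
     map_poly to_ac q = [:- y, 1:] * [:- y, 1:])"

lemma roots: "map_poly to_ac p = [:- x1, 1:] * [:- x2, 1:]" "x1 \<noteq> x2"
  "map_poly to_ac q = [:- y, 1:] * [:- y, 1:]"
proof -
  have "\<exists>x2 y. map_poly to_ac p = [:- x1, 1:] * [:- x2, 1:] \<and> x1 \<noteq> x2 \<and>
     map_poly to_ac q = [:- y, 1:] * [:- y, 1:]"
    unfolding x1_def by (rule someI_ex[OF ex_roots])
  from someI_ex[OF this] have "\<exists>y. map_poly to_ac p = [:- x1, 1:] * [:- x2, 1:] \<and> x1 \<noteq> x2 \<and>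
     map_poly to_ac q = [:- y, 1:] * [:- y, 1:]"
    unfolding x2_def .
  from someI_ex[OF this] show "map_poly to_ac p = [:- x1, 1:] * [:- x2, 1:]" "x1 \<noteq> x2"
    "map_poly to_ac q = [:- y, 1:] * [:- y, 1:]"
    unfolding y_def by blast+
qed

text \<open>The double root \<open>y\<close> satisfies 2y = -b for the linear coefficient
  \<open>b\<close> of \<open>q\<close>. If 2 were invertible, \<open>y\<close> would lie in the base
  field and be a root of the irreducible \<open>q\<close>. So 2 = 0, and then b = 0.\<close>

lemma char2: "(1::'a) + 1 = 0" and q_eq: "q = [:\<delta>, 0, 1:]"
proof -
  define b where "b = Polynomial.coeff q 1"
  have qb: "q = [:\<delta>, b, 1:]"
    unfolding \<delta>_def b_def by (rule monic_quadratic_eq[OF q(2,3)])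
  have mq: "[:to_ac \<delta>, to_ac b, 1:] = [:- y, 1:] * [:- y, 1:]"
    using roots(3) arg_cong[OF qb, of "map_poly to_ac"] by (simp only: map_poly_to_ac_pCons to_ac_1 map_poly_0)
  then have b: "to_ac b = - (y + y)"
    by simp
  show two: "(1::'a) + 1 = 0"
  proof (rule ccontr)
    assume ne: "(1::'a) + 1 \<noteq> 0"
    then have "to_ac ((1::'a) + 1) \<noteq> 0"
      by (simp only: to_ac_eq_0_iff not_False_eq_True)
    then have ne': "(1::'a alg_closure) + 1 \<noteq> 0"
      by (simp only: to_ac_add to_ac_1 not_False_eq_True)
    have "y * (1 + 1) = - to_ac b"
      by (simp only: b distrib_left mult_1_right minus_minus)
    then have "y = - to_ac b / (1 + 1)"
      by (rule nonzero_eq_divide_eq[OF ne', THEN iffD2])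
    also have "\<dots> = to_ac (- b / (1 + 1))"
      by (simp only: to_ac_divide to_ac_minus to_ac_add to_ac_1)
    finally have yb: "y = to_ac (- b / (1 + 1))" .
    have "poly (map_poly to_ac q) y = 0"
      by (simp add: roots(3))
    then have "to_ac (poly q (- b / (1 + 1))) = 0"
      by (simp only: yb poly_map_to_ac_of_base)
    then show False
      using q_no_root by (simp only: to_ac_eq_0_iff)
  qed
  have "to_ac b = - (y * to_ac (1 + 1))"
    by (simp add: b distrib_left)
  then have "b = 0"
    by (simp only: two to_ac_0 mult_zero_right minus_zero to_ac_eq_0_iff)
  with qb show "q = [:\<delta>, 0, 1:]"
    by simp
qed

lemma ac_char2: "(1::'a alg_closure) + 1 = 0"
  using arg_cong[OF char2, of to_ac] by simp

lemma ac_add_self: "z + z = (0::'a alg_closure)"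
  using distrib_left[of z 1 1] by (simp only: ac_char2 mult_zero_right mult_1_right)

lemma ac_neg: "- z = (z::'a alg_closure)"
  by (rule minus_unique[OF ac_add_self])

lemma ac_eq_iff: "a + b = 0 \<longleftrightarrow> a = (b::'a alg_closure)"
  by (simp only: eq_neg_iff_add_eq_0[symmetric] ac_neg)

lemma poly_q: "poly q x = \<delta> + x\<^sup>2"
  using arg_cong[OF q_eq, of "\<lambda>f. poly f x"] by (simp add: power2_eq_square)

lemma nonzero: "\<alpha> \<noteq> 0" "\<delta> \<noteq> 0"
  using p_no_root[of 0] q_no_root[of 0] by (simp_all add: \<alpha>_def \<delta>_def poly_0_coeff_0)

lemma y_square: "y\<^sup>2 = to_ac \<delta>"
proof -
  have "[:to_ac \<delta>, 0, 1:] = [:- y, 1:] * [:- y, 1:]"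
    using roots(3) arg_cong[OF q_eq, of "map_poly to_ac"]
    by (simp only: map_poly_to_ac_pCons to_ac_0 to_ac_1 map_poly_0)
  then show ?thesis
    by (simp add: power2_eq_square)
qed

lemma y_nonzero: "y \<noteq> 0"
  using y_square nonzero(2) by auto

lemma x_sum: "x1 + x2 = to_ac \<tau>" and x_prod: "x1 * x2 = to_ac \<alpha>"
proof -
  have "[:to_ac \<alpha>, to_ac \<tau>, 1:] = [:- x1, 1:] * [:- x2, 1:]"
    using roots(1) arg_cong[OF p_eq, of "map_poly to_ac"]
    by (simp only: map_poly_to_ac_pCons to_ac_1 map_poly_0)
  then have "to_ac \<alpha> = x1 * x2" "to_ac \<tau> = - x2 - x1"
    by simp_all
  then show "x1 + x2 = to_ac \<tau>" "x1 * x2 = to_ac \<alpha>"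
    by (simp_all only: diff_conv_add_uminus ac_neg add.commute)
qed

lemma \<tau>_nonzero: "\<tau> \<noteq> 0"
proof
  assume "\<tau> = 0"
  then have "x1 + x2 = 0"
    by (simp add: x_sum)
  then show False
    using roots(2) by (simp add: ac_eq_iff)
qed

lemma x1_square: "x1\<^sup>2 = to_ac \<tau> * x1 + to_ac \<alpha>"
proof -
  have "to_ac \<tau> * x1 + to_ac \<alpha> = x1\<^sup>2 + (x1 * x2 + x1 * x2)"
    by (simp add: power2_eq_square algebra_simps flip: x_sum x_prod)
  then show ?thesis
    by (simp only: ac_add_self add_0_right)
qed

lemma map_G: "map_poly to_ac (G_poly p q) =
  [:- (x1 * inverse y), 1:] * [:- (x1 * inverse y), 1:] * [:- (x2 * inverse y), 1:] * [:- (x2 * inverse y), 1:]"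
  using map_poly_G_poly[OF roots(1,3)] q_no_root by blast

lemma G_eq: "G_poly p q = [:(\<alpha> / \<delta>)\<^sup>2, 0, \<tau>\<^sup>2 / \<delta>, 0, 1:]"
proof (rule map_poly_to_ac_inj)
  have "x1 * inverse y * (x2 * inverse y) = to_ac (\<alpha> / \<delta>)"
    using y_nonzero by (simp add: field_simps power2_eq_square flip: x_prod y_square)
  moreover have "(x1 * inverse y + x2 * inverse y)\<^sup>2 = to_ac (\<tau>\<^sup>2 / \<delta>)"
    by (simp add: power_mult_distrib power_inverse divide_inverse x_sum y_square flip: distrib_right)
  ultimately show "map_poly to_ac (G_poly p q) = map_poly to_ac [:(\<alpha> / \<delta>)\<^sup>2, 0, \<tau>\<^sup>2 / \<delta>, 0, 1:]"
    unfolding map_G char2_quartic[OF ac_char2] by (simp add: map_poly_to_ac_pCons)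
qed

lemma root_G_iff: "poly (map_poly to_ac (G_poly p q)) z = 0 \<longleftrightarrow>
  z \<in> {x * inverse y | x y. x \<in> ac_roots p \<and> y \<in> ac_roots q}"
proof -
  have "ac_roots p = {x1, x2}" "ac_roots q = {y}"
    by (auto simp: ac_roots_def roots simp del: mult_pCons_left mult_pCons_right)
  moreover have "poly (map_poly to_ac (G_poly p q)) z = 0 \<longleftrightarrow> z = x1 * inverse y \<or> z = x2 * inverse y"
    unfolding map_G by (simp add: eq_neg_iff_add_eq_0 del: mult_pCons_left mult_pCons_right)
  ultimately show ?thesis
    by auto
qed

text \<open>1 and \<open>x1\<close> are independent over the base field, because \<open>p\<close>
  has no root there.\<close>

lemma linear_x1_eq_0: "to_ac a + to_ac b * x1 = 0 \<Longrightarrow> a = 0 \<and> b = 0"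
proof -
  assume *: "to_ac a + to_ac b * x1 = 0"
  have "b = 0"
  proof (rule ccontr)
    assume "b \<noteq> 0"
    then have "x1 = to_ac (- a / b)"
      using * by (simp add: field_simps eq_neg_iff_add_eq_0)
    moreover have "poly (map_poly to_ac p) x1 = 0"
      by (simp add: roots(1))
    ultimately have "to_ac (poly p (- a / b)) = 0"
      by (simp only: poly_map_to_ac_of_base)
    then show False
      using p_no_root by (simp only: to_ac_eq_0_iff)
  qed
  then show "a = 0 \<and> b = 0"
    using * by simp
qed

text \<open>\<delta> is not a square in the base field: in characteristic two a square root would be
  a root of \<open>q\<close>.\<close>

lemma square_eq_\<delta>_square: "a\<^sup>2 = \<delta> * b\<^sup>2 \<Longrightarrow> a = 0 \<and> b = 0"
proof -
  assume *: "a\<^sup>2 = \<delta> * b\<^sup>2"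
  have "b = 0"
  proof (rule ccontr)
    assume "b \<noteq> 0"
    then have "(a / b)\<^sup>2 = \<delta>"
      using * by (simp add: power_divide)
    then have "poly q (a / b) = \<delta> * (1 + 1)"
      by (simp add: poly_q distrib_left)
    then show False
      using q_no_root by (simp only: char2 mult_zero_right)
  qed
  then show "a = 0 \<and> b = 0"
    using * by simp
qed

text \<open>Squaring \<open>A + y B = 0\<close> with \<open>A, B\<close> in the separable extension \<open>F(x1)\<close> gives
  \<open>A\<^sup>2 = \<delta> B\<^sup>2\<close>, which descends to \<open>F\<close> coefficientwise.\<close>

lemma linear_x1_y_eq_0:
  assumes "to_ac a0 + to_ac a1 * x1 + y * (to_ac b0 + to_ac b1 * x1) = 0"
  shows "a0 = 0 \<and> a1 = 0 \<and> b0 = 0 \<and> b1 = 0"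
proof -
  have sq: "(to_ac c0 + to_ac c1 * x1)\<^sup>2 = to_ac (c0\<^sup>2 + c1\<^sup>2 * \<alpha>) + to_ac (c1\<^sup>2 * \<tau>) * x1" for c0 c1
  proof -
    have "(to_ac c0 + to_ac c1 * x1)\<^sup>2 =
        to_ac c0 ^ 2 + to_ac c1 ^ 2 * x1\<^sup>2 + (to_ac c0 * to_ac c1 * x1 + to_ac c0 * to_ac c1 * x1)"
      by (simp add: power2_eq_square algebra_simps)
    also have "\<dots> = to_ac c0 ^ 2 + to_ac c1 ^ 2 * x1\<^sup>2"
      by (simp only: ac_add_self add_0_right)
    finally show ?thesis
      by (simp add: x1_square algebra_simps)
  qed
  have "to_ac a0 + to_ac a1 * x1 = y * (to_ac b0 + to_ac b1 * x1)"
    using assms by (simp only: ac_eq_iff)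
  then have "(to_ac a0 + to_ac a1 * x1)\<^sup>2 = to_ac \<delta> * (to_ac b0 + to_ac b1 * x1)\<^sup>2"
    by (simp add: power_mult_distrib y_square)
  then have "to_ac (a0\<^sup>2 + a1\<^sup>2 * \<alpha> - \<delta> * (b0\<^sup>2 + b1\<^sup>2 * \<alpha>)) + to_ac (a1\<^sup>2 * \<tau> - \<delta> * (b1\<^sup>2 * \<tau>)) * x1 = 0"
    unfolding sq by (simp add: algebra_simps)
  then have 1: "a0\<^sup>2 + a1\<^sup>2 * \<alpha> - \<delta> * (b0\<^sup>2 + b1\<^sup>2 * \<alpha>) = 0" "a1\<^sup>2 * \<tau> - \<delta> * (b1\<^sup>2 * \<tau>) = 0"
    using linear_x1_eq_0 by blast+
  then have "(a1\<^sup>2 - \<delta> * b1\<^sup>2) * \<tau> = 0"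
    by (simp add: algebra_simps)
  then have "a1\<^sup>2 = \<delta> * b1\<^sup>2"
    using \<tau>_nonzero by simp
  then have a1: "a1 = 0 \<and> b1 = 0"
    by (rule square_eq_\<delta>_square)
  then have "a0\<^sup>2 = \<delta> * b0\<^sup>2"
    using 1(1) by simp
  then have "a0 = 0 \<and> b0 = 0"
    by (rule square_eq_\<delta>_square)
  with a1 show ?thesis
    by simp
qed

text \<open>The even powers of x1/y lie in F(x1) and the odd ones in y F(x1). Expanded in the
  independent elements 1, x1, y, y x1, a polynomial of degree at most three vanishes at x1/y only if
  all its coefficients do.\<close>

lemma degree_ge_4_if_root:
  assumes f: "poly (map_poly to_ac f) (x1 * inverse y) = 0" "f \<noteq> 0"
  shows "4 \<le> degree f"
proof (rule ccontr)
  assume "\<not> 4 \<le> degree f"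
  then have deg: "degree f < 4"
    by simp
  define c where "c = Polynomial.coeff f"
  have "f = [:c 0, c 1, c 2, c 3:]"
  proof (rule poly_eqI)
    fix n :: nat
    consider "n = 0" | "n = 1" | "n = 2" | "n = 3" | "3 < n"
      by linarith
    then show "Polynomial.coeff f n = Polynomial.coeff [:c 0, c 1, c 2, c 3:] n"
      using deg by cases (auto simp: coeff_eq_0 eval_nat_numeral c_def)
  qed
  then have mf: "map_poly to_ac f = [:to_ac (c 0), to_ac (c 1), to_ac (c 2), to_ac (c 3):]"
    by (simp add: map_poly_to_ac_pCons)
  define d where "d = to_ac \<delta>"
  define z where "z = x1 * inverse y"
  have d: "d \<noteq> 0"
    using nonzero by (simp add: d_def)
  have dy: "d = y * y"
    using y_square by (simp add: d_def power2_eq_square)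
  have iy: "inverse y = y / d"
    using y_nonzero by (simp add: dy inverse_eq_divide)
  have z1: "z = y * (x1 / d)"
    by (simp add: z_def iy)
  have xx: "x1 * x1 = to_ac \<tau> * x1 + to_ac \<alpha>"
    using x1_square by (simp add: power2_eq_square)
  have "z * z = (y * y) * (x1 * x1) / (d * d)"
    by (simp add: z1)
  then have z2: "z * z = (to_ac \<tau> * x1 + to_ac \<alpha>) / d"
    using d by (simp add: xx flip: dy)
  have "z * (z * z) = y * ((to_ac \<tau> * (x1 * x1) + to_ac \<alpha> * x1) / (d * d))"
    using d unfolding z2 unfolding z1 by (simp add: field_simps)
  then have z3: "z * (z * z) = y * (((to_ac \<tau> * to_ac \<tau> + to_ac \<alpha>) * x1 + to_ac \<tau> * to_ac \<alpha>) / (d * d))"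
    by (simp add: xx algebra_simps)
  have "0 = to_ac (c 0) + to_ac (c 1) * z + to_ac (c 2) * (z * z) + to_ac (c 3) * (z * (z * z))"
    using f(1) unfolding mf z_def[symmetric] by (simp add: algebra_simps)
  also have "\<dots> = to_ac (c 0 + c 2 * \<alpha> / \<delta>) + to_ac (c 2 * \<tau> / \<delta>) * x1 +
      y * (to_ac (c 3 * \<tau> * \<alpha> / (\<delta> * \<delta>)) + to_ac (c 1 / \<delta> + c 3 * (\<tau> * \<tau> + \<alpha>) / (\<delta> * \<delta>)) * x1)"
    unfolding z3 unfolding z2 unfolding z1 by (simp add: d_def algebra_simps add_divide_distrib)
  finally have "c 0 + c 2 * \<alpha> / \<delta> = 0 \<and> c 2 * \<tau> / \<delta> = 0 \<and> c 3 * \<tau> * \<alpha> / (\<delta> * \<delta>) = 0 \<and>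
      c 1 / \<delta> + c 3 * (\<tau> * \<tau> + \<alpha>) / (\<delta> * \<delta>) = 0"
    by (intro linear_x1_y_eq_0) simp
  \<comment> \<open>The coefficient of \<open>x1\<close> gives \<open>c 2 = 0\<close> and that of
    \<open>y\<close> gives \<open>c 3 = 0\<close>, as \<tau> and \<alpha> are nonzero; the other two
    follow.\<close>
  then have "c 0 = 0" "c 1 = 0" "c 2 = 0" "c 3 = 0"
    using nonzero \<tau>_nonzero by auto
  then have "f = 0"
    using \<open>f = [:c 0, c 1, c 2, c 3:]\<close> by simp
  then show False
    using f(2) by simp
qed

text \<open>In a factorisation one factor has the root x1/y, hence degree at least four, which
  leaves degree zero for the other.\<close>

lemma irreducible_G: "irreducible (G_poly p q)"
proof -
  have deg: "degree (G_poly p q) = 4"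
    by (simp add: G_eq)
  have unit: "g dvd 1" if fg: "G_poly p q = f * g" and f: "poly (map_poly to_ac f) (x1 * inverse y) = 0" for f g
  proof -
    have "f \<noteq> 0" "g \<noteq> 0"
      using fg deg by auto
    then have "degree f + degree g = 4"
      using deg fg by (simp add: degree_mult_eq)
    moreover have "4 \<le> degree f"
      using degree_ge_4_if_root[OF f \<open>f \<noteq> 0\<close>] .
    ultimately show ?thesis
      using \<open>g \<noteq> 0\<close> by (simp add: poly_dvd_1)
  qed
  show ?thesis
    unfolding irreducible_def
  proof (intro conjI allI impI)
    show "G_poly p q \<noteq> 0" "\<not> G_poly p q dvd 1"
      using deg by (auto simp: poly_dvd_1)
    fix f g assume fg: "G_poly p q = f * g"
    have "poly (map_poly to_ac (G_poly p q)) (x1 * inverse y) = 0"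
      by (simp add: map_G poly_mult del: mult_pCons_left mult_pCons_right)
    then have "poly (map_poly to_ac f) (x1 * inverse y) = 0 \<or> poly (map_poly to_ac g) (x1 * inverse y) = 0"
      by (simp add: fg poly_map_to_ac_mult)
    then show "f dvd 1 \<or> g dvd 1"
      using unit[of f g] unit[of g f] fg by (metis mult.commute)
  qed
qed

end

section \<open>Invariant factors\<close>

text \<open>A threshold separates \<open>n\<close> from \<open>n + e\<close> only if it equals
  \<open>n + e\<close>, because \<open>e \<le> 1\<close>; otherwise a pair counts twice or not at
  all.\<close>

lemma even_length_filter_pairs:
  fixes bl :: "(nat \<times> nat) list"
  assumes "\<forall>(n, e)\<in>set bl. e \<le> 1" "c \<notin> set (concat (map (\<lambda>(n, e). [n + e, n]) bl))"
  shows "even (length (filter (\<lambda>x. c \<le> x) (concat (map (\<lambda>(n, e). [n + e, n]) bl))))"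
  using assms
proof (induction bl)
  case (Cons a bl)
  obtain n e where a: "a = (n, e)"
    by (cases a)
  have "e \<le> 1" "c \<noteq> n + e"
    using Cons.prems by (auto simp: a)
  then have "c \<le> n + e \<longleftrightarrow> c \<le> n"
    by linarith
  moreover have "even (length (filter (\<lambda>x. c \<le> x) (concat (map (\<lambda>(n, e). [n + e, n]) bl))))"
    using Cons by simp
  ultimately show ?case
    by (simp add: a)
qed simp

text \<open>If the sorted exponents dropped by at least two from position \<open>2k - 1\<close> to position \<open>2k\<close>, an odd
  number of them would exceed an intermediate value that is not attained; but each block
  contributes evenly to that number.\<close>

lemma sorted_pairs_drop_le_1:
  fixes bl :: "(nat \<times> nat) list" and x :: "nat \<Rightarrow> nat"
  assumes bl: "\<forall>(n, e)\<in>set bl. e \<le> 1"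
    and es: "mset es = mset (concat (map (\<lambda>(n, e). [n + e, n]) bl))" "sorted (rev es)"
    and x: "\<And>i. x i = (if i < length es then es ! i else 0)"
  shows "x (2 * k) \<le> x (Suc (2 * k)) + 1"
proof (rule ccontr)
  assume drop: "\<not> ?thesis"
  \<comment> \<open>Positions count from 0 here, so \<open>2 * k\<close> and
    \<open>Suc (2 * k)\<close> form a pair. \<open>c\<close> lies strictly between neighbours of a
    sorted list, hence is attained nowhere.\<close>
  define c where "c = x (Suc (2 * k)) + 1"
  have c: "c < x (2 * k)" "x (Suc (2 * k)) < c"
    using drop by (simp_all add: c_def)
  have mono: "x j \<le> x i" if "i \<le> j" for i j
    using that sorted_rev_nth_mono[OF es(2), of i j] by (simp add: x)
  have ge: "c < x i" if "i \<le> 2 * k" for i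
    using mono[OF that] c(1) by simp
  have lt: "x i < c" if "2 * k < i" for i
    using mono[of "Suc (2 * k)" i] that c(2) by simp
  have "{i. i < length es \<and> c \<le> es ! i} = {..2 * k}"
  proof (rule Set.set_eqI)
    fix i
    have "c \<le> x i \<longleftrightarrow> i \<le> 2 * k"
      using ge[of i] lt[of i] by (cases "i \<le> 2 * k") simp_all
    moreover have "i < length es \<and> c \<le> es ! i \<longleftrightarrow> c \<le> x i"
    proof (cases "i < length es")
      case True
      then have "x i = es ! i"
        by (simp add: x)
      with True show ?thesis
        by simp
    next
      case False
      then have "x i < c"
        by (simp add: x[of i] c_def)
      with False show ?thesis
        by simp
    qed
    ultimately show "i \<in> {i. i < length es \<and> c \<le> es ! i} \<longleftrightarrow> i \<in> {..2 * k}"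
      by simp
  qed
  then have "length (filter (\<lambda>a. c \<le> a) es) = Suc (2 * k)"
    by (simp add: length_filter_conv_card)
  moreover have "length (filter (\<lambda>a. c \<le> a) es) =
      length (filter (\<lambda>a. c \<le> a) (concat (map (\<lambda>(n, e). [n + e, n]) bl)))"
    by (metis es(1) mset_filter size_mset)
  moreover have "c \<notin> set es"
  proof
    assume "c \<in> set es"
    then obtain i where "i < length es" "es ! i = c"
      by (meson in_set_conv_nth)
    then have "x i = c"
      by (simp add: x)
    then show False
      using ge[of i] lt[of i] by (cases "i \<le> 2 * k") auto
  qed
  then have "c \<notin> set (concat (map (\<lambda>(n, e). [n + e, n]) bl))"
    using mset_eq_setD[OF es(1)] by simp
  ultimately show False
    using even_length_filter_pairs[OF bl] by fastforce
qed

context plain_vector_space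
begin

lemma min_poly_invariant_factors:
  assumes u: "endo u" and ps: "cyclic_decomp u ps" and m: "map snd ps = map r [1..<Suc m]"
    and r: "\<And>i. 1 \<le> i \<Longrightarrow> lead_coeff (r i) = 1" "\<And>i. 1 \<le> i \<Longrightarrow> r (Suc i) dvd r i"
      "\<And>i. m < i \<Longrightarrow> r i = 1"
  shows "min_poly scale u = r 1"
proof (rule min_poly_cyclic_decomp[OF u ps])
  have dvd: "r (Suc i) dvd r 1" for i
  proof (induction i)
    case (Suc i)
    then show ?case
      using r(2)[of "Suc i"] dvd_trans by simp
  qed simp
  have set: "snd ` set ps = r ` {1..<Suc m}"
    by (metis m set_map set_upt)
  show "lead_coeff (r 1) = 1"
    by (simp add: r(1))
  show "\<forall>s\<in>snd ` set ps. s dvd r 1"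
    unfolding set
  proof
    fix s assume "s \<in> r ` {1..<Suc m}"
    then obtain i where "1 \<le> i" "s = r i"
      by auto
    then show "s dvd r 1"
      using dvd[of "i - 1"] by simp
  qed
  fix f assume f: "\<forall>s\<in>snd ` set ps. s dvd f"
  show "r 1 dvd f"
  proof (cases "m = 0")
    case True
    then show ?thesis
      using r(3)[of 1] by simp
  next
    case False
    then have "r 1 \<in> snd ` set ps"
      unfolding set by simp
    then show ?thesis
      using f by blast
  qed
qed

lemma invariant_factors_iff:
  "invariant_factors scale u r \<longleftrightarrow> (\<forall>i\<ge>1. lead_coeff (r i) = 1 \<and> r (Suc i) dvd r i) \<and>
    (\<exists>m ps. (\<forall>i>m. r i = 1) \<and> map snd ps = map r [1..<Suc m] \<and> cyclic_decomp u ps)"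
proof -
  have "represented_by scale u (diag_block_mat (map (\<lambda>i. companion (r i)) [1..<Suc m])) \<longleftrightarrow>
      (\<exists>ps. map snd ps = map r [1..<Suc m] \<and> cyclic_decomp u ps)"
    if "\<forall>i\<ge>1. lead_coeff (r i) = 1" for m
  proof -
    have "map (\<lambda>i. companion (r i)) [1..<Suc m] = map companion (map r [1..<Suc m])"
      by (simp only: map_map o_def)
    moreover have "\<forall>s\<in>set (map r [1..<Suc m]). lead_coeff s = 1"
      using that by (simp del: upt_Suc)
    ultimately show ?thesis
      using represented_by_companions_iff[of "map r [1..<Suc m]" u] by (simp only: companions_def)
  qed
  then show ?thesis
    unfolding invariant_factors_def by blast
qed

text \<open>Padding by trivial summands allows an odd number of invariant factors to be grouped into
  pairs.\<close>

lemma cyclic_decomp_append_trivial: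
  assumes "cyclic_decomp u ps"
  shows "cyclic_decomp u (ps @ replicate k (0, 1))"
proof -
  have "blocks u (replicate k (0, 1)) = []"
    by (induction k) (simp_all add: chain_def)
  then show ?thesis
    using assms by (auto simp: cyclic_decomp_def)
qed

end

context char2_quadratics
begin

lemma map_snd_eq_imp_exponent_blocks:
  assumes "map snd ps = concat (map (\<lambda>(n, e). [G ^ (n + e), G ^ n]) bl)"
  shows "\<exists>qs. ps = exponent_blocks qs \<and> map (snd \<circ> snd) qs = bl"
  using assms
proof (induction bl arbitrary: ps)
  case Nil
  then show ?case
    by (intro exI[of _ "[]"]) simp
next
  case (Cons a bl)
  obtain n e where a: "a = (n, e)"
    by (cases a)
  obtain v v' ps' where ps: "ps = (v, G ^ (n + e)) # (v', G ^ n) # ps'"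
    and ps': "map snd ps' = concat (map (\<lambda>(n, e). [G ^ (n + e), G ^ n]) bl)"
    using Cons.prems by (auto simp: a Cons_eq_map_conv map_eq_Cons_conv)
  obtain qs where qs: "ps' = exponent_blocks qs" "map (snd \<circ> snd) qs = bl"
    using Cons.IH[OF ps'] by blast
  show ?case
    using qs by (intro exI[of _ "(v, v', n, e) # qs"]) (simp add: ps a comp_def)
qed

lemma map_snd_exponent_blocks:
  "map snd (exponent_blocks qs) =
    concat (map (\<lambda>(n, e). [G ^ (n + e), G ^ n]) (map (snd \<circ> snd) qs))"
  by (induction qs) auto

lemma monic_G_power: "lead_coeff (G ^ n) = 1"
  by (simp add: lead_coeff_power monic_G)

lemma degree_G_power: "degree (G ^ n) = 4 * n"
  using degree_G by (subst degree_power_eq) auto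

lemma represented_by_pair_blocks_iff:
  "(\<exists>bl :: (nat \<times> nat) list. (\<forall>(n, e)\<in>set bl. e \<in> {0, 1}) \<and>
      represented_by scale u (diag_block_mat (map (\<lambda>(n, e). diag_block_mat
        [companion (G ^ (n + e)), companion (G ^ n)]) bl))) \<longleftrightarrow>
   (\<exists>qs. (\<forall>(v, v', n, e)\<in>set qs. e \<le> 1) \<and> cyclic_decomp u (exponent_blocks qs))"
proof -
  define rs where "rs bl = concat (map (\<lambda>(n, e). [G ^ (n + e), G ^ n]) bl)" for bl :: "(nat \<times> nat) list"
  have flat: "diag_block_mat (map (\<lambda>(n, e). diag_block_mat [companion (G ^ (n + e)), companion (G ^ n)]) bl) =
      companions (rs bl)" for bl
  proof -
    have "map (\<lambda>(n, e). diag_block_mat [companion (G ^ (n + e)), companion (G ^ n)]) bl =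
        map diag_block_mat (map (\<lambda>(n, e). [companion (G ^ (n + e)), companion (G ^ n)]) bl)"
      unfolding map_map by (rule map_cong) auto
    moreover have "concat (map (\<lambda>(n, e). [companion (G ^ (n + e)), companion (G ^ n)]) bl) =
        map companion (rs bl)"
      unfolding rs_def map_concat map_map by (rule arg_cong[of _ _ concat], rule map_cong) auto
    ultimately show ?thesis
      by (simp only: diag_block_mat_concat companions_def)
  qed
  have monic: "\<forall>r\<in>set (rs bl). lead_coeff r = 1" for bl
    by (auto simp: rs_def monic_G_power)
  show ?thesis
    unfolding flat represented_by_companions_iff[OF monic]
  proof
    assume "\<exists>bl. (\<forall>(n, e)\<in>set bl. e \<in> {0, 1}) \<and> (\<exists>ps. map snd ps = rs bl \<and> cyclic_decomp u ps)"
    then obtain bl ps where bl: "\<forall>(n, e)\<in>set bl. e \<in> {0, 1}"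
      and ps: "map snd ps = rs bl" "cyclic_decomp u ps"
      by blast
    obtain qs where qs: "ps = exponent_blocks qs" "map (snd \<circ> snd) qs = bl"
      using map_snd_eq_imp_exponent_blocks[OF ps(1)[unfolded rs_def]] by blast
    have "e \<le> 1" if "(v, v', n, e) \<in> set qs" for v v' n e
    proof -
      have "(n, e) \<in> set bl"
        using that unfolding qs(2)[symmetric] by force
      then show ?thesis
        using bl by force
    qed
    then show "\<exists>qs. (\<forall>(v, v', n, e)\<in>set qs. e \<le> 1) \<and> cyclic_decomp u (exponent_blocks qs)"
      using ps(2) qs(1) by blast
  next
    assume "\<exists>qs. (\<forall>(v, v', n, e)\<in>set qs. e \<le> 1) \<and> cyclic_decomp u (exponent_blocks qs)"
    then obtain qs where qs: "\<forall>(v, v', n, e)\<in>set qs. e \<le> 1" "cyclic_decomp u (exponent_blocks qs)"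
      by blast
    have "e \<in> {0, 1}" if "(n, e) \<in> set (map (snd \<circ> snd) qs)" for n e
    proof -
      have "e \<le> 1"
        using that qs(1) by force
      then show ?thesis
        by force
    qed
    then show "\<exists>bl. (\<forall>(n, e)\<in>set bl. e \<in> {0, 1}) \<and> (\<exists>ps. map snd ps = rs bl \<and> cyclic_decomp u ps)"
      using qs(2) map_snd_exponent_blocks[of qs] unfolding rs_def by blast
  qed
qed

text \<open>The minimal polynomial is \<open>r 1\<close>, so all invariant factors divide a power of
  \<open>G\<close> and are powers of \<open>G\<close>; consecutive ones then form the
  blocks.\<close>

lemma invariant_factors_imp_exponent_blocks:
  assumes u: "endo u" and N: "min_poly scale u = G ^ N" and inv: "invariant_factors scale u r"
    and pairs: "\<And>k. 1 \<le> k \<Longrightarrow> r (2 * k) = r (2 * k - 1) \<or> r (2 * k - 1) = r (2 * k) * G"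
  shows "\<exists>qs. (\<forall>(v, v', n, e)\<in>set qs. e \<le> 1) \<and> cyclic_decomp u (exponent_blocks qs)"
proof -
  obtain m ps where r: "\<And>i. 1 \<le> i \<Longrightarrow> lead_coeff (r i) = 1" "\<And>i. 1 \<le> i \<Longrightarrow> r (Suc i) dvd r i"
      "\<And>i. m < i \<Longrightarrow> r i = 1"
    and ps: "map snd ps = map r [1..<Suc m]" "cyclic_decomp u ps"
    using inv unfolding invariant_factors_iff by blast
  have r1: "r 1 = G ^ N"
    using min_poly_invariant_factors[OF u ps(2,1) r] N by simp
  have dvd: "r (Suc i) dvd G ^ N" for i
  proof (induction i)
    case 0
    then show ?case
      using r1 by simp
  next
    case (Suc i)
    then show ?case
      using r(2)[of "Suc i"] dvd_trans by simp
  qed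
  have "\<exists>e. r (Suc i) = G ^ e" for i
    using monic_dvd_irreducible_power[OF G_irred monic_G r(1) dvd] by simp
  then obtain x where x: "r (Suc i) = G ^ x i" for i
    by metis
  \<comment> \<open>The exponent \<open>x i\<close> belongs to \<open>r (Suc i)\<close>, so the pair
    \<open>r (2 * k + 1)\<close>, \<open>r (2 * k + 2)\<close> has the smaller exponent
    \<open>x (Suc (2 * k))\<close>. Taking \<open>m\<close> pairs covers all nontrivial factors for
    either parity of \<open>m\<close>; the surplus ones are 1.\<close>
  define bl where "bl = map (\<lambda>k. (x (Suc (2 * k)), if r (Suc (Suc (2 * k))) = r (Suc (2 * k)) then 0 else 1 :: nat)) [0..<m]"
  have pair: "r (Suc (2 * k)) = G ^ (x (Suc (2 * k)) + (if r (Suc (Suc (2 * k))) = r (Suc (2 * k)) then 0 else 1))"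
    for k
    using pairs[of "Suc k"] x[of "Suc (2 * k)"] by (auto simp: mult.commute)
  have "map r [1..<Suc (2 * n)] = concat (map (\<lambda>k. [r (Suc (2 * k)), r (Suc (Suc (2 * k)))]) [0..<n])" for n
    by (induction n) simp_all
  also have "\<dots> m = concat (map (\<lambda>(n, e). [G ^ (n + e), G ^ n]) bl)"
    unfolding bl_def map_map
    by (rule arg_cong[of _ _ concat], rule map_cong[OF refl]) (use pair x in simp)
  finally have rs: "map r [1..<Suc (2 * m)] = concat (map (\<lambda>(n, e). [G ^ (n + e), G ^ n]) bl)" .
  have "map snd (ps @ replicate m (0, 1)) = map r [1..<Suc (2 * m)]"
  proof (rule nth_equalityI)
    have len: "length ps = m"
      using arg_cong[OF ps(1), of length] by simp
    then show "length (map snd (ps @ replicate m (0, 1))) = length (map r [1..<Suc (2 * m)])"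
      by simp
    fix i assume "i < length (map snd (ps @ replicate m (0, 1)))"
    then have i: "i < 2 * m"
      by (simp add: len)
    have "map r [1..<Suc (2 * m)] ! i = r (Suc i)"
      using i by (simp del: upt_Suc)
    moreover have "map snd (ps @ replicate m (0, 1)) ! i = r (Suc i)"
    proof (cases "i < m")
      case True
      then have "map snd ps ! i = r (Suc i)"
        unfolding ps(1) by (simp del: upt_Suc)
      then show ?thesis
        using True len by (simp add: nth_append)
    next
      case False
      then show ?thesis
        using i len r(3)[of "Suc i"] by (simp add: nth_append)
    qed
    ultimately show "map snd (ps @ replicate m (0, 1)) ! i = map r [1..<Suc (2 * m)] ! i"
      by simp
  qed
  then obtain qs where qs: "ps @ replicate m (0, 1) = exponent_blocks qs" "map (snd \<circ> snd) qs = bl"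
    using map_snd_eq_imp_exponent_blocks[of _ bl] unfolding rs by blast
  have "e \<le> 1" if "(v, v', n, e) \<in> set qs" for v v' n e
  proof -
    have "(n, e) \<in> set bl"
      using that unfolding qs(2)[symmetric] by force
    then show ?thesis
      by (auto simp: bl_def)
  qed
  then show ?thesis
    using cyclic_decomp_append_trivial[OF ps(2), of m] unfolding qs(1) by blast
qed

text \<open>Sorting the exponents downwards gives the divisibility chain. It tears the given pairs
  apart, but by \<open>sorted_pairs_drop_le_1\<close> the neighbours that form the new pairs still
  differ by at most one.\<close>

lemma exponent_blocks_imp_invariant_factors:
  assumes u: "endo u" and qs: "\<forall>(v, v', n, e)\<in>set qs. e \<le> 1" and dec: "cyclic_decomp u (exponent_blocks qs)"
  shows "(\<exists>N. min_poly scale u = G ^ N) \<and> (\<exists>r. invariant_factors scale u r \<and>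
    (\<forall>k\<ge>1. r (2 * k) = r (2 * k - 1) \<or> r (2 * k - 1) = r (2 * k) * G))"
proof -
  \<comment> \<open>The exponent of a power of \<open>G\<close> is recovered from its degree, as
    \<open>G\<close> has degree 4.\<close>
  define key where "key vr = degree (snd vr) div 4" for vr :: "'b \<times> 'a poly"
  define ps where "ps = rev (sort_key key (exponent_blocks qs))"
  define es where "es = map key ps"
  define x where "x i = (if i < length es then es ! i else 0)" for i
  define r where "r i = G ^ x (i - 1)" for i
  define bl where "bl = map (snd \<circ> snd) qs"
  have bl: "\<forall>(n, e)\<in>set bl. e \<le> 1"
    using qs by (force simp: bl_def)
  have dec_ps: "cyclic_decomp u ps"
    by (rule cyclic_decomp_cong_mset[OF _ dec]) (simp add: ps_def)
  have "map key (exponent_blocks qs) = concat (map (\<lambda>(n, e). [n + e, n]) bl)"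
    unfolding bl_def by (induction qs) (auto simp: key_def degree_G_power)
  moreover have "mset es = mset (map key (exponent_blocks qs))"
    by (simp add: es_def ps_def)
  ultimately have mset_es: "mset es = mset (concat (map (\<lambda>(n, e). [n + e, n]) bl))"
    by simp
  have sorted: "sorted (rev es)"
    by (simp add: es_def ps_def rev_map)
  have antimono: "x j \<le> x i" if "i \<le> j" for i j
    using that sorted_rev_nth_mono[OF sorted, of i j] by (simp add: x_def)
  have snd_ps: "snd vr = G ^ key vr" if "vr \<in> set ps" for vr
  proof -
    have "vr \<in> set (exponent_blocks qs)"
      using that by (simp add: ps_def)
    then obtain k where "snd vr = G ^ k"
      unfolding exponent_blocks_def by fastforce
    then show ?thesis
      by (simp add: key_def degree_G_power)
  qed
  have len: "length es = length ps"
    by (simp add: es_def)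
  have map_ps: "map snd ps = map r [1..<Suc (length ps)]"
  proof (rule nth_equalityI)
    fix i assume "i < length (map snd ps)"
    then have i: "i < length ps"
      by simp
    have "snd (ps ! i) = G ^ key (ps ! i)"
      by (rule snd_ps[OF nth_mem[OF i]])
    then show "map snd ps ! i = map r [1..<Suc (length ps)] ! i"
      using i by (simp add: r_def x_def es_def del: upt_Suc)
  qed (simp del: upt_Suc)
  have r: "lead_coeff (r i) = 1" "1 \<le> i \<Longrightarrow> r (Suc i) dvd r i" "length ps < i \<Longrightarrow> r i = 1" for i
  proof -
    show "lead_coeff (r i) = 1"
      by (simp only: r_def monic_G_power)
    show "r (Suc i) dvd r i"
      unfolding r_def by (intro le_imp_power_dvd antimono) simp
    show "r i = 1" if "length ps < i"
    proof -
      have "x (i - 1) = 0"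
        using that by (simp add: x_def len)
      then show ?thesis
        by (simp add: r_def)
    qed
  qed
  have "min_poly scale u = r 1"
    by (rule min_poly_invariant_factors[OF u dec_ps map_ps]) (use r in blast)+
  then have "\<exists>N. min_poly scale u = G ^ N"
    by (auto simp: r_def)
  moreover have "invariant_factors scale u r"
    unfolding invariant_factors_iff using r dec_ps map_ps by blast
  moreover have "r (2 * k) = r (2 * k - 1) \<or> r (2 * k - 1) = r (2 * k) * G" if k: "1 \<le> k" for k
  proof -
    obtain l where l: "k = Suc l"
      using k by (cases k) auto
    have "x (2 * l) \<le> x (Suc (2 * l)) + 1"
      by (rule sorted_pairs_drop_le_1[OF bl mset_es sorted x_def])
    moreover have "x (Suc (2 * l)) \<le> x (2 * l)"
      by (rule antimono) simp
    ultimately have "x (Suc (2 * l)) = x (2 * l) \<or> x (2 * l) = Suc (x (Suc (2 * l)))"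
      by linarith
    then show ?thesis
      by (auto simp: r_def l)
  qed
  ultimately show ?thesis
    by blast
qed

lemma exponent_blocks_nilpotent:
  assumes u: "endo u" and dec: "cyclic_decomp u (exponent_blocks qs)"
  shows "\<exists>N. \<forall>x. ev u (G ^ N) x = 0"
proof -
  define N where "N = sum_list (map (\<lambda>(v, v', n, e). n + e) qs)"
  have "\<forall>r\<in>snd ` set (exponent_blocks qs). r dvd G ^ N"
  proof
    fix r assume "r \<in> snd ` set (exponent_blocks qs)"
    then obtain v v' n e where q: "(v, v', n, e) \<in> set qs" and r: "r = G ^ (n + e) \<or> r = G ^ n"
      unfolding exponent_blocks_def by fastforce
    have "n + e \<in> set (map (\<lambda>(v, v', n, e). n + e) qs)"
      using q by force
    then have "n + e \<le> N"
      unfolding N_def by (rule member_le_sum_list) simp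
    with r show "r dvd G ^ N"
      by (auto intro!: le_imp_power_dvd)
  qed
  then have "annihilates scale (G ^ N) u"
    by (rule annihilates_cyclic_decomp[OF u dec])
  then show ?thesis
    by (auto simp: annihilates_def)
qed

end

theorem theorem4p36:
  fixes scale :: "'a::field \<Rightarrow> 'b::ab_group_add \<Rightarrow> 'b"
    and Basis :: "'b set"
    and p q :: "'a poly"
    and u :: "'b \<Rightarrow> 'b"
  assumes V: "finite_dimensional_vector_space scale Basis"
    and p: "irreducible p" "lead_coeff p = 1" "degree p = 2"
    and q: "irreducible q" "lead_coeff q = 1" "degree q = 2"
    and sep_p: "separable_poly p"
    and insep_q: "\<not> separable_poly q"
    and u: "endomorphism scale u"
  shows
    "(pq_quotient scale p q u \<and> q_exceptional scale p q u \<longleftrightarrow>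
        (\<exists>N. min_poly scale u = G_poly p q ^ N) \<and>
        (\<exists>r. invariant_factors scale u r \<and>
           (\<forall>k\<ge>1. r (2 * k) = r (2 * k - 1) \<or> r (2 * k - 1) = r (2 * k) * G_poly p q))) \<and>
     ((\<exists>N. min_poly scale u = G_poly p q ^ N) \<and>
        (\<exists>r. invariant_factors scale u r \<and>
           (\<forall>k\<ge>1. r (2 * k) = r (2 * k - 1) \<or> r (2 * k - 1) = r (2 * k) * G_poly p q)) \<longleftrightarrow>
        (\<exists>bl :: (nat \<times> nat) list. (\<forall>(n, e)\<in>set bl. e \<in> {0, 1}) \<and>
           represented_by scale u
             (diag_block_mat (map (\<lambda>(n, e). diag_block_mat
                [companion (G_poly p q ^ (n + e)), companion (G_poly p q ^ n)]) bl))))"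
proof -
  interpret Q: quadratic_pair p q
    by (rule quadratic_pair.intro[OF p q sep_p insep_q])
  interpret F: finite_dimensional_vector_space scale Basis
    by (rule V)
  interpret C: char2_quadratics scale Q.\<alpha> Q.\<tau> Q.\<delta> "G_poly p q" p q
  proof (intro char2_quadratics.intro char2_quadratics_axioms.intro plain_vector_space.intro)
    show "vector_space scale"
      by (rule F.vector_space_axioms)
    show "\<exists>B. finite B \<and> module.span scale B = UNIV"
      using F.finite_Basis F.span_Basis by blast
  qed (fact Q.char2 Q.nonzero Q.p_eq Q.q_eq Q.G_eq Q.irreducible_G)+
  have endo: "C.endo u"
    using u by (simp add: endomorphism_def)
  \<comment> \<open>Each of the three conditions is shown equivalent to the existence of such a
    decomposition.\<close>
  define decomposed where "decomposed \<longleftrightarrow>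
    (\<exists>qs. (\<forall>(v, v', n, e)\<in>set qs. e \<le> 1) \<and> C.cyclic_decomp u (C.exponent_blocks qs))"
  obtain bs where "set bs = Basis" "distinct bs"
    using finite_distinct_list[OF F.finite_Basis] by blast
  then have bs: "ordered_basis scale bs"
    using F.independent_Basis F.span_Basis by (simp add: ordered_basis_def)
  have i: "pq_quotient scale p q u \<and> q_exceptional scale p q u \<longleftrightarrow> decomposed"
  proof
    assume *: "pq_quotient scale p q u \<and> q_exceptional scale p q u"
    then have "poly (map_poly to_ac (G_poly p q)) z = 0" if "z \<in> ac_eigenvalues scale u" for z
      using that unfolding Q.root_G_iff q_exceptional_def by blast
    then obtain N where "poly_endo scale (G_poly p q ^ N) u x = 0" for x
      using C.nilpotent_if_eigenvalues_roots[OF endo bs Q.irreducible_G] by blast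
    then show decomposed
      unfolding decomposed_def using C.quotient_imp_exponent_blocks[OF endo] * by blast
  next
    assume decomposed
    then obtain qs where qs: "\<forall>(v, v', n, e)\<in>set qs. e \<le> 1" "C.cyclic_decomp u (C.exponent_blocks qs)"
      unfolding decomposed_def by blast
    obtain N where N: "poly_endo scale (G_poly p q ^ N) u x = 0" for x
      using C.exponent_blocks_nilpotent[OF endo qs(2)] by blast
    have "poly (map_poly to_ac (G_poly p q)) z = 0" if "z \<in> ac_eigenvalues scale u" for z
      using C.eigenvalue_imp_root[OF endo that N] by (simp add: poly_map_to_ac_power)
    then have "q_exceptional scale p q u"
      unfolding q_exceptional_def Q.root_G_iff by blast
    then show "pq_quotient scale p q u \<and> q_exceptional scale p q u"
      using C.exponent_blocks_imp_quotient[OF endo qs N] by blast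
  qed
  have ii: "(\<exists>N. min_poly scale u = G_poly p q ^ N) \<and>
      (\<exists>r. invariant_factors scale u r \<and>
        (\<forall>k\<ge>1. r (2 * k) = r (2 * k - 1) \<or> r (2 * k - 1) = r (2 * k) * G_poly p q)) \<longleftrightarrow> decomposed"
  proof (rule iffI, elim conjE exE)
    fix N r
    assume "min_poly scale u = G_poly p q ^ N" "invariant_factors scale u r"
      "\<forall>k\<ge>1. r (2 * k) = r (2 * k - 1) \<or> r (2 * k - 1) = r (2 * k) * G_poly p q"
    then show decomposed
      unfolding decomposed_def by (intro C.invariant_factors_imp_exponent_blocks[OF endo]) auto
  next
    assume decomposed
    then obtain qs where "\<forall>(v, v', n, e)\<in>set qs. e \<le> 1" "C.cyclic_decomp u (C.exponent_blocks qs)"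
      unfolding decomposed_def by blast
    then show "(\<exists>N. min_poly scale u = G_poly p q ^ N) \<and>
        (\<exists>r. invariant_factors scale u r \<and>
          (\<forall>k\<ge>1. r (2 * k) = r (2 * k - 1) \<or> r (2 * k - 1) = r (2 * k) * G_poly p q))"
      by (rule C.exponent_blocks_imp_invariant_factors[OF endo])
  qed
  show ?thesis
    using i ii C.represented_by_pair_blocks_iff[of u, folded decomposed_def] by argo
qed

end
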